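(* Let $\mathcal{Q}$ be a set of noncommutative polynomials in indeterminates $\{Z_{i,j}\}$, $i\in\{1,\ldots,k\}$, $j\in\{1,\ldots,n_i\}$, with $\mathcal{N}_{\mathcal{Q}}\ne\{0\}$, and let $\mathbf{A}=(A_1,\ldots,A_k)\in B(\mathcal{H})^{n_1}\times_c\cdots\times_cB(\mathcal{H})^{n_k}$, $A_i=(A_{i,1},\ldots,A_{i,n_i})$, be such that each $\sum_{\alpha\in\mathbb{F}_{n_i}^+}a_{i,\alpha}A_{i,\alpha}A_{i,\alpha}^*$ is weakly convergent and $q(\mathbf{A})=0$ for any $q\in\mathcal{Q}$. Then the following statements are equivalent. (i) There exists an invertible operator $Y:\mathcal{H}\to\mathcal{G}$ such that $$A_{i,j}^*=Y^{-1}[(\mathbf{S}_{i,j}^*\otimes I_{\mathcal{H}})|_{\mathcal{G}}]Y$$ for all $i\in\{1,\ldots,k\}$ and $j\in\{1,\ldots,n_i\}$, where $\mathcal{G}\subseteq\mathcal{N}_{\mathcal{Q}}\otimes\mathcal{H}$ is a (closed) subspace invariant under each operator $\mathbf{S}_{i,j}^*\otimes I_{\mathcal{H}}$. (ii) There is an invertible operator $Q\in\mathcal{C}_{\geq}(\mathbf{\Delta}_{\mathbf{f},\mathbf{A}}^{\mathbf{m}})^+$ such that, for each $i\in\{1,\ldots,k\}$, $\Phi_{f_i,A_i}^s(Q)\to0$ weakly as $s\to\infty$. (iii) There exist constants $0<a\leq b$ and a positive operator $R\in B(\mathcal{H})$ such that $$aI\leq\sum_{(s_1,\ldots,s_k)\in\mathbb{Z}_+^k}\binom{s_1+m_1-1}{m_1-1}\cdots\binom{s_k+m_k-1}{m_k-1}\Phi_{f_1,A_1}^{s_1}\circ\cdots\circ\Phi_{f_k,A_k}^{s_k}(R)\leq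 bI.$$ Moreover, under condition (iii), one can choose the invertible operator $Y$ in (i) such that $\|Y\|\|Y^{-1}\|\leq\sqrt{b/a}$.
   Context: Hilbert spaces are complex, $\mathcal{H}$ separable. $\mathbb{N}=\{1,2,\ldots\}$, $\mathbb{Z}_+=\{0,1,\ldots\}$; fix $k\in\mathbb{N}$ and $n_i,m_i\in\mathbb{N}$, $\mathbf{m}=(m_1,\ldots,m_k)$. Order on $\mathbb{Z}_+^k$ is coordinatewise. Series of operators converge in the weak operator topology (WOT). $\mathbb{F}_{n_i}^+$ is the free monoid on generators $g_1^i,\ldots,g_{n_i}^i$ with identity $g_0^i$; $|\alpha|$ is word length. For an $n_i$-tuple $(X_{i,1},\ldots,X_{i,n_i})$ and $\alpha=g^i_{j_1}\cdots g^i_{j_p}$, $X_{i,\alpha}:=X_{i,j_1}\cdots X_{i,j_p}$, $X_{i,g_0^i}:=I$. For $(\alpha)=(\alpha_1,\ldots,\alpha_k)$, $X_{(\alpha)}:=X_{1,\alpha_1}\cdots X_{k,\alpha_k}$. $\mathbf{f}=(f_1,\ldots,f_k)$, where each $f_i=\sum_{\alpha\in\mathbb{F}_{n_i}^+}a_{i,\alpha}Z_{i,\alpha}$ is a positive regular free holomorphic function: a formal power series in noncommuting $Z_{i,1},\ldots,Z_{i,n_i}$ with $a_{i,\alpha}\ge0$, $a_{i,g_0^i}=0$, $a_{i,g_j^i}>0$ for $j=1,\ldots,n_i$, and $\limsup_{p\to\infty}(\sum_{|\alpha|=p}|a_{i,\alpha}|^2)^{1/2p}<\infty$. $B(\mathcal{H})^{n_1}\times_c\cdots\times_cB(\mathcal{H})^{n_k}$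 is the set of tuples $\mathbf{X}=(X_1,\ldots,X_k)$, $X_i=(X_{i,1},\ldots,X_{i,n_i})$, such that for $s\ne t$ the entries of $X_s$ commute with those of $X_t$. $\Phi_{f_i,A_i}(Y):=\sum_\alpha a_{i,\alpha}A_{i,\alpha}YA_{i,\alpha}^*$ (WOT). $\mathbf{\Delta}_{\mathbf{f},\mathbf{A}}^{\mathbf{p}}:=(id-\Phi_{f_1,A_1})^{p_1}\circ\cdots\circ(id-\Phi_{f_k,A_k})^{p_k}$, and $\mathcal{C}_{\ge}(\mathbf{\Delta}_{\mathbf{f},\mathbf{A}}^{\mathbf{m}})^+:=\{X\in B(\mathcal{H}):X\ge0,\ \mathbf{\Delta}_{\mathbf{f},\mathbf{A}}^{\mathbf{p}}(X)\ge0\text{ for }0\le\mathbf{p}\le\mathbf{m}\}$. Universal model: $F^2(H_{n_i})$ is the full Fock space over an $n_i$-dimensional Hilbert space, with orthonormal basis $\{e^i_\alpha\}_{\alpha\in\mathbb{F}_{n_i}^+}$, $e^i_{g_0^i}=1$. Put $b_{i,g_0^i}^{(m_i)}:=1$ and, for $|\alpha|\ge1$, $$b_{i,\alpha}^{(m_i)}:=\sum_{p=1}^{|\alpha|}\ \sum_{\gamma_1\cdots\gamma_p=\alpha,\ |\gamma_1|\ge1,\ldots,|\gamma_p|\ge1}a_{i,\gamma_1}\cdots a_{i,\gamma_p}\binom{p+m_i-1}{m_i-1}.$$ $W_{i,j}e^i_\alpha:=\sqrt{b_{i,\alpha}^{(m_i)}/b_{i,g_j^i\alpha}^{(m_i)}}\,e^i_{g_j^i\alpha}$,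 and $\mathbf{W}_{i,j}:=I\otimes\cdots\otimes W_{i,j}\otimes\cdots\otimes I$ ($W_{i,j}$ in the $i$-th position) on $\bigotimes_{i=1}^kF^2(H_{n_i})$. Polynomials are in the algebra $\mathbb{C}\langle Z_{i,j}\rangle$ where $Z_{s,j}$ and $Z_{t,l}$ commute for $s\neq t$ and are otherwise noncommuting. $\mathcal{M}_{\mathcal{Q}}:=\overline{\mathrm{span}}\{\mathbf{W}_{(\alpha)}q(\mathbf{W})\mathbf{W}_{(\beta)}(\mathbb{C}):(\alpha),(\beta)\in\mathbb{F}_{n_1}^+\times\cdots\times\mathbb{F}_{n_k}^+,\ q\in\mathcal{Q}\}$ (where $\mathbb{C}$ denotes the scalar multiples of the vacuum $1\otimes\cdots\otimes1$), $\mathcal{N}_{\mathcal{Q}}:=[\bigotimes_iF^2(H_{n_i})]\ominus\mathcal{M}_{\mathcal{Q}}$ (throughout assumed $\neq\{0\}$), which is invariant under each $\mathbf{W}_{i,j}^*$; $\mathbf{S}_{i,j}:=P_{\mathcal{N}_{\mathcal{Q}}}\mathbf{W}_{i,j}|_{\mathcal{N}_{\mathcal{Q}}}$. *)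

theory Defs
  imports "HOL-Analysis.Analysis" "HOL-Library.Poly_Mapping" "HOL-Library.FuncSet"
begin

section \<open>Complex Hilbert spaces\<close>

text \<open>The complex inner product is linear in the first argument.\<close>

class complex_inner = real_inner +
  fixes scaleC :: "complex \<Rightarrow> 'a \<Rightarrow> 'a" (infixr "*\<^sub>C" 75)
    and cinner :: "'a \<Rightarrow> 'a \<Rightarrow> complex"
  assumes scaleC_add_right: "c *\<^sub>C (x + y) = c *\<^sub>C x + c *\<^sub>C y"
    and scaleC_add_left: "(c + d) *\<^sub>C x = c *\<^sub>C x + d *\<^sub>C x"
    and scaleC_scaleC: "c *\<^sub>C (d *\<^sub>C x) = (c * d) *\<^sub>C x"
    and scaleR_scaleC: "scaleR r x = complex_of_real r *\<^sub>C x"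
    and cinner_commute: "cinner x y = cnj (cinner y x)"
    and cinner_add_left: "cinner (x + y) z = cinner x z + cinner y z"
    and cinner_scaleC_left: "cinner (c *\<^sub>C x) y = c * cinner x y"
    and inner_eq_Re_cinner: "inner x y = Re (cinner x y)"

class chilbert_space = complex_inner + complete_space

global_interpretation complex_vector:
  vector_space "scaleC :: complex \<Rightarrow> 'a \<Rightarrow> 'a::complex_inner"
  defines csubspace = complex_vector.subspace
    and cspan = complex_vector.span
proof
  fix x :: 'a
  have "1 *\<^sub>C x = scaleR 1 x" by (simp add: scaleR_scaleC)
  then show "1 *\<^sub>C x = x" by simp
qed (simp_all add: scaleC_add_right scaleC_add_left scaleC_scaleC)

instantiation complex :: complex_inner
begin
definition scaleC_complex :: "complex \<Rightarrow> complex \<Rightarrow> complex" where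
  "scaleC_complex c x = c * x"
definition cinner_complex :: "complex \<Rightarrow> complex \<Rightarrow> complex" where
  "cinner_complex x y = x * cnj y"
instance
  by standard (auto simp: scaleC_complex_def cinner_complex_def algebra_simps
      scaleR_conv_of_real inner_complex_def)
end

instance complex :: chilbert_space ..

lemma cinner_self: "cinner x x = complex_of_real ((norm x)\<^sup>2)" for x :: "'a::complex_inner"
proof (rule complex_eqI)
  show "Re (cinner x x) = Re (complex_of_real ((norm x)\<^sup>2))"
    by (simp add: power2_norm_eq_inner inner_eq_Re_cinner)
  show "Im (cinner x x) = Im (complex_of_real ((norm x)\<^sup>2))"
    using arg_cong[OF cinner_commute[of x x], of Im] by simp
qed

lemma cinner_scaleC_right: "cinner x (c *\<^sub>C y) = cnj c * cinner x y"
  for x :: "'a::complex_inner"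
  by (metis cinner_commute cinner_scaleC_left complex_cnj_mult)

lemma norm_scaleC [simp]: "norm (c *\<^sub>C x) = cmod c * norm x" for x :: "'a::complex_inner"
proof -
  have "complex_of_real ((norm (c *\<^sub>C x))\<^sup>2) = complex_of_real ((cmod c * norm x)\<^sup>2)"
    unfolding cinner_self[symmetric] cinner_scaleC_left cinner_scaleC_right
    by (simp add: cinner_self power_mult_distrib complex_norm_square mult.assoc
        del: of_real_power)
  then have "(norm (c *\<^sub>C x))\<^sup>2 = (cmod c * norm x)\<^sup>2"
    using of_real_eq_iff by blast
  then show ?thesis by (simp add: power2_eq_iff_nonneg)
qed

lemma cmod_cinner_le: "cmod (cinner x y) \<le> norm x * norm y" for x :: "'a::complex_inner"
proof (cases "cinner x y = 0")
  case False
  define c where "c = cnj (sgn (cinner x y))"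
  have c: "cmod c = 1" using False by (simp add: c_def norm_sgn)
  have "c * cinner x y = cnj (cinner x y) * cinner x y / complex_of_real (cmod (cinner x y))"
    by (simp add: c_def sgn_eq)
  also have "\<dots> = complex_of_real (cmod (cinner x y))"
    using False complex_norm_square[of "cinner x y"]
    by (simp add: mult.commute[of "cnj (cinner x y)"] power2_eq_square flip: complex_norm_square)
  finally have "c * cinner x y = complex_of_real (cmod (cinner x y))" .
  then have "cmod (cinner x y) = Re (cinner (c *\<^sub>C x) y)"
    by (simp add: cinner_scaleC_left)
  also have "\<dots> = inner (c *\<^sub>C x) y" by (simp add: inner_eq_Re_cinner)
  also have "\<dots> \<le> norm (c *\<^sub>C x) * norm y" by (rule norm_cauchy_schwarz)
  finally show ?thesis by (simp add: c)
qed simp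

section \<open>Square-summable families\<close>

text \<open>\<open>('i, 'h) l2\<close> realizes the Hilbert space tensor product of \<open>\<ell>\<^sup>2('i)\<close> and \<open>'h\<close>.\<close>

typedef (overloaded) ('i, 'h) l2 =
  "{f :: 'i \<Rightarrow> 'h::complex_inner. (\<lambda>i. (norm (f i))\<^sup>2) summable_on UNIV}"
  by (rule exI[of _ "\<lambda>_. 0"]) simp

setup_lifting type_definition_l2

lemma l2_summable: "(\<lambda>i. (norm (Rep_l2 x i))\<^sup>2) summable_on UNIV"
  using Rep_l2[of x] by simp

lemma l2_cinner_abs_summable:
  "(\<lambda>i. norm (cinner (Rep_l2 x i) (Rep_l2 y i))) summable_on UNIV"
proof (rule summable_on_comparison_test)
  show "(\<lambda>i. (norm (Rep_l2 x i))\<^sup>2 + (norm (Rep_l2 y i))\<^sup>2) summable_on UNIV"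
    by (intro summable_on_add l2_summable)
  fix i
  have "2 * (norm (Rep_l2 x i) * norm (Rep_l2 y i))
      \<le> (norm (Rep_l2 x i))\<^sup>2 + (norm (Rep_l2 y i))\<^sup>2"
    using sum_squares_bound[of "norm (Rep_l2 x i)" "norm (Rep_l2 y i)"] by simp
  moreover have "0 \<le> norm (Rep_l2 x i) * norm (Rep_l2 y i)" by simp
  ultimately show "norm (cinner (Rep_l2 x i) (Rep_l2 y i))
      \<le> (norm (Rep_l2 x i))\<^sup>2 + (norm (Rep_l2 y i))\<^sup>2"
    using cmod_cinner_le[of "Rep_l2 x i" "Rep_l2 y i"] by linarith
qed simp

lemma l2_cinner_summable: "(\<lambda>i. cinner (Rep_l2 x i) (Rep_l2 y i)) summable_on UNIV"
  by (rule abs_summable_summable) (rule l2_cinner_abs_summable)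

lemma l2_inner_summable: "(\<lambda>i. inner (Rep_l2 x i) (Rep_l2 y i)) summable_on UNIV"
  unfolding inner_eq_Re_cinner by (rule summable_on_Re) (rule l2_cinner_summable)

lemma square_summable_add:
  fixes f g :: "'i \<Rightarrow> 'h::real_normed_vector"
  assumes "(\<lambda>i. (norm (f i))\<^sup>2) summable_on UNIV" "(\<lambda>i. (norm (g i))\<^sup>2) summable_on UNIV"
  shows "(\<lambda>i. (norm (f i + g i))\<^sup>2) summable_on UNIV"
proof (rule summable_on_comparison_test)
  show "(\<lambda>i. 2 * (norm (f i))\<^sup>2 + 2 * (norm (g i))\<^sup>2) summable_on UNIV"
    by (intro summable_on_add summable_on_cmult_right assms)
  fix i
  have "(norm (f i + g i))\<^sup>2 \<le> (norm (f i) + norm (g i))\<^sup>2"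
    by (intro power_mono norm_triangle_ineq) simp
  also have "\<dots> \<le> 2 * (norm (f i))\<^sup>2 + 2 * (norm (g i))\<^sup>2"
    using sum_squares_bound[of "norm (f i)" "norm (g i)"] by (simp add: power2_sum)
  finally show "(norm (f i + g i))\<^sup>2 \<le> 2 * (norm (f i))\<^sup>2 + 2 * (norm (g i))\<^sup>2" .
qed simp

instantiation l2 :: (type, complex_inner) real_vector
begin

lift_definition zero_l2 :: "('a, 'b) l2" is "\<lambda>_. 0" by simp

lift_definition plus_l2 :: "('a, 'b) l2 \<Rightarrow> ('a, 'b) l2 \<Rightarrow> ('a, 'b) l2"
  is "\<lambda>f g i. f i + g i" by (rule square_summable_add)

lift_definition uminus_l2 :: "('a, 'b) l2 \<Rightarrow> ('a, 'b) l2" is "\<lambda>f i. - f i" by simp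

lift_definition minus_l2 :: "('a, 'b) l2 \<Rightarrow> ('a, 'b) l2 \<Rightarrow> ('a, 'b) l2"
  is "\<lambda>f g i. f i - g i"
  subgoal for f g using square_summable_add[of f "\<lambda>i. - g i"] by simp
  done

lift_definition scaleR_l2 :: "real \<Rightarrow> ('a, 'b) l2 \<Rightarrow> ('a, 'b) l2" is "\<lambda>r f i. r *\<^sub>R f i"
  by (simp add: power_mult_distrib summable_on_cmult_right)

instance
proof
  fix x y z :: "('a, 'b) l2" and r s :: real
  show "x + y + z = x + (y + z)" by transfer (simp add: add.assoc)
  show "x + y = y + x" by transfer (simp add: add.commute)
  show "0 + x = x" by transfer simp
  show "- x + x = 0" by transfer simp
  show "x - y = x + - y" by transfer simp
  show "r *\<^sub>R (x + y) = r *\<^sub>R x + r *\<^sub>R y" by transfer (simp add: scaleR_add_right)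
  show "(r + s) *\<^sub>R x = r *\<^sub>R x + s *\<^sub>R x" by transfer (simp add: scaleR_add_left)
  show "r *\<^sub>R s *\<^sub>R x = (r * s) *\<^sub>R x" by transfer simp
  show "1 *\<^sub>R x = x" by transfer simp
qed

end

instantiation l2 :: (type, complex_inner) real_inner
begin

definition inner_l2 :: "('a, 'b) l2 \<Rightarrow> ('a, 'b) l2 \<Rightarrow> real" where
  "inner_l2 x y = (\<Sum>\<^sub>\<infinity>i. inner (Rep_l2 x i) (Rep_l2 y i))"

definition norm_l2 :: "('a, 'b) l2 \<Rightarrow> real" where
  "norm_l2 x = sqrt (inner x x)"

definition dist_l2 :: "('a, 'b) l2 \<Rightarrow> ('a, 'b) l2 \<Rightarrow> real" where
  "dist_l2 x y = norm (x - y)"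

definition sgn_l2 :: "('a, 'b) l2 \<Rightarrow> ('a, 'b) l2" where
  "sgn_l2 x = x /\<^sub>R norm x"

definition uniformity_l2 :: "(('a, 'b) l2 \<times> ('a, 'b) l2) filter" where
  "uniformity_l2 = (INF e\<in>{0 <..}. principal {(x, y). dist x y < e})"

definition open_l2 :: "('a, 'b) l2 set \<Rightarrow> bool" where
  "open_l2 U = (\<forall>x\<in>U. \<forall>\<^sub>F (x', y) in uniformity. x' = x \<longrightarrow> y \<in> U)"

instance
proof
  fix x y z :: "('a, 'b) l2" and r :: real and U :: "('a, 'b) l2 set"
  show "sgn x = x /\<^sub>R norm x" by (simp add: sgn_l2_def)
  show "dist x y = norm (x - y)" by (simp add: dist_l2_def)
  show "uniformity = (INF e\<in>{0 <..}. principal {(x, y :: ('a, 'b) l2). dist x y < e})"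
    by (simp add: uniformity_l2_def)
  show "open U = (\<forall>x\<in>U. \<forall>\<^sub>F (x', y) in uniformity. x' = x \<longrightarrow> y \<in> U)"
    by (simp add: open_l2_def)
  show "inner x y = inner y x"
    by (simp add: inner_l2_def inner_commute)
  show "inner (x + y) z = inner x z + inner y z"
    by (simp add: inner_l2_def plus_l2.rep_eq inner_add_left infsum_add l2_inner_summable)
  show "inner (r *\<^sub>R x) y = r * inner x y"
    by (simp add: inner_l2_def scaleR_l2.rep_eq infsum_cmult_right')
  show "0 \<le> inner x x" by (simp add: inner_l2_def infsum_nonneg)
  show "(inner x x = 0) = (x = 0)"
  proof
    assume "inner x x = 0"
    then have "inner (Rep_l2 x i) (Rep_l2 x i) = 0" for i
      using l2_inner_summable[of x x] nonneg_infsum_le_0D[of "\<lambda>i. inner (Rep_l2 x i) (Rep_l2 x i)" UNIV i]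
      by (simp add: inner_l2_def)
    then have "Rep_l2 x i = 0" for i by simp
    then have "Rep_l2 x = Rep_l2 0" by (auto simp: zero_l2.rep_eq)
    then show "x = 0" by (simp add: Rep_l2_inject)
  qed (simp add: inner_l2_def zero_l2.rep_eq)
  show "norm x = sqrt (inner x x)" by (simp add: norm_l2_def)
qed

end

instantiation l2 :: (type, complex_inner) complex_inner
begin

lift_definition scaleC_l2 :: "complex \<Rightarrow> ('a, 'b) l2 \<Rightarrow> ('a, 'b) l2" is "\<lambda>c f i. c *\<^sub>C f i"
  by (simp add: power_mult_distrib summable_on_cmult_right)

definition cinner_l2 :: "('a, 'b) l2 \<Rightarrow> ('a, 'b) l2 \<Rightarrow> complex" where
  "cinner_l2 x y = (\<Sum>\<^sub>\<infinity>i. cinner (Rep_l2 x i) (Rep_l2 y i))"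

instance
proof
  fix x y z :: "('a, 'b) l2" and r :: real and c d :: complex
  show "c *\<^sub>C (x + y) = c *\<^sub>C x + c *\<^sub>C y" by transfer (simp add: scaleC_add_right)
  show "(c + d) *\<^sub>C x = c *\<^sub>C x + d *\<^sub>C x" by transfer (simp add: scaleC_add_left)
  show "c *\<^sub>C d *\<^sub>C x = (c * d) *\<^sub>C x" by transfer (simp add: scaleC_scaleC)
  show "r *\<^sub>R x = complex_of_real r *\<^sub>C x" by transfer (simp add: scaleR_scaleC)
  show "cinner x y = cnj (cinner y x)"
    unfolding cinner_l2_def infsum_cnj[symmetric] by (simp add: cinner_commute[symmetric])
  show "cinner (x + y) z = cinner x z + cinner y z"
    by (simp add: cinner_l2_def plus_l2.rep_eq cinner_add_left infsum_add l2_cinner_summable)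
  show "cinner (c *\<^sub>C x) y = c * cinner x y"
    by (simp add: cinner_l2_def scaleC_l2.rep_eq cinner_scaleC_left infsum_cmult_right')
  show "inner x y = Re (cinner x y)"
    by (simp add: cinner_l2_def inner_l2_def inner_eq_Re_cinner infsum_Re l2_cinner_summable)
qed

end

lemma l2_eqI: "(\<And>i. Rep_l2 x i = Rep_l2 y i) \<Longrightarrow> x = y"
  by (simp add: Rep_l2_inject[symmetric] fun_eq_iff)

lemma norm_l2_square: "(norm x)\<^sup>2 = (\<Sum>\<^sub>\<infinity>i. (norm (Rep_l2 x i))\<^sup>2)"
  for x :: "('i, 'h::complex_inner) l2"
  unfolding power2_norm_eq_inner inner_l2_def ..

lemma sum_norm_l2_le: "finite F \<Longrightarrow> (\<Sum>i\<in>F. (norm (Rep_l2 x i))\<^sup>2) \<le> (norm x)\<^sup>2"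
  for x :: "('i, 'h::complex_inner) l2"
  unfolding norm_l2_square by (rule finite_sum_le_infsum) (auto intro: l2_summable)

lemma norm_Rep_l2_le: "norm (Rep_l2 x i) \<le> norm x" for x :: "('i, 'h::complex_inner) l2"
  using sum_norm_l2_le[of "{i}" x] by (simp add: power2_le_iff_abs_le)

instance l2 :: (type, chilbert_space) chilbert_space
proof
  fix X :: "nat \<Rightarrow> ('a, 'b) l2"
  assume X: "Cauchy X"
  define L where "L i = lim (\<lambda>n. Rep_l2 (X n) i)" for i
  have coord: "(\<lambda>n. Rep_l2 (X n) i) \<longlonglongrightarrow> L i" for i
  proof -
    have "Cauchy (\<lambda>n. Rep_l2 (X n) i)"
    proof (rule metric_CauchyI)
      fix e :: real assume "e > 0"
      then obtain M where M: "\<forall>m\<ge>M. \<forall>n\<ge>M. dist (X m) (X n) < e"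
        using metric_CauchyD[OF X] by blast
      have "dist (Rep_l2 (X m) i) (Rep_l2 (X n) i) < e" if "m \<ge> M" "n \<ge> M" for m n
        using M that norm_Rep_l2_le[of "X m - X n" i]
        by (fastforce simp: dist_norm minus_l2.rep_eq)
      then show "\<exists>M. \<forall>m\<ge>M. \<forall>n\<ge>M. dist (Rep_l2 (X m) i) (Rep_l2 (X n) i) < e" by blast
    qed
    then show ?thesis
      unfolding L_def by (simp add: Cauchy_convergent convergent_LIMSEQ_iff[symmetric])
  qed
  have fin: "(\<Sum>i\<in>F. (norm (L i - Rep_l2 (X n) i))\<^sup>2) \<le> e\<^sup>2"
    if e: "e > 0" and F: "finite F" and M: "\<And>m. m \<ge> n \<Longrightarrow> dist (X m) (X n) < e" for e F n
  proof (rule LIMSEQ_le_const2)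
    show "(\<lambda>m. \<Sum>i\<in>F. (norm (Rep_l2 (X m) i - Rep_l2 (X n) i))\<^sup>2)
        \<longlonglongrightarrow> (\<Sum>i\<in>F. (norm (L i - Rep_l2 (X n) i))\<^sup>2)"
      by (intro tendsto_intros coord)
    have "(\<Sum>i\<in>F. (norm (Rep_l2 (X m) i - Rep_l2 (X n) i))\<^sup>2) \<le> e\<^sup>2" if "m \<ge> n" for m
    proof -
      have "(\<Sum>i\<in>F. (norm (Rep_l2 (X m) i - Rep_l2 (X n) i))\<^sup>2) \<le> (norm (X m - X n))\<^sup>2"
        using sum_norm_l2_le[OF F, of "X m - X n"] by (simp add: minus_l2.rep_eq)
      also have "\<dots> \<le> e\<^sup>2"
        using M[OF that] by (intro power_mono) (auto simp: dist_norm)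
      finally show ?thesis .
    qed
    then show "\<exists>N. \<forall>m\<ge>N. (\<Sum>i\<in>F. (norm (Rep_l2 (X m) i - Rep_l2 (X n) i))\<^sup>2) \<le> e\<^sup>2"
      by blast
  qed
  have summ: "(\<lambda>i. (norm (L i - Rep_l2 (X n) i))\<^sup>2) summable_on UNIV"
    if "e > 0" and "\<And>m. m \<ge> n \<Longrightarrow> dist (X m) (X n) < e" for e n
    by (rule nonneg_bdd_above_summable_on)
      (use fin[OF that(1) _ that(2)] in \<open>auto intro!: bdd_aboveI[of _ "e\<^sup>2"]\<close>)
  have ex: "\<exists>N. \<forall>n\<ge>N. \<forall>m\<ge>n. dist (X m) (X n) < e" if "e > 0" for e
    using metric_CauchyD[OF X that] by (meson le_trans)
  obtain N where "\<forall>m\<ge>N. dist (X m) (X N) < 1" using ex[of 1] by auto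
  then have "(\<lambda>i. (norm (L i - Rep_l2 (X N) i))\<^sup>2) summable_on UNIV"
    by (intro summ[of 1]) auto
  from square_summable_add[OF this l2_summable[of "X N"]]
  have "(\<lambda>i. (norm (L i))\<^sup>2) summable_on UNIV" by simp
  then have Rep: "Rep_l2 (Abs_l2 L) = L" by (simp add: Abs_l2_inverse)
  have "X \<longlonglongrightarrow> Abs_l2 L"
  proof (rule metric_LIMSEQ_I)
    fix e :: real assume "e > 0"
    then have e2: "e / 2 > 0" by simp
    from ex[OF e2] obtain N where N: "\<forall>n\<ge>N. \<forall>m\<ge>n. dist (X m) (X n) < e / 2" by blast
    have "dist (X n) (Abs_l2 L) < e" if "n \<ge> N" for n
    proof -
      have M: "\<And>m. m \<ge> n \<Longrightarrow> dist (X m) (X n) < e / 2" using N that by blast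
      have "(norm (Abs_l2 L - X n))\<^sup>2 = (\<Sum>\<^sub>\<infinity>i. (norm (L i - Rep_l2 (X n) i))\<^sup>2)"
        by (simp add: norm_l2_square minus_l2.rep_eq Rep)
      also have "\<dots> \<le> (e / 2)\<^sup>2"
        by (rule infsum_le_finite_sums) (use summ[OF e2 M] fin[OF e2 _ M] in auto)
      finally have "norm (Abs_l2 L - X n) \<le> e / 2"
        using e2 by (simp add: power2_le_iff_abs_le)
      then show ?thesis using \<open>e > 0\<close> by (simp add: dist_norm norm_minus_commute)
    qed
    then show "\<exists>N. \<forall>n\<ge>N. dist (X n) (Abs_l2 L) < e" by blast
  qed
  then show "convergent X" by (rule convergentI)
qed

definition ket :: "'i \<Rightarrow> ('i, complex) l2" where
  "ket i = Abs_l2 (\<lambda>i'. if i' = i then 1 else 0)"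

lemma Rep_ket: "Rep_l2 (ket i) = (\<lambda>i'. if i' = i then 1 else 0)"
  unfolding ket_def
proof (rule Abs_l2_inverse, rule CollectI)
  have "(\<lambda>i'. if i' = i then 1 else 0 :: real) summable_on UNIV"
    using summable_on_cong_neutral[of UNIV "{i}" "\<lambda>i'. if i' = i then 1 else 0 :: real"
        "\<lambda>i'. if i' = i then 1 else 0 :: real"] by simp
  moreover have "(\<lambda>i'. (norm (if i' = i then 1 else 0 :: complex))\<^sup>2)
      = (\<lambda>i'. if i' = i then 1 else 0 :: real)" by auto
  ultimately show "(\<lambda>i'. (norm (if i' = i then 1 else 0 :: complex))\<^sup>2) summable_on UNIV"
    by simp
qed

lift_definition tensor :: "('i, complex) l2 \<Rightarrow> 'h::complex_inner \<Rightarrow> ('i, 'h) l2"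
  (infixl "\<otimes>\<^sub>H" 70) is "\<lambda>x h i. x i *\<^sub>C h"
  by (simp add: power_mult_distrib summable_on_cmult_left)

lemma cinner_tensor: "cinner (x \<otimes>\<^sub>H g) (y \<otimes>\<^sub>H h) = cinner x y * cinner g h"
proof -
  have "cinner (x \<otimes>\<^sub>H g) (y \<otimes>\<^sub>H h)
      = (\<Sum>\<^sub>\<infinity>i. cinner (Rep_l2 x i) (Rep_l2 y i) * cinner g h)"
    unfolding cinner_l2_def
    by (rule infsum_cong)
      (simp add: tensor.rep_eq cinner_scaleC_left cinner_scaleC_right cinner_complex_def)
  also have "\<dots> = cinner x y * cinner g h"
    unfolding cinner_l2_def by (rule infsum_cmult_left')
  finally show ?thesis .
qed

definition tensor_space :: "('i, complex) l2 set \<Rightarrow> ('i, 'h::complex_inner) l2 set" where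
  "tensor_space V = closure (cspan {x \<otimes>\<^sub>H h | x h. x \<in> V})"

section \<open>Operators\<close>

text \<open>
  An operator on a subspace \<open>V\<close> is a function on the ambient type; only its values on \<open>V\<close> are
  meaningful. \<open>bounded_op_on UNIV\<close> is \<open>B(\<H>)\<close>.
\<close>

definition bounded_op_on :: "'a::complex_inner set \<Rightarrow> ('a \<Rightarrow> 'b::complex_inner) \<Rightarrow> bool" where
  "bounded_op_on V T \<longleftrightarrow>
     (\<forall>x\<in>V. \<forall>y\<in>V. T (x + y) = T x + T y) \<and>
     (\<forall>c. \<forall>x\<in>V. T (c *\<^sub>C x) = c *\<^sub>C T x) \<and>
     (\<exists>K. \<forall>x\<in>V. norm (T x) \<le> K * norm x)"

abbreviation bounded_op :: "('a::complex_inner \<Rightarrow> 'b::complex_inner) \<Rightarrow> bool" where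
  "bounded_op \<equiv> bounded_op_on UNIV"

text \<open>For \<open>V = UNIV\<close> this is \<^const>\<open>onorm\<close>.\<close>

definition opnorm_on :: "'a::complex_inner set \<Rightarrow> ('a \<Rightarrow> 'b::complex_inner) \<Rightarrow> real" where
  "opnorm_on V T = (SUP x\<in>V. norm (T x) / norm x)"

definition invertible_op ::
    "'a::complex_inner set \<Rightarrow> 'b::complex_inner set \<Rightarrow> ('a \<Rightarrow> 'b) \<Rightarrow> bool" where
  "invertible_op V U T \<longleftrightarrow>
     bounded_op_on V T \<and> bij_betw T V U \<and> bounded_op_on U (inv_into V T)"

definition adjoint_on :: "'a::complex_inner set \<Rightarrow> ('a \<Rightarrow> 'a) \<Rightarrow> 'a \<Rightarrow> 'a" where
  "adjoint_on V T y = (THE z. z \<in> V \<and> (\<forall>x\<in>V. cinner (T x) y = cinner x z))"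

abbreviation adj :: "('a::complex_inner \<Rightarrow> 'a) \<Rightarrow> 'a \<Rightarrow> 'a" where
  "adj \<equiv> adjoint_on UNIV"

definition orth_proj :: "'a::complex_inner set \<Rightarrow> 'a \<Rightarrow> 'a" where
  "orth_proj V x = (THE p. p \<in> V \<and> (\<forall>y\<in>V. cinner (x - p) y = 0))"

text \<open>\<open>T \<otimes> I\<close> on \<open>V \<otimes> \<H>\<close>: the values on \<open>tensor_space V\<close> are unique since elementary
  tensors have dense span.\<close>

definition tensor_id ::
    "('i, complex) l2 set \<Rightarrow> (('i, complex) l2 \<Rightarrow> ('i, complex) l2) \<Rightarrow>
     ('i, 'h::complex_inner) l2 \<Rightarrow> ('i, 'h) l2" where
  "tensor_id V T = (SOME F. bounded_op_on (tensor_space V) F \<and>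
     (\<forall>x\<in>V. \<forall>h. F (x \<otimes>\<^sub>H h) = T x \<otimes>\<^sub>H h))"

definition positive_op :: "('h::complex_inner \<Rightarrow> 'h) \<Rightarrow> bool" where
  "positive_op T \<longleftrightarrow> bounded_op T \<and> (\<forall>x. cinner (T x) x \<in> \<real> \<and> 0 \<le> Re (cinner (T x) x))"

definition op_le :: "('h::complex_inner \<Rightarrow> 'h) \<Rightarrow> ('h \<Rightarrow> 'h) \<Rightarrow> bool" where
  "op_le S T \<longleftrightarrow> positive_op (\<lambda>x. T x - S x)"

text \<open>All operator series below have positive terms, or terms dominated by such a series, so that
  convergence in the weak operator topology does not depend on the order of summation.\<close>

definition wot_has_sum ::
    "('i \<Rightarrow> 'h::complex_inner \<Rightarrow> 'h) \<Rightarrow> 'i set \<Rightarrow> ('h \<Rightarrow> 'h) \<Rightarrow> bool" where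
  "wot_has_sum f I T \<longleftrightarrow> bounded_op T \<and>
     (\<forall>x y. ((\<lambda>i. cinner (f i x) y) has_sum cinner (T x) y) I)"

definition wot_infsum :: "('i \<Rightarrow> 'h::complex_inner \<Rightarrow> 'h) \<Rightarrow> 'i set \<Rightarrow> 'h \<Rightarrow> 'h" where
  "wot_infsum f I = (THE T. wot_has_sum f I T)"

definition wot_tendsto_zero :: "(nat \<Rightarrow> 'h::complex_inner \<Rightarrow> 'h) \<Rightarrow> bool" where
  "wot_tendsto_zero f \<longleftrightarrow> (\<forall>x y. (\<lambda>s. cinner (f s x) y) \<longlonglongrightarrow> 0)"

section \<open>Words and noncommutative polynomials\<close>

text \<open>
  The word \<open>g\<^sub>j\<^sub>1 \<dots> g\<^sub>j\<^sub>p\<close> in the free monoid on \<open>n\<close> generators is the list \<open>[j1, \<dots>, jp]\<close> in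
  \<open>lists {1..n}\<close>.
\<close>

type_synonym mword = "nat \<Rightarrow> nat list"

definition mwords :: "nat \<Rightarrow> (nat \<Rightarrow> nat) \<Rightarrow> mword set" where
  "mwords k n = (\<Pi>\<^sub>E i\<in>{1..k}. lists {1..n i})"

definition word_op :: "(nat \<Rightarrow> 'v \<Rightarrow> 'v) \<Rightarrow> nat list \<Rightarrow> 'v \<Rightarrow> 'v" where
  "word_op X w = foldr (\<lambda>j T. X j \<circ> T) w id"

definition ordered_comp :: "nat \<Rightarrow> (nat \<Rightarrow> 'v \<Rightarrow> 'v) \<Rightarrow> 'v \<Rightarrow> 'v" where
  "ordered_comp k F = foldr (\<lambda>i T. F i \<circ> T) [1..<Suc k] id"

definition mword_op :: "nat \<Rightarrow> (nat \<Rightarrow> nat \<Rightarrow> 'v \<Rightarrow> 'v) \<Rightarrow> mword \<Rightarrow> 'v \<Rightarrow> 'v" where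
  "mword_op k X \<alpha> = ordered_comp k (\<lambda>i. word_op (X i) (\<alpha> i))"

text \<open>Since \<open>Z\<^sub>s\<^sub>,\<^sub>j\<close> and \<open>Z\<^sub>t\<^sub>,\<^sub>l\<close> commute for \<open>s \<noteq> t\<close>, the monomials are exactly the
  \<open>Z\<^sub>(\<^sub>\<alpha>\<^sub>)\<close> with \<open>(\<alpha>) \<in> mwords k n\<close>.\<close>

type_synonym ncpoly = "mword \<Rightarrow>\<^sub>0 complex"

definition ncpolys :: "nat \<Rightarrow> (nat \<Rightarrow> nat) \<Rightarrow> ncpoly set" where
  "ncpolys k n = {q. Poly_Mapping.keys q \<subseteq> mwords k n}"

definition poly_op ::
    "nat \<Rightarrow> (nat \<Rightarrow> nat \<Rightarrow> 'v \<Rightarrow> 'v) \<Rightarrow> ncpoly \<Rightarrow> 'v \<Rightarrow> 'v::complex_inner" where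
  "poly_op k X q v =
     (\<Sum>\<alpha>\<in>Poly_Mapping.keys q. Poly_Mapping.lookup q \<alpha> *\<^sub>C mword_op k X \<alpha> v)"

text \<open>The free holomorphic function \<open>\<Sum>\<^sub>\<alpha> a\<^sub>\<alpha> Z\<^sub>\<alpha>\<close> is given by its coefficients on
  \<open>lists {1..n}\<close>.\<close>

definition positive_regular :: "nat \<Rightarrow> (nat list \<Rightarrow> real) \<Rightarrow> bool" where
  "positive_regular n a \<longleftrightarrow>
     (\<forall>\<alpha>\<in>lists {1..n}. 0 \<le> a \<alpha>) \<and> a [] = 0 \<and> (\<forall>j\<in>{1..n}. 0 < a [j]) \<and>
     limsup (\<lambda>p. ereal ((\<Sum>\<alpha> | \<alpha> \<in> lists {1..n} \<and> length \<alpha> = p. \<bar>a \<alpha>\<bar>\<^sup>2)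
       powr (1 / (2 * real p)))) < \<infinity>"

section \<open>The universal model\<close>

text \<open>The full Fock space over an \<open>n\<close>-dimensional space is realized as \<open>\<ell>\<^sup>2(lists {1..n})\<close>, and the
  tensor product of the Fock spaces as \<open>\<ell>\<^sup>2(mwords k n)\<close>; the basis vectors are the \<^const>\<open>ket\<close>s.\<close>

definition fock_tensor :: "nat \<Rightarrow> (nat \<Rightarrow> nat) \<Rightarrow> (mword, complex) l2 set" where
  "fock_tensor k n = {\<xi>. \<forall>\<alpha>. \<alpha> \<notin> mwords k n \<longrightarrow> Rep_l2 \<xi> \<alpha> = 0}"

definition tensor_vec ::
    "nat \<Rightarrow> (nat \<Rightarrow> nat) \<Rightarrow> (nat \<Rightarrow> (nat list, complex) l2) \<Rightarrow> (mword, complex) l2" where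
  "tensor_vec k n x = Abs_l2 (\<lambda>\<alpha>. if \<alpha> \<in> mwords k n then \<Prod>i=1..k. Rep_l2 (x i) (\<alpha> i) else 0)"

lemma Rep_tensor_vec:
  "Rep_l2 (tensor_vec k n x)
     = (\<lambda>\<alpha>. if \<alpha> \<in> mwords k n then \<Prod>i=1..k. Rep_l2 (x i) (\<alpha> i) else 0)" (is "_ = ?f")
  unfolding tensor_vec_def
proof (rule Abs_l2_inverse, rule CollectI, rule nonneg_bdd_above_summable_on)
  show "bdd_above (sum (\<lambda>\<alpha>. (norm (?f \<alpha>))\<^sup>2) ` {F. F \<subseteq> UNIV \<and> finite F})"
  proof (rule bdd_aboveI, clarify)
    fix F :: "mword set"
    assume "finite F"
    define B where "B i = (\<lambda>\<alpha>. \<alpha> i) ` F" for i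
    define G where "G = (\<Pi>\<^sub>E i\<in>{1..k}. B i)"
    have fin: "finite (B i)" for i using \<open>finite F\<close> by (simp add: B_def)
    then have "finite G" unfolding G_def by (intro finite_PiE) auto
    have "(\<Sum>\<alpha>\<in>F. (norm (?f \<alpha>))\<^sup>2)
        = (\<Sum>\<alpha>\<in>F \<inter> mwords k n. \<Prod>i=1..k. (norm (Rep_l2 (x i) (\<alpha> i)))\<^sup>2)"
      using \<open>finite F\<close>
      by (intro sum.mono_neutral_cong_right)
        (auto simp: norm_mult prod_norm[symmetric] prod_power_distrib)
    also have "\<dots> \<le> (\<Sum>\<alpha>\<in>G. \<Prod>i=1..k. (norm (Rep_l2 (x i) (\<alpha> i)))\<^sup>2)"
    proof (rule sum_mono2[OF \<open>finite G\<close>])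
      show "F \<inter> mwords k n \<subseteq> G"
        by (auto simp: G_def B_def mwords_def PiE_iff)
    qed (simp add: prod_nonneg)
    also have "\<dots> = (\<Prod>i=1..k. \<Sum>w\<in>B i. (norm (Rep_l2 (x i) w))\<^sup>2)"
      unfolding G_def using fin by (intro prod_sum_PiE[symmetric]) auto
    also have "\<dots> \<le> (\<Prod>i=1..k. (norm (x i))\<^sup>2)"
      by (intro prod_mono) (auto intro!: sum_nonneg sum_norm_l2_le fin)
    finally show "(\<Sum>\<alpha>\<in>F. (norm (?f \<alpha>))\<^sup>2) \<le> (\<Prod>i=1..k. (norm (x i))\<^sup>2)" .
  qed
qed simp

definition bcoef :: "(nat list \<Rightarrow> real) \<Rightarrow> nat \<Rightarrow> nat list \<Rightarrow> real" where
  "bcoef a m \<alpha> = (if \<alpha> = [] then 1 else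
     \<Sum>p=1..length \<alpha>. \<Sum>\<gamma> | length \<gamma> = p \<and> concat \<gamma> = \<alpha> \<and> [] \<notin> set \<gamma>.
       prod_list (map a \<gamma>) * real ((p + m - 1) choose (m - 1)))"

text \<open>The continuous linear extension of
  \<open>e\<^sub>\<alpha> \<mapsto> sqrt (b\<^sub>\<alpha> / b\<^bsub>g\<^sub>j \<alpha>\<^esub>) e\<^bsub>g\<^sub>j \<alpha>\<^esub>\<close>.\<close>

definition weighted_shift ::
    "nat \<Rightarrow> (nat list \<Rightarrow> real) \<Rightarrow> nat \<Rightarrow> nat \<Rightarrow> (nat list, complex) l2 \<Rightarrow> (nat list, complex) l2"
  where "weighted_shift n a m j \<xi> =
    (\<Sum>\<^sub>\<infinity>\<alpha>\<in>lists {1..n}.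
       Rep_l2 \<xi> \<alpha> *\<^sub>C complex_of_real (sqrt (bcoef a m \<alpha> / bcoef a m (j # \<alpha>))) *\<^sub>C ket (j # \<alpha>))"

text \<open>\<open>I \<otimes> \<cdots> \<otimes> T \<otimes> \<cdots> \<otimes> I\<close> with \<open>T\<close> in position \<open>i\<close>, determined by its values on the
  orthonormal basis \<open>e\<^sub>\<alpha>\<^sub>1 \<otimes> \<cdots> \<otimes> e\<^sub>\<alpha>\<^sub>k\<close>.\<close>

definition at_position ::
    "nat \<Rightarrow> (nat \<Rightarrow> nat) \<Rightarrow> nat \<Rightarrow> ((nat list, complex) l2 \<Rightarrow> (nat list, complex) l2) \<Rightarrow>
     (mword, complex) l2 \<Rightarrow> (mword, complex) l2" where
  "at_position k n i T \<xi> = (\<Sum>\<^sub>\<infinity>\<alpha>\<in>mwords k n.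
     Rep_l2 \<xi> \<alpha> *\<^sub>C tensor_vec k n ((\<lambda>l. ket (\<alpha> l))(i := T (ket (\<alpha> i)))))"

definition model_W ::
    "nat \<Rightarrow> (nat \<Rightarrow> nat) \<Rightarrow> (nat \<Rightarrow> nat) \<Rightarrow> (nat \<Rightarrow> nat list \<Rightarrow> real) \<Rightarrow> nat \<Rightarrow> nat \<Rightarrow>
     (mword, complex) l2 \<Rightarrow> (mword, complex) l2" where
  "model_W k n m a i j = at_position k n i (weighted_shift (n i) (a i) (m i) j)"

lemma infsum_ket:
  fixes f :: "'i \<Rightarrow> 'h::complex_inner"
  assumes "\<alpha> \<in> S"
  shows "(\<Sum>\<^sub>\<infinity>\<beta>\<in>S. Rep_l2 (ket \<alpha>) \<beta> *\<^sub>C f \<beta>) = f \<alpha>"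
proof -
  have "(\<Sum>\<^sub>\<infinity>\<beta>\<in>S. Rep_l2 (ket \<alpha>) \<beta> *\<^sub>C f \<beta>) = (\<Sum>\<^sub>\<infinity>\<beta>\<in>{\<alpha>}. f \<beta>)"
    using assms by (intro infsum_cong_neutral) (auto simp: Rep_ket)
  then show ?thesis by simp
qed

lemma weighted_shift_ket:
  assumes "\<alpha> \<in> lists {1..n}"
  shows "weighted_shift n a m j (ket \<alpha>) =
    complex_of_real (sqrt (bcoef a m \<alpha> / bcoef a m (j # \<alpha>))) *\<^sub>C ket (j # \<alpha>)"
  unfolding weighted_shift_def by (rule infsum_ket) (rule assms)

lemma tensor_vec_ket:
  assumes "\<alpha> \<in> mwords k n"
  shows "tensor_vec k n (\<lambda>l. ket (\<alpha> l)) = ket \<alpha>"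
proof (rule l2_eqI)
  fix \<beta>
  have "(\<forall>i\<in>{1..k}. \<beta> i = \<alpha> i) \<longleftrightarrow> \<beta> = \<alpha>" if "\<beta> \<in> mwords k n"
    using that assms unfolding mwords_def by (metis PiE_ext)
  moreover have "(\<Prod>i=1..k. if \<beta> i = \<alpha> i then 1 else 0 :: complex)
      = (if \<forall>i\<in>{1..k}. \<beta> i = \<alpha> i then 1 else 0)"
    by (auto simp del: atLeastAtMost_iff intro!: prod.neutral)
  ultimately show "Rep_l2 (tensor_vec k n (\<lambda>l. ket (\<alpha> l))) \<beta> = Rep_l2 (ket \<alpha>) \<beta>"
    using assms by (auto simp: Rep_tensor_vec Rep_ket)
qed

lemma tensor_vec_scaleC:
  assumes "i \<in> {1..k}"
  shows "tensor_vec k n (x(i := c *\<^sub>C y)) = c *\<^sub>C tensor_vec k n (x(i := y))"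
proof (rule l2_eqI)
  fix \<beta>
  have *: "(\<Prod>l=1..k. Rep_l2 ((x(i := z)) l) (\<beta> l))
      = Rep_l2 z (\<beta> i) * (\<Prod>l\<in>{1..k} - {i}. Rep_l2 (x l) (\<beta> l))" for z
    by (subst prod.remove[OF _ assms]) (auto intro!: prod.cong)
  show "Rep_l2 (tensor_vec k n (x(i := c *\<^sub>C y))) \<beta>
      = Rep_l2 (c *\<^sub>C tensor_vec k n (x(i := y))) \<beta>"
    unfolding scaleC_l2.rep_eq Rep_tensor_vec * by (simp add: scaleC_complex_def)
qed

lemma model_W_ket:
  assumes "\<alpha> \<in> mwords k n" "i \<in> {1..k}" "j \<in> {1..n i}"
  shows "model_W k n m a i j (ket \<alpha>) =
    complex_of_real (sqrt (bcoef (a i) (m i) (\<alpha> i) / bcoef (a i) (m i) (j # \<alpha> i)))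
      *\<^sub>C ket (\<alpha>(i := j # \<alpha> i))"
proof -
  have \<alpha>i: "\<alpha> i \<in> lists {1..n i}" using assms(1,2) by (auto simp: mwords_def)
  have "\<alpha>(i := j # \<alpha> i) \<in> mwords k n"
    using assms \<alpha>i by (auto simp: mwords_def PiE_iff extensional_def)
  from tensor_vec_ket[OF this]
  have "tensor_vec k n ((\<lambda>l. ket (\<alpha> l))(i := ket (j # \<alpha> i))) = ket (\<alpha>(i := j # \<alpha> i))"
    by (simp add: fun_upd_def if_distrib[of ket])
  then show ?thesis
    unfolding model_W_def at_position_def
    by (subst infsum_ket[OF assms(1)])
      (simp add: weighted_shift_ket[OF \<alpha>i] tensor_vec_scaleC[OF assms(2)])
qed

definition vacuum :: "nat \<Rightarrow> (mword, complex) l2" where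
  "vacuum k = ket (\<lambda>i\<in>{1..k}. [])"

definition model_M ::
    "nat \<Rightarrow> (nat \<Rightarrow> nat) \<Rightarrow> (nat \<Rightarrow> nat) \<Rightarrow> (nat \<Rightarrow> nat list \<Rightarrow> real) \<Rightarrow> ncpoly set \<Rightarrow>
     (mword, complex) l2 set" where
  "model_M k n m a Q = closure (cspan
     {mword_op k (model_W k n m a) \<alpha> (poly_op k (model_W k n m a) q
        (mword_op k (model_W k n m a) \<beta> (c *\<^sub>C vacuum k))) | \<alpha> \<beta> q c.
      \<alpha> \<in> mwords k n \<and> \<beta> \<in> mwords k n \<and> q \<in> Q})"

definition model_N ::
    "nat \<Rightarrow> (nat \<Rightarrow> nat) \<Rightarrow> (nat \<Rightarrow> nat) \<Rightarrow> (nat \<Rightarrow> nat list \<Rightarrow> real) \<Rightarrow> ncpoly set \<Rightarrow>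
     (mword, complex) l2 set" where
  "model_N k n m a Q = {\<xi> \<in> fock_tensor k n. \<forall>\<eta>\<in>model_M k n m a Q. cinner \<xi> \<eta> = 0}"

definition model_S ::
    "nat \<Rightarrow> (nat \<Rightarrow> nat) \<Rightarrow> (nat \<Rightarrow> nat) \<Rightarrow> (nat \<Rightarrow> nat list \<Rightarrow> real) \<Rightarrow> ncpoly set \<Rightarrow>
     nat \<Rightarrow> nat \<Rightarrow> (mword, complex) l2 \<Rightarrow> (mword, complex) l2" where
  "model_S k n m a Q i j \<xi> = orth_proj (model_N k n m a Q) (model_W k n m a i j \<xi>)"

definition model_S_adj_id ::
    "nat \<Rightarrow> (nat \<Rightarrow> nat) \<Rightarrow> (nat \<Rightarrow> nat) \<Rightarrow> (nat \<Rightarrow> nat list \<Rightarrow> real) \<Rightarrow> ncpoly set \<Rightarrow>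
     nat \<Rightarrow> nat \<Rightarrow> (mword, 'h::complex_inner) l2 \<Rightarrow> (mword, 'h) l2" where
  "model_S_adj_id k n m a Q i j =
     tensor_id (model_N k n m a Q) (adjoint_on (model_N k n m a Q) (model_S k n m a Q i j))"

section \<open>Completely positive maps and the defect operators\<close>

definition Phi ::
    "nat \<Rightarrow> (nat list \<Rightarrow> real) \<Rightarrow> (nat \<Rightarrow> 'h \<Rightarrow> 'h) \<Rightarrow> ('h \<Rightarrow> 'h) \<Rightarrow> 'h \<Rightarrow> 'h::complex_inner" where
  "Phi n a A Y =
     wot_infsum (\<lambda>\<alpha> x. a \<alpha> *\<^sub>R word_op A \<alpha> (Y (adj (word_op A \<alpha>) x))) (lists {1..n})"

definition Delta ::
    "nat \<Rightarrow> (nat \<Rightarrow> nat) \<Rightarrow> (nat \<Rightarrow> nat list \<Rightarrow> real) \<Rightarrow> (nat \<Rightarrow> nat \<Rightarrow> 'h \<Rightarrow> 'h) \<Rightarrow> (nat \<Rightarrow> nat) \<Rightarrow>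
     ('h \<Rightarrow> 'h) \<Rightarrow> 'h \<Rightarrow> 'h::complex_inner" where
  "Delta k n a A p =
     ordered_comp k (\<lambda>i. (\<lambda>Y x. Y x - Phi (n i) (a i) (A i) Y x) ^^ p i)"

definition cone_ge ::
    "nat \<Rightarrow> (nat \<Rightarrow> nat) \<Rightarrow> (nat \<Rightarrow> nat) \<Rightarrow> (nat \<Rightarrow> nat list \<Rightarrow> real) \<Rightarrow>
     (nat \<Rightarrow> nat \<Rightarrow> 'h \<Rightarrow> 'h) \<Rightarrow> ('h \<Rightarrow> 'h::complex_inner) set" where
  "cone_ge k n m a A = {X. positive_op X \<and>
     (\<forall>p. (\<forall>i\<in>{1..k}. p i \<le> m i) \<longrightarrow> positive_op (Delta k n a A p X))}"

definition commuting_tuples ::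
    "nat \<Rightarrow> (nat \<Rightarrow> nat) \<Rightarrow> (nat \<Rightarrow> nat \<Rightarrow> 'h \<Rightarrow> 'h::complex_inner) set" where
  "commuting_tuples k n = {X.
     (\<forall>i\<in>{1..k}. \<forall>j\<in>{1..n i}. bounded_op (X i j)) \<and>
     (\<forall>s\<in>{1..k}. \<forall>t\<in>{1..k}. s \<noteq> t \<longrightarrow>
        (\<forall>j\<in>{1..n s}. \<forall>l\<in>{1..n t}. X s j \<circ> X t l = X t l \<circ> X s j))}"

definition model_similarity ::
    "nat \<Rightarrow> (nat \<Rightarrow> nat) \<Rightarrow> (nat \<Rightarrow> nat) \<Rightarrow> (nat \<Rightarrow> nat list \<Rightarrow> real) \<Rightarrow> ncpoly set \<Rightarrow>
     (nat \<Rightarrow> nat \<Rightarrow> 'h \<Rightarrow> 'h) \<Rightarrow> (mword, 'h::complex_inner) l2 set \<Rightarrow> ('h \<Rightarrow> (mword, 'h) l2) \<Rightarrow> bool"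
  where
  "model_similarity k n m a Q A G Y \<longleftrightarrow>
     G \<subseteq> tensor_space (model_N k n m a Q) \<and> csubspace G \<and> closed G \<and>
     (\<forall>i\<in>{1..k}. \<forall>j\<in>{1..n i}. model_S_adj_id k n m a Q i j ` G \<subseteq> G) \<and>
     invertible_op UNIV G Y \<and>
     (\<forall>i\<in>{1..k}. \<forall>j\<in>{1..n i}.
        adj (A i j) = inv_into UNIV Y \<circ> model_S_adj_id k n m a Q i j \<circ> Y)"

definition series_bounds ::
    "nat \<Rightarrow> (nat \<Rightarrow> nat) \<Rightarrow> (nat \<Rightarrow> nat) \<Rightarrow> (nat \<Rightarrow> nat list \<Rightarrow> real) \<Rightarrow>
     (nat \<Rightarrow> nat \<Rightarrow> 'h \<Rightarrow> 'h) \<Rightarrow> real \<Rightarrow> real \<Rightarrow> ('h \<Rightarrow> 'h::complex_inner) \<Rightarrow> bool" where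
  "series_bounds k n m a A c d R \<longleftrightarrow> 0 < c \<and> c \<le> d \<and> positive_op R \<and>
     (\<exists>T. wot_has_sum
        (\<lambda>s x. (\<Prod>i=1..k. real ((s i + m i - 1) choose (m i - 1))) *\<^sub>R
           ordered_comp k (\<lambda>i. Phi (n i) (a i) (A i) ^^ s i) R x)
        (\<Pi>\<^sub>E i\<in>{1..k}. UNIV) T \<and>
      op_le (\<lambda>x. c *\<^sub>R x) T \<and> op_le T (\<lambda>x. d *\<^sub>R x))"

end

theory Submission
  imports Defs
begin

text \<open>
  A positive operator \<open>X\<close> is replaced by its quadratic form \<open>x \<mapsto> \<langle>X x, x\<rangle>\<close> with values in
  \<open>[0, \<infinity>]\<close>. On such forms \<open>\<Phi>\<^sub>i\<close> becomes the countably additive map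
  \<open>q \<mapsto> \<Sum>\<^sub>\<alpha> a\<^sub>i\<^sub>,\<^sub>\<alpha> q (A\<^sub>i\<^sub>,\<^sub>\<alpha>\<^sup>* x)\<close>, all sums may be rearranged, and the series in (iii) is both the
  product of the powers \<open>(\<Sum>\<^sub>s \<Phi>\<^sub>i\<^sup>s)\<^bsup>m\<^sub>i\<^esup>\<close> applied to \<open>R\<close> and the sum
  \<open>\<Sum>\<^sub>\<alpha> b\<^sub>\<alpha> \<langle>R A\<^sub>\<alpha>\<^sup>* x, A\<^sub>\<alpha>\<^sup>* x\<rangle>\<close>. The first description gives (ii) from (iii), since
  \<open>id - \<Phi>\<^sub>i\<close> cancels one factor, and (iii) from (ii) with \<open>R = \<Delta>\<^sup>m(Q)\<close>, by telescoping. By the second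
  one, a factorization \<open>R = D\<^sup>* D\<close> makes the noncommutative Berezin kernel
  \<open>x \<mapsto> \<Sum>\<^sub>\<alpha> sqrt b\<^sub>\<alpha> e\<^sub>\<alpha> \<otimes> D A\<^sub>\<alpha>\<^sup>* x\<close> bounded above and below; it intertwines \<open>A\<^sub>i\<^sub>,\<^sub>j\<^sup>*\<close> with
  \<open>S\<^sub>i\<^sub>,\<^sub>j\<^sup>* \<otimes> I\<close>, which gives (i). Conversely, a similarity \<open>Y\<close> gives (iii) with
  \<open>\<langle>R x, x\<rangle>\<close> the squared norm of the vacuum coordinate of \<open>Y x\<close>.
\<close>

section \<open>Complex Hilbert spaces\<close>

text \<open>Values in [0, infinity] settle convergence but cost subtraction, so z = (id - F) p is
  written p = z + F p. Operators return through boundedness: finite values can be subtracted, and a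
  series of positive forms with a quadratic upper bound is again the form of an operator. In (ii) to
  (iii), decay of the powers is assumed for Q alone, whereas the telescoping happens at partially
  differenced operators; these are positive by the cone condition at a suitable exponent tuple and
  dominated by Q, so they inherit the decay. The factor D comes from the binomial series of sqrt (1
  - t) after rescaling. The kernel lands in N_Q tensor H because pairing a slice of it with a
  generator of M_Q produces a factor q(A)^*, which vanishes. The squared norm of the kernel at x is
  exactly the series in (iii) at x, which explains the constant sqrt (b/a). Conversely, the vacuum
  coordinate suffices because the adjoint of W_(\<gamma>) carries the coordinate at \<gamma> to the
  vacuum with factor 1 / sqrt b_\<gamma>.\<close>

instance chilbert_space \<subseteq> banach ..

lemma cinner_add_right: "cinner x (y + z) = cinner x y + cinner x z"
  for x :: "'a::complex_inner"
  by (metis cinner_add_left cinner_commute complex_cnj_add)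

lemma cinner_scaleR_left: "cinner (r *\<^sub>R x) y = r *\<^sub>R cinner x y"
  for x :: "'a::complex_inner"
  by (simp add: scaleR_scaleC[where 'a='a] cinner_scaleC_left scaleR_conv_of_real)

lemma cinner_scaleR_right: "cinner x (r *\<^sub>R y) = r *\<^sub>R cinner x y"
  for x :: "'a::complex_inner"
  by (simp add: scaleR_scaleC[where 'a='a] cinner_scaleC_right scaleR_conv_of_real)

lemma bounded_bilinear_cinner: "bounded_bilinear (cinner :: 'a::complex_inner \<Rightarrow> 'a \<Rightarrow> complex)"
  by standard
    (auto simp: cinner_add_left cinner_add_right cinner_scaleR_left cinner_scaleR_right
      intro!: exI[of _ 1] cmod_cinner_le)

lemmas cinner_zero_left [simp] = bounded_bilinear.zero_left[OF bounded_bilinear_cinner]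
  and cinner_zero_right [simp] = bounded_bilinear.zero_right[OF bounded_bilinear_cinner]
  and cinner_diff_left = bounded_bilinear.diff_left[OF bounded_bilinear_cinner]
  and cinner_diff_right = bounded_bilinear.diff_right[OF bounded_bilinear_cinner]
  and cinner_sum_left = bounded_bilinear.sum_left[OF bounded_bilinear_cinner]
  and cinner_sum_right = bounded_bilinear.sum_right[OF bounded_bilinear_cinner]

lemma scaleC_one [simp]: "1 *\<^sub>C x = x" for x :: "'a::complex_inner"
  by (metis of_real_1 scaleR_one scaleR_scaleC)

lemma cinner_eq_zeroD: "cinner x x = 0 \<Longrightarrow> x = 0" for x :: "'a::complex_inner"
  by (simp add: cinner_self)

lemma cinner_extensionality: "(\<And>y. cinner x y = cinner z y) \<Longrightarrow> x = z"
  for x :: "'a::complex_inner"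
  using cinner_eq_zeroD[of "x - z"] by (simp add: cinner_diff_left)

section \<open>Subspaces, orthogonal projection and the Riesz representation\<close>

lemma csubspace_add: "csubspace V \<Longrightarrow> x \<in> V \<Longrightarrow> y \<in> V \<Longrightarrow> x + y \<in> V"
  and csubspace_diff: "csubspace V \<Longrightarrow> x \<in> V \<Longrightarrow> y \<in> V \<Longrightarrow> x - y \<in> V"
  and csubspace_scaleC: "csubspace V \<Longrightarrow> x \<in> V \<Longrightarrow> c *\<^sub>C x \<in> V"
  and csubspace_0: "csubspace V \<Longrightarrow> 0 \<in> V"
  for V :: "'a::complex_inner set"
  by (fact complex_vector.subspace_add complex_vector.subspace_diff
      complex_vector.subspace_scale complex_vector.subspace_0)+

lemma csubspace_scaleR: "csubspace V \<Longrightarrow> x \<in> V \<Longrightarrow> r *\<^sub>R x \<in> V"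
  for V :: "'a::complex_inner set"
  by (simp add: scaleR_scaleC csubspace_scaleC)

text \<open>Minimizing a distance gives orthogonality for the real inner product only; testing
  against \<open>\<i> *\<^sub>C y\<close> recovers the imaginary part.\<close>

lemma cinner_zero_if_inner_zero:
  fixes V :: "'a::complex_inner set"
  assumes "csubspace V" "\<And>y. y \<in> V \<Longrightarrow> inner w y = 0" "y \<in> V"
  shows "cinner w y = 0"
proof (rule complex_eqI)
  show "Re (cinner w y) = Re 0" using assms by (simp add: inner_eq_Re_cinner)
  have "inner w (\<i> *\<^sub>C y) = 0" using assms csubspace_scaleC by blast
  then show "Im (cinner w y) = Im 0" by (simp add: inner_eq_Re_cinner cinner_scaleC_right)
qed

lemma orth_decomp_ex:
  fixes V :: "'a::chilbert_space set"
  assumes V: "csubspace V" "closed V"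
  shows "\<exists>p\<in>V. \<forall>y\<in>V. cinner (x - p) y = 0"
proof -
  define S where "S = (\<lambda>v. (norm (x - v))\<^sup>2) ` V"
  define D where "D = Inf S"
  have ne: "S \<noteq> {}" using csubspace_0[OF V(1)] by (auto simp: S_def)
  have bdd: "bdd_below S" by (rule bdd_belowI[of _ 0]) (auto simp: S_def)
  have D_le: "D \<le> (norm (x - v))\<^sup>2" if "v \<in> V" for v
    unfolding D_def using that bdd by (intro cInf_lower) (auto simp: S_def)
  have "\<exists>v\<in>V. (norm (x - v))\<^sup>2 < D + 1 / real (Suc n)" for n
  proof -
    have "Inf S < D + 1 / real (Suc n)" by (simp add: D_def)
    then show ?thesis using cInf_lessD[OF ne] by (auto simp: S_def)
  qed
  then obtain v where vV: "\<And>n. v n \<in> V"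
    and vD: "\<And>n. (norm (x - v n))\<^sup>2 < D + 1 / real (Suc n)" by metis
  \<comment> \<open>The midpoint of \<open>v i\<close> and \<open>v j\<close> lies in
    \<open>V\<close>, so its squared distance to x is at least \<open>D\<close>; the parallelogram
    law then makes the minimizing sequence Cauchy.\<close>
  have par: "(norm (v i - v j))\<^sup>2 \<le> 2 / real (Suc i) + 2 / real (Suc j)" for i j
  proof -
    let ?a = "x - v i" and ?b = "x - v j"
    have "D \<le> (norm (x - (1/2) *\<^sub>R (v i + v j)))\<^sup>2"
      by (intro D_le csubspace_scaleR csubspace_add V vV)
    also have "x - (1/2) *\<^sub>R (v i + v j) = (1/2) *\<^sub>R (?a + ?b)"
      by (simp add: algebra_simps flip: scaleR_add_left)
    finally have "4 * D \<le> (norm (?a + ?b))\<^sup>2" by (simp add: power_mult_distrib power2_eq_square)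
    moreover have "(norm (?a + ?b))\<^sup>2 + (norm (?a - ?b))\<^sup>2 = 2 * (norm ?a)\<^sup>2 + 2 * (norm ?b)\<^sup>2"
      by (simp add: power2_norm_eq_inner inner_add inner_diff inner_commute algebra_simps)
    moreover have "norm (?a - ?b) = norm (v i - v j)"
      by (simp add: norm_minus_commute)
    ultimately show ?thesis using vD[of i] vD[of j] by simp
  qed
  have "Cauchy v"
  proof (rule metric_CauchyI)
    fix e :: real assume "e > 0"
    then obtain M where M: "4 / real (Suc M) < e\<^sup>2"
      using reals_Archimedean[of "e\<^sup>2 / 4"] by (auto simp: divide_simps)
    have "dist (v i) (v j) < e" if "i \<ge> M" "j \<ge> M" for i j
    proof -
      have "2 / real (Suc i) \<le> 2 / real (Suc M)" "2 / real (Suc j) \<le> 2 / real (Suc M)"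
        using that by (simp_all add: frac_le)
      then have "(norm (v i - v j))\<^sup>2 < e\<^sup>2" using par[of i j] M by linarith
      then show ?thesis using \<open>e > 0\<close> by (simp add: dist_norm power_less_imp_less_base)
    qed
    then show "\<exists>M. \<forall>m\<ge>M. \<forall>n\<ge>M. dist (v m) (v n) < e" by blast
  qed
  then obtain p where p: "v \<longlonglongrightarrow> p" by (auto simp: Cauchy_convergent_iff convergent_def)
  then have pV: "p \<in> V" using closed_sequentially[OF V(2)] vV by blast
  have lim: "(\<lambda>n. (norm (x - v n))\<^sup>2) \<longlonglongrightarrow> (norm (x - p))\<^sup>2"
    by (intro tendsto_intros p)
  have lim2: "(\<lambda>n. D + 1 / real (Suc n)) \<longlonglongrightarrow> D + 0"
    by (intro tendsto_intros LIMSEQ_Suc lim_1_over_n)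
  have pD: "(norm (x - p))\<^sup>2 \<le> D"
    using LIMSEQ_le[OF lim lim2] vD less_imp_le by auto
  have "inner (x - p) y = 0" if y: "y \<in> V" for y
  proof (cases "y = 0")
    case False
    \<comment> \<open>\<open>t\<close> minimizes the quadratic s \<mapsto> norm (x - (p + s y))^2;
      as p is optimal, the gain (inner (x - p) y)^2 / (norm y)^2 must vanish.\<close>
    define t where "t = inner (x - p) y / (norm y)\<^sup>2"
    have ny: "(norm y)\<^sup>2 \<noteq> 0" using False by simp
    have "(norm (x - p))\<^sup>2 \<le> (norm (x - (p + t *\<^sub>R y)))\<^sup>2"
      using pD by (rule order_trans) (intro D_le csubspace_add csubspace_scaleR V pV y)
    also have "\<dots> = (norm (x - p))\<^sup>2 - 2 * t * inner (x - p) y + t\<^sup>2 * (norm y)\<^sup>2"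
      unfolding power2_norm_eq_inner
      by (simp add: inner_add inner_diff inner_commute algebra_simps power2_eq_square)
    also have "\<dots> = (norm (x - p))\<^sup>2 - (inner (x - p) y)\<^sup>2 / (norm y)\<^sup>2"
      using ny by (simp add: t_def power2_eq_square field_simps)
    finally have "(inner (x - p) y)\<^sup>2 / (norm y)\<^sup>2 \<le> 0" by simp
    then show ?thesis using ny by (simp add: divide_le_0_iff)
  qed simp
  then show ?thesis using cinner_zero_if_inner_zero[OF V(1)] pV by blast
qed

lemma orth_projI:
  fixes V :: "'a::complex_inner set"
  assumes V: "csubspace V" and p: "p \<in> V" "\<And>y. y \<in> V \<Longrightarrow> cinner (x - p) y = 0"
  shows "orth_proj V x = p"
  unfolding orth_proj_def
proof (rule the_equality)
  fix p' assume p': "p' \<in> V \<and> (\<forall>y\<in>V. cinner (x - p') y = 0)"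
  then have "cinner (x - p) (p' - p) = 0" "cinner (x - p') (p' - p) = 0"
    using p csubspace_diff[OF V] by blast+
  then have "cinner (p' - p) (p' - p) = 0" by (simp add: cinner_diff_left)
  then show "p' = p" using cinner_eq_zeroD by fastforce
qed (use p in blast)

lemma orth_proj:
  fixes V :: "'a::chilbert_space set"
  assumes "csubspace V" "closed V"
  shows "orth_proj V x \<in> V" "y \<in> V \<Longrightarrow> cinner (x - orth_proj V x) y = 0"
  using orth_decomp_ex[OF assms, of x] orth_projI[OF assms(1), of _ x] by auto

lemma orthogonal_complement_trivial_imp_UNIV:
  fixes V :: "'a::chilbert_space set"
  assumes V: "csubspace V" "closed V" and tr: "\<And>w. (\<And>y. y \<in> V \<Longrightarrow> cinner w y = 0) \<Longrightarrow> w = 0"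
  shows "V = UNIV"
proof (rule UNIV_eq_I[symmetric])
  fix x
  have "x - orth_proj V x = 0" by (intro tr orth_proj[OF V])
  then show "x \<in> V" using orth_proj(1)[OF V, of x] by simp
qed

lemma riesz_representation:
  fixes f :: "'a::chilbert_space \<Rightarrow> complex"
  assumes add: "\<And>x y. f (x + y) = f x + f y" and sc: "\<And>c x. f (c *\<^sub>C x) = c * f x"
    and bd: "\<And>x. cmod (f x) \<le> K * norm x"
  shows "\<exists>z. \<forall>x. f x = cinner x z"
proof (cases "\<forall>x. f x = 0")
  case True
  then show ?thesis by (intro exI[of _ 0]) simp
next
  case False
  then obtain x0 where x0: "f x0 \<noteq> 0" by blast
  have f0: "f 0 = 0" using add[of 0 0] by simp
  have diff: "f (x - y) = f x - f y" for x y using add[of "x - y" y] by simp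
  define V where "V = {x. f x = 0}"
  have V: "csubspace V"
    by (rule complex_vector.subspaceI) (auto simp: V_def add sc f0)
  have lin: "bounded_linear f"
    using bd by (intro bounded_linear_intro[of _ K])
      (auto simp: add sc scaleR_scaleC scaleC_complex_def mult.commute)
  have "closed V"
    unfolding V_def by (intro closed_Collect_eq continuous_intros
        linear_continuous_on[OF lin, of UNIV])
  note pr = orth_proj[OF V this, where x = x0]
  \<comment> \<open>\<open>w\<close> is orthogonal to the kernel of f, which has codimension one, so
    x differs from a multiple of \<open>w\<close> by an element of the kernel.\<close>
  define w where "w = x0 - orth_proj V x0"
  have fw: "f w \<noteq> 0" using pr(1) x0 by (simp add: w_def diff V_def)
  then have w0: "w \<noteq> 0" using f0 by auto
  have "f x = cinner x (cnj (f w / cinner w w) *\<^sub>C w)" for x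
  proof -
    have "x - (f x / f w) *\<^sub>C w \<in> V" using fw by (simp add: V_def diff sc)
    then have "cinner w (x - (f x / f w) *\<^sub>C w) = 0" using pr(2) unfolding w_def by blast
    then have "cinner (x - (f x / f w) *\<^sub>C w) w = 0" by (metis cinner_commute complex_cnj_zero)
    then have "cinner x w = f x / f w * cinner w w"
      by (simp add: cinner_diff_left cinner_scaleC_left)
    moreover have "cinner w w \<noteq> 0" using w0 cinner_eq_zeroD by blast
    ultimately show ?thesis using fw by (simp add: cinner_scaleC_right)
  qed
  then show ?thesis by blast
qed

section \<open>Bounded operators, sesquilinear forms and adjoints\<close>

lemma bounded_op_onI:
  assumes "\<And>x y. x \<in> V \<Longrightarrow> y \<in> V \<Longrightarrow> T (x + y) = T x + T y"
    and "\<And>c x. x \<in> V \<Longrightarrow> T (c *\<^sub>C x) = c *\<^sub>C T x"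
    and "\<And>x. x \<in> V \<Longrightarrow> norm (T x) \<le> K * norm x"
  shows "bounded_op_on V T"
  using assms unfolding bounded_op_on_def by blast

lemma bounded_op_add: "bounded_op T \<Longrightarrow> T (x + y) = T x + T y"
  and bounded_op_scaleC: "bounded_op T \<Longrightarrow> T (c *\<^sub>C x) = c *\<^sub>C T x"
  by (auto simp: bounded_op_on_def)

lemma bounded_op_on_bound:
  assumes "bounded_op_on V T"
  obtains K where "K > 0" "\<And>x. x \<in> V \<Longrightarrow> norm (T x) \<le> K * norm x"
proof -
  obtain K where K: "\<And>x. x \<in> V \<Longrightarrow> norm (T x) \<le> K * norm x"
    using assms unfolding bounded_op_on_def by blast
  have "norm (T x) \<le> (\<bar>K\<bar> + 1) * norm x" if "x \<in> V" for x
    using K[OF that] by (rule order_trans) (intro mult_right_mono, auto)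
  then show ?thesis by (intro that[of "\<bar>K\<bar> + 1"]) auto
qed

lemma bounded_op_bounded_linear: "bounded_op T \<Longrightarrow> bounded_linear T"
proof -
  assume T: "bounded_op T"
  then obtain K where "K > 0" "\<And>x. norm (T x) \<le> K * norm x"
    using bounded_op_on_bound by (metis UNIV_I)
  then show ?thesis using T
    by (intro bounded_linear_intro[of _ K]) (auto simp: bounded_op_on_def scaleR_scaleC mult.commute)
qed

lemma bounded_op_0: "bounded_op T \<Longrightarrow> T 0 = 0"
  and bounded_op_diff: "bounded_op T \<Longrightarrow> T (x - y) = T x - T y"
  and bounded_op_sum: "bounded_op T \<Longrightarrow> T (sum g S) = (\<Sum>s\<in>S. T (g s))"
  using bounded_op_bounded_linear bounded_linear.linear linear_0 linear_diff linear_scale linear_sum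
  by blast+

lemma bounded_op_id: "bounded_op id"
  by (rule bounded_op_onI[of _ _ 1]) auto

lemma bounded_op_diff_op:
  assumes "bounded_op S" "bounded_op T"
  shows "bounded_op (\<lambda>x. S x - T x)"
proof -
  obtain K L where "\<And>x. norm (S x) \<le> K * norm x" "\<And>x. norm (T x) \<le> L * norm x"
    using assms by (metis bounded_op_on_bound UNIV_I)
  then have "norm (S x - T x) \<le> (K + L) * norm x" for x
    by (smt (verit) norm_triangle_ineq4 distrib_right)
  then show ?thesis using assms
    by (intro bounded_op_onI) (auto simp: bounded_op_on_def complex_vector.scale_right_diff_distrib)
qed

lemma bounded_op_scaleR_op:
  assumes "bounded_op S"
  shows "bounded_op (\<lambda>x. r *\<^sub>R S x)"
proof -
  obtain K where K: "\<And>x. norm (S x) \<le> K * norm x"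
    using assms by (metis bounded_op_on_bound UNIV_I)
  have "norm (r *\<^sub>R S x) \<le> (\<bar>r\<bar> * K) * norm x" for x
    using mult_left_mono[OF K[of x], of "\<bar>r\<bar>"] by (simp add: mult.assoc)
  then show ?thesis using assms
    by (intro bounded_op_onI[of _ _ "\<bar>r\<bar> * K"])
      (simp_all add: bounded_op_add bounded_op_scaleC scaleR_scaleC scaleC_add_right scaleC_scaleC mult.commute)
qed

lemma bounded_op_comp:
  assumes "bounded_op S" "bounded_op T"
  shows "bounded_op (S \<circ> T)"
proof -
  obtain K L where "K > 0" and K: "\<And>x. norm (S x) \<le> K * norm x" and L: "\<And>x. norm (T x) \<le> L * norm x"
    using assms by (metis bounded_op_on_bound UNIV_I)
  have "norm (S (T x)) \<le> (K * L) * norm x" for x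
    using order_trans[OF K[of "T x"] mult_left_mono[OF L[of x], of K]] \<open>K > 0\<close> by (simp add: mult.assoc)
  then show ?thesis using assms
    by (intro bounded_op_onI) (auto simp: bounded_op_on_def)
qed

text \<open>Riesz in the second variable, after a conjugation that makes it linear. It yields
  boundedness of adjoints, weak sums of positive series and the operator \<open>R\<close> extracted
  from a similarity.\<close>

lemma sesquilinear_form_operator:
  fixes B :: "'a::chilbert_space \<Rightarrow> 'a \<Rightarrow> complex"
  assumes addl: "\<And>x y z. B (x + y) z = B x z + B y z" and addr: "\<And>x y z. B x (y + z) = B x y + B x z"
    and scl: "\<And>c x y. B (c *\<^sub>C x) y = c * B x y" and scr: "\<And>c x y. B x (c *\<^sub>C y) = cnj c * B x y"
    and bd: "\<And>x y. cmod (B x y) \<le> K * norm x * norm y"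
  obtains T where "bounded_op T" "\<And>x y. cinner (T x) y = B x y"
proof -
  have "\<exists>z. \<forall>y. cnj (B x y) = cinner y z" for x
    by (rule riesz_representation[of _ "K * norm x"]) (use bd in \<open>auto simp: addr scr\<close>)
  then obtain T where "\<And>x y. cnj (B x y) = cinner y (T x)" by metis
  then have T: "\<And>x y. cinner (T x) y = B x y" by (metis cinner_commute complex_cnj_cnj)
  have "bounded_op T"
  proof (rule bounded_op_onI)
    show "T (x + y) = T x + T y" for x y
      by (rule cinner_extensionality) (simp add: T cinner_add_left addl)
    show "T (c *\<^sub>C x) = c *\<^sub>C T x" for c x
      by (rule cinner_extensionality) (simp add: T cinner_scaleC_left scl)
    show "norm (T x) \<le> K * norm x" for x
    proof (cases "T x = 0")
      case False
      have "(norm (T x))\<^sup>2 = cmod (cinner (T x) (T x))" by (simp add: cinner_self norm_power)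
      also have "\<dots> \<le> K * norm x * norm (T x)" unfolding T by (rule bd)
      finally show ?thesis using False by (simp add: power2_eq_square)
    next
      case True
      \<comment> \<open>\<open>K\<close> is not assumed nonnegative; the bound at y = x forces it as
        soon as x is nonzero.\<close>
      have "0 \<le> K * norm x * norm x" using bd[of x x] by (meson norm_ge_zero order_trans)
      then show ?thesis using True by (cases "x = 0") (auto simp: zero_le_mult_iff)
    qed
  qed
  then show ?thesis using T that by blast
qed

lemma adjoint_onI:
  fixes V :: "'a::complex_inner set"
  assumes V: "csubspace V" and z: "z \<in> V" "\<And>x. x \<in> V \<Longrightarrow> cinner (T x) y = cinner x z"
  shows "adjoint_on V T y = z"
  unfolding adjoint_on_def
proof (rule the_equality)
  fix z' assume z': "z' \<in> V \<and> (\<forall>x\<in>V. cinner (T x) y = cinner x z')"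
  then have "cinner (z' - z) z' = cinner (z' - z) z"
    using z csubspace_diff[OF V] by metis
  then have "cinner (z' - z) (z' - z) = 0" by (simp add: cinner_diff_right)
  then show "z' = z" using cinner_eq_zeroD by fastforce
qed (use z in blast)

lemma csubspace_UNIV: "csubspace UNIV"
  by (fact complex_vector.subspace_UNIV)

lemma cinner_adj:
  fixes T :: "'a::chilbert_space \<Rightarrow> 'a"
  assumes "bounded_op T"
  shows "cinner x (adj T y) = cinner (T x) y"
proof -
  obtain K where K: "K > 0" "\<And>x. norm (T x) \<le> K * norm x"
    using assms by (metis bounded_op_on_bound UNIV_I)
  have "\<exists>z. \<forall>x. cinner (T x) y = cinner x z"
  proof (rule riesz_representation)
    fix x
    have "cmod (cinner (T x) y) \<le> norm (T x) * norm y" by (rule cmod_cinner_le)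
    also have "\<dots> \<le> K * norm x * norm y" using K(2) by (intro mult_right_mono) auto
    finally show "cmod (cinner (T x) y) \<le> (K * norm y) * norm x" by (simp add: mult_ac)
  qed (use assms in \<open>auto simp: bounded_op_on_def cinner_add_left cinner_scaleC_left\<close>)
  then obtain z where z: "\<And>x. cinner (T x) y = cinner x z" by blast
  then have "adj T y = z" by (intro adjoint_onI csubspace_UNIV) auto
  then show ?thesis using z by simp
qed

lemma cinner_adj_left:
  fixes T :: "'a::chilbert_space \<Rightarrow> 'a"
  shows "bounded_op T \<Longrightarrow> cinner (adj T y) x = cinner y (T x)"
  by (metis cinner_adj cinner_commute)

lemma bounded_op_adj:
  fixes T :: "'a::chilbert_space \<Rightarrow> 'a"
  assumes "bounded_op T"
  shows "bounded_op (adj T)"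
proof -
  obtain K where K: "K > 0" "\<And>x. norm (T x) \<le> K * norm x"
    using assms by (metis bounded_op_on_bound UNIV_I)
  have "cmod (cinner x (T y)) \<le> K * norm x * norm y" for x y
  proof -
    have "cmod (cinner x (T y)) \<le> norm x * norm (T y)" by (rule cmod_cinner_le)
    also have "\<dots> \<le> norm x * (K * norm y)" using K(2) by (intro mult_left_mono) auto
    finally show ?thesis by (simp add: mult_ac)
  qed
  then obtain S where S: "bounded_op S" "\<And>x y. cinner (S x) y = cinner x (T y)"
    using sesquilinear_form_operator[of "\<lambda>x y. cinner x (T y)" K] assms
    by (auto simp: bounded_op_on_def cinner_add_left cinner_add_right cinner_scaleC_left cinner_scaleC_right)
  have "adj T = S"
    by (rule ext, rule cinner_extensionality) (simp add: S cinner_adj_left assms)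
  then show ?thesis using S by simp
qed

lemma adj_comp:
  fixes S T :: "'a::chilbert_space \<Rightarrow> 'a"
  assumes "bounded_op S" "bounded_op T"
  shows "adj (S \<circ> T) = adj T \<circ> adj S"
  by (rule ext, rule cinner_extensionality)
    (simp add: cinner_adj_left assms bounded_op_comp)

lemma adj_id: "adj id = (id :: 'a::chilbert_space \<Rightarrow> 'a)"
  by (intro ext adjoint_onI csubspace_UNIV) auto

section \<open>Polarization and symmetry of positive operators\<close>

lemma sum_unit_roots4: "(\<Sum>c\<in>{1,-1,\<i>,-\<i>}. g c) = g 1 + g (-1) + g \<i> + (g (-\<i>) :: 'a::comm_monoid_add)"
proof -
  have "1 \<notin> {-1,\<i>,-\<i>}" "-1 \<notin> {\<i>,-\<i>}" "\<i> \<notin> {-\<i>}" by (auto simp: complex_eq_iff)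
  then show ?thesis by (simp add: add.assoc)
qed

text \<open>Transfers convergence of quadratic forms to all matrix entries: summability of weak
  series and weak limits are both checked on the diagonal.\<close>

lemma polarization:
  assumes "bounded_op T"
  shows "4 * cinner (T x) y = (\<Sum>c\<in>{1,-1,\<i>,-\<i>}. c * cinner (T (x + c *\<^sub>C y)) (x + c *\<^sub>C y))"
  unfolding sum_unit_roots4
  by (simp add: bounded_op_add[OF assms] bounded_op_scaleC[OF assms] cinner_add_left cinner_add_right
      cinner_scaleC_left cinner_scaleC_right bounded_op_diff[OF assms] cinner_diff_left cinner_diff_right
      distrib_left right_diff_distrib)

definition qform :: "('a::complex_inner \<Rightarrow> 'a) \<Rightarrow> 'a \<Rightarrow> real" where
  "qform T x = Re (cinner (T x) x)"

lemma positive_op_bounded: "positive_op T \<Longrightarrow> bounded_op T"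
  and qform_nonneg: "positive_op T \<Longrightarrow> 0 \<le> qform T x"
  and cinner_qform: "positive_op T \<Longrightarrow> cinner (T x) x = complex_of_real (qform T x)"
  by (auto simp: positive_op_def qform_def complex_is_Real_iff complex_eq_iff)

lemma positive_opI:
  "bounded_op T \<Longrightarrow> (\<And>x. cinner (T x) x = complex_of_real (q x)) \<Longrightarrow> (\<And>x. 0 \<le> q x) \<Longrightarrow> positive_op T"
  by (auto simp: positive_op_def)

text \<open>Polarization expresses both sides by four real values of \<open>qform T\<close>, which
  is invariant under unimodular scalars. Swapping x and y therefore only exchanges the two values
  with coefficients i and -i, and this conjugates the sum.\<close>

lemma positive_op_symmetric:
  fixes x :: "'a::complex_inner"
  assumes "positive_op T"
  shows "cinner (T x) y = cinner x (T y)"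
proof -
  note T = positive_op_bounded[OF assms]
  have q: "qform T (c *\<^sub>C z) = qform T z" if "cmod c = 1" for c and z :: 'a
  proof -
    have "qform T (c *\<^sub>C z) = Re (c * cnj c * cinner (T z) z)"
      by (simp add: qform_def bounded_op_scaleC[OF T] cinner_scaleC_left cinner_scaleC_right mult_ac)
    also have "c * cnj c = 1" using that by (metis complex_norm_square of_real_1 power_one)
    finally show ?thesis by (simp add: qform_def)
  qed
  have e: "qform T (y + x) = qform T (x + y)" "qform T (y - x) = qform T (x - y)"
    "qform T (y + \<i> *\<^sub>C x) = qform T (x - \<i> *\<^sub>C y)" "qform T (y - \<i> *\<^sub>C x) = qform T (x + \<i> *\<^sub>C y)"
    using q[of "-1" "x - y"] q[of "\<i>" "x - \<i> *\<^sub>C y"] q[of "-\<i>" "x + \<i> *\<^sub>C y"]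
    by (simp_all add: add.commute scaleC_add_right complex_vector.scale_right_diff_distrib scaleC_scaleC)
  define P where "P = qform T (x + y)"
  define M where "M = qform T (x - y)"
  define U where "U = qform T (x + \<i> *\<^sub>C y)"
  define V where "V = qform T (x - \<i> *\<^sub>C y)"
  have pol: "4 * cinner (T u) v = of_real (qform T (u + v)) - of_real (qform T (u - v))
      + \<i> * of_real (qform T (u + \<i> *\<^sub>C v)) - \<i> * of_real (qform T (u - \<i> *\<^sub>C v))" for u v
  proof -
    have "4 * cinner (T u) v = (\<Sum>c\<in>{1,-1,\<i>,-\<i>}. c * of_real (qform T (u + c *\<^sub>C v)))"
      unfolding polarization[OF T] cinner_qform[OF assms] ..
    then show ?thesis unfolding sum_unit_roots4 by simp
  qed
  have "4 * cinner (T x) y = of_real P - of_real M + \<i> * of_real U - \<i> * of_real V"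
    unfolding pol P_def M_def U_def V_def ..
  moreover have "4 * cinner (T y) x = of_real P - of_real M + \<i> * of_real V - \<i> * of_real U"
    unfolding pol e P_def M_def U_def V_def ..
  ultimately have "4 * cinner (T x) y = 4 * cnj (cinner (T y) x)"
    by (simp add: complex_eq_iff)
  then show ?thesis by (metis cinner_commute mult_cancel_left zero_neq_numeral)
qed

section \<open>Extended nonnegative quadratic forms\<close>

lemma summable_ennreal: "f summable_on A" for f :: "'a \<Rightarrow> ennreal"
  by (rule nonneg_summable_on_complete) simp

lemma infsum_ennreal_mono:
  fixes f :: "'a \<Rightarrow> ennreal"
  shows "(\<And>x. x \<in> A \<Longrightarrow> f x \<le> g x) \<Longrightarrow> infsum f A \<le> infsum g A"
  by (intro infsum_mono summable_ennreal)

lemma infsum_ennreal_mono_set: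
  fixes f :: "'a \<Rightarrow> ennreal"
  shows "A \<subseteq> B \<Longrightarrow> infsum f A \<le> infsum f B"
  by (intro infsum_mono_neutral summable_ennreal) auto

text \<open>Tonelli for unordered sums. A finite set of pairs lies over finitely many first indices,
  so both inequalities reduce to a finite outer sum, which is handled by additivity on disjoint
  unions.\<close>

lemma infsum_ennreal_Sigma:
  fixes f :: "'a \<Rightarrow> 'b \<Rightarrow> ennreal"
  shows "(\<Sum>\<^sub>\<infinity>x\<in>A. \<Sum>\<^sub>\<infinity>y\<in>B x. f x y) = (\<Sum>\<^sub>\<infinity>(x,y)\<in>Sigma A B. f x y)"
proof (rule antisym)
  have fin: "(\<Sum>x\<in>X. \<Sum>\<^sub>\<infinity>y\<in>B x. f x y) = (\<Sum>\<^sub>\<infinity>(x,y)\<in>Sigma X B. f x y)" if "finite X" for X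
    using that
  proof induction
    case (insert x X)
    have "Sigma (insert x X) B = Pair x ` B x \<union> Sigma X B" by auto
    moreover have "Pair x ` B x \<inter> Sigma X B = {}" using insert.hyps by auto
    ultimately have "(\<Sum>\<^sub>\<infinity>(x,y)\<in>Sigma (insert x X) B. f x y)
        = (\<Sum>\<^sub>\<infinity>(x,y)\<in>Pair x ` B x. f x y) + (\<Sum>\<^sub>\<infinity>(x,y)\<in>Sigma X B. f x y)"
      by (simp add: infsum_Un_disjoint summable_ennreal)
    also have "(\<Sum>\<^sub>\<infinity>(x,y)\<in>Pair x ` B x. f x y) = (\<Sum>\<^sub>\<infinity>y\<in>B x. f x y)"
      by (subst infsum_reindex) (auto simp: inj_on_def o_def)
    finally show ?case using insert by simp
  qed simp
  show "(\<Sum>\<^sub>\<infinity>x\<in>A. \<Sum>\<^sub>\<infinity>y\<in>B x. f x y) \<le> (\<Sum>\<^sub>\<infinity>(x,y)\<in>Sigma A B. f x y)"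
  proof (rule infsum_le_finite_sums[OF summable_ennreal])
    fix X assume "finite X" "X \<subseteq> A"
    then show "(\<Sum>x\<in>X. \<Sum>\<^sub>\<infinity>y\<in>B x. f x y) \<le> (\<Sum>\<^sub>\<infinity>(x,y)\<in>Sigma A B. f x y)"
      unfolding fin[OF \<open>finite X\<close>] by (intro infsum_ennreal_mono_set) auto
  qed
  show "(\<Sum>\<^sub>\<infinity>(x,y)\<in>Sigma A B. f x y) \<le> (\<Sum>\<^sub>\<infinity>x\<in>A. \<Sum>\<^sub>\<infinity>y\<in>B x. f x y)"
  proof (rule infsum_le_finite_sums[OF summable_ennreal])
    fix F assume F: "finite F" "F \<subseteq> Sigma A B"
    have "(\<Sum>(x,y)\<in>F. f x y) = (\<Sum>\<^sub>\<infinity>(x,y)\<in>F. f x y)" using F by simp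
    also have "\<dots> \<le> (\<Sum>\<^sub>\<infinity>(x,y)\<in>Sigma (fst ` F) B. f x y)"
      using F by (intro infsum_ennreal_mono_set) force
    also have "\<dots> = (\<Sum>\<^sub>\<infinity>x\<in>fst ` F. \<Sum>\<^sub>\<infinity>y\<in>B x. f x y)" using F by (simp flip: fin)
    also have "\<dots> \<le> (\<Sum>\<^sub>\<infinity>x\<in>A. \<Sum>\<^sub>\<infinity>y\<in>B x. f x y)"
      using F by (intro infsum_ennreal_mono_set) auto
    finally show "(\<Sum>(x,y)\<in>F. f x y) \<le> (\<Sum>\<^sub>\<infinity>x\<in>A. \<Sum>\<^sub>\<infinity>y\<in>B x. f x y)" .
  qed
qed

lemma infsum_ennreal_swap:
  fixes f :: "'a \<Rightarrow> 'b \<Rightarrow> ennreal"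
  shows "(\<Sum>\<^sub>\<infinity>x\<in>A. \<Sum>\<^sub>\<infinity>y\<in>B. f x y) = (\<Sum>\<^sub>\<infinity>y\<in>B. \<Sum>\<^sub>\<infinity>x\<in>A. f x y)"
  unfolding infsum_ennreal_Sigma
  by (rule infsum_reindex_bij_betw[symmetric, of prod.swap, THEN trans])
    (auto simp: bij_betw_def inj_on_def intro!: infsum_cong)

lemma infsum_ennreal_cmult:
  fixes f :: "'a \<Rightarrow> ennreal"
  shows "(\<Sum>\<^sub>\<infinity>x\<in>A. c * f x) = c * infsum f A"
  by (simp add: nonneg_infsum_complete SUP_mult_left_ennreal flip: sum_distrib_left)

text \<open>Used to group factorizations of words once by their number of factors and once by their
  concatenation.\<close>

lemma infsum_ennreal_fibres:
  fixes f :: "'a \<Rightarrow> ennreal"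
  assumes "\<And>x. x \<in> A \<Longrightarrow> g x \<in> B"
  shows "infsum f A = (\<Sum>\<^sub>\<infinity>y\<in>B. \<Sum>\<^sub>\<infinity>x | x \<in> A \<and> g x = y. f x)"
proof -
  have "bij_betw snd (SIGMA y:B. {x. x \<in> A \<and> g x = y}) A"
    using assms by (auto simp: bij_betw_def inj_on_def image_iff)
  then have "infsum f A = (\<Sum>\<^sub>\<infinity>p\<in>(SIGMA y:B. {x. x \<in> A \<and> g x = y}). f (snd p))"
    by (rule infsum_reindex_bij_betw[symmetric])
  then show ?thesis by (simp add: infsum_ennreal_Sigma case_prod_unfold)
qed

section \<open>Countably additive maps on forms and their Neumann series\<close>

lemma sums_ennreal_infsum: "f sums infsum f UNIV" for f :: "nat \<Rightarrow> ennreal"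
  by (intro has_sum_imp_sums has_sum_infsum summable_ennreal)

text \<open>The weights are built in so that binomial series pass through \<open>F\<close>;
  homogeneity and finite additivity are the cases of finitely many nonzero weights.\<close>

definition cnt_add :: "(('v \<Rightarrow> ennreal) \<Rightarrow> 'v \<Rightarrow> ennreal) \<Rightarrow> bool" where
  "cnt_add F \<longleftrightarrow>
     (\<forall>c q. F (\<lambda>x. \<Sum>\<^sub>\<infinity>t::nat. c t * q t x) = (\<lambda>x. \<Sum>\<^sub>\<infinity>t. c t * F (q t) x))"

lemma cnt_addD:
  "cnt_add F \<Longrightarrow> F (\<lambda>x. \<Sum>\<^sub>\<infinity>t::nat. c t * q t x) = (\<lambda>x. \<Sum>\<^sub>\<infinity>t. c t * F (q t) x)"
  by (simp add: cnt_add_def)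

lemma cnt_addD_sum:
  "cnt_add F \<Longrightarrow> F (\<lambda>x. \<Sum>\<^sub>\<infinity>t::nat. q t x) = (\<lambda>x. \<Sum>\<^sub>\<infinity>t. F (q t) x)"
  using cnt_addD[of F "\<lambda>_. 1" q] by simp

lemma cnt_add_add:
  assumes "cnt_add F"
  shows "F (\<lambda>x. p x + q x) = (\<lambda>x. F p x + F q x)"
proof -
  \<comment> \<open>The weights vanish from index 2 on, so the countable sum has just the two terms
    that stand for p and q.\<close>
  have split: "(\<Sum>\<^sub>\<infinity>t::nat. (if t < 2 then 1 else 0) * g t) = g 0 + (g 1 :: ennreal)" for g
  proof -
    have "(\<Sum>\<^sub>\<infinity>t::nat. (if t < 2 then 1 else 0) * g t) = (\<Sum>\<^sub>\<infinity>t\<in>{0,1}. g t)"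
      by (rule infsum_cong_neutral) auto
    then show ?thesis by simp
  qed
  show ?thesis
    using cnt_addD[OF assms, of "\<lambda>t. if t < 2 then 1 else 0" "\<lambda>t. if t = 0 then p else q"]
    unfolding split by simp
qed

lemma cnt_add_comp: "cnt_add F \<Longrightarrow> cnt_add G \<Longrightarrow> cnt_add (F \<circ> G)"
  by (simp add: cnt_add_def)

lemma cnt_add_id: "cnt_add id"
  by (simp add: cnt_add_def)

lemma cnt_add_funpow: "cnt_add F \<Longrightarrow> cnt_add (F ^^ s)"
  by (induction s) (auto intro: cnt_add_comp cnt_add_id)

lemma cnt_add_infsum:
  assumes "\<And>s. s \<in> S \<Longrightarrow> cnt_add (G s)"
  shows "cnt_add (\<lambda>q x. \<Sum>\<^sub>\<infinity>s\<in>S. d s * G s q x)"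
  unfolding cnt_add_def
proof (intro allI ext)
  fix c :: "nat \<Rightarrow> ennreal" and q x
  have "(\<Sum>\<^sub>\<infinity>s\<in>S. d s * G s (\<lambda>x. \<Sum>\<^sub>\<infinity>t. c t * q t x) x)
      = (\<Sum>\<^sub>\<infinity>s\<in>S. \<Sum>\<^sub>\<infinity>t. c t * (d s * G s (q t) x))"
  proof (rule infsum_cong)
    fix s assume "s \<in> S"
    then show "d s * G s (\<lambda>x. \<Sum>\<^sub>\<infinity>t. c t * q t x) x = (\<Sum>\<^sub>\<infinity>t. c t * (d s * G s (q t) x))"
      by (simp only: cnt_addD[OF assms[OF \<open>s \<in> S\<close>]] mult.left_commute[of "c _" "d _"] infsum_ennreal_cmult)
  qed
  also have "\<dots> = (\<Sum>\<^sub>\<infinity>t. c t * (\<Sum>\<^sub>\<infinity>s\<in>S. d s * G s (q t) x))"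
    by (subst infsum_ennreal_swap) (simp add: infsum_ennreal_cmult)
  finally show "(\<Sum>\<^sub>\<infinity>s\<in>S. d s * G s (\<lambda>x. \<Sum>\<^sub>\<infinity>t. c t * q t x) x)
      = (\<Sum>\<^sub>\<infinity>t. c t * (\<Sum>\<^sub>\<infinity>s\<in>S. d s * G s (q t) x))" .
qed

text \<open>\<open>fold\<close> lets the first letter act first. With \<open>C\<close> the adjoints
  of a tuple, this is the order in which the factors of \<open>A\<^sub>\<alpha>\<^sup>*\<close>
  act.\<close>

definition Phif :: "nat \<Rightarrow> (nat list \<Rightarrow> real) \<Rightarrow> (nat \<Rightarrow> 'v \<Rightarrow> 'v) \<Rightarrow> ('v \<Rightarrow> ennreal) \<Rightarrow> 'v \<Rightarrow> ennreal" where
  "Phif n a C q x = (\<Sum>\<^sub>\<infinity>\<alpha>\<in>lists {1..n}. ennreal (a \<alpha>) * q (fold C \<alpha> x))"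

text \<open>The Neumann series of \<open>F\<close>; it replaces the inverse of id - F and may take
  the value infinity.\<close>

definition geom :: "(('v \<Rightarrow> ennreal) \<Rightarrow> 'v \<Rightarrow> ennreal) \<Rightarrow> ('v \<Rightarrow> ennreal) \<Rightarrow> 'v \<Rightarrow> ennreal" where
  "geom F q x = (\<Sum>\<^sub>\<infinity>s. (F ^^ s) q x)"

lemma cnt_add_Phif: "cnt_add (Phif n a C)"
  unfolding Phif_def[abs_def]
  by (rule cnt_add_infsum) (simp add: cnt_add_def)

lemma cnt_add_geom: "cnt_add F \<Longrightarrow> cnt_add (geom F)"
  using cnt_add_infsum[of UNIV "\<lambda>s. F ^^ s" "\<lambda>_. 1"]
  by (simp add: geom_def[abs_def] cnt_add_funpow)

lemma fold_comp_commute: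
  assumes "\<And>j l. j \<in> set \<alpha> \<Longrightarrow> l \<in> set \<beta> \<Longrightarrow> C j \<circ> D l = D l \<circ> C j"
  shows "fold C \<alpha> (fold D \<beta> x) = fold D \<beta> (fold C \<alpha> x)"
proof -
  have *: "C j (fold D \<beta> x) = fold D \<beta> (C j x)" if "\<And>l. l \<in> set \<beta> \<Longrightarrow> C j \<circ> D l = D l \<circ> C j" for j x
    using that by (induction \<beta> arbitrary: x) (auto simp: fun_eq_iff)
  show ?thesis using assms by (induction \<alpha> arbitrary: x) (auto simp: *)
qed

lemma Phif_commute:
  assumes "\<And>j l. j \<in> {1..n} \<Longrightarrow> l \<in> {1..n'} \<Longrightarrow> C j \<circ> D l = D l \<circ> C j"
  shows "Phif n a C \<circ> Phif n' b D = Phif n' b D \<circ> Phif n a C"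
proof (intro ext)
  fix q x
  have "Phif n a C (Phif n' b D q) x
      = (\<Sum>\<^sub>\<infinity>\<alpha>\<in>lists {1..n}. \<Sum>\<^sub>\<infinity>\<beta>\<in>lists {1..n'}.
           ennreal (b \<beta>) * (ennreal (a \<alpha>) * q (fold C \<alpha> (fold D \<beta> x))))"
    unfolding Phif_def infsum_ennreal_cmult[symmetric]
  proof (intro infsum_cong)
    fix \<alpha> \<beta> assume "\<alpha> \<in> lists {1..n}" "\<beta> \<in> lists {1..n'}"
    then have "fold C \<alpha> (fold D \<beta> x) = fold D \<beta> (fold C \<alpha> x)"
      by (intro fold_comp_commute assms) auto
    then show "ennreal (a \<alpha>) * (ennreal (b \<beta>) * q (fold D \<beta> (fold C \<alpha> x)))
        = ennreal (b \<beta>) * (ennreal (a \<alpha>) * q (fold C \<alpha> (fold D \<beta> x)))"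
      by (simp add: mult.left_commute)
  qed
  also have "\<dots> = Phif n' b D (Phif n a C q) x"
    by (subst infsum_ennreal_swap) (simp add: Phif_def infsum_ennreal_cmult)
  finally show "(Phif n a C \<circ> Phif n' b D) q x = (Phif n' b D \<circ> Phif n a C) q x" by simp
qed

lemma funpow_commute:
  assumes "F \<circ> G = G \<circ> F"
  shows "F \<circ> G ^^ s = G ^^ s \<circ> F"
proof (induction s)
  case (Suc s)
  have "F \<circ> G ^^ Suc s = (F \<circ> G) \<circ> G ^^ s" by (simp add: comp_assoc)
  also have "\<dots> = G \<circ> (F \<circ> G ^^ s)" unfolding assms by (simp add: comp_assoc)
  also have "\<dots> = G ^^ Suc s \<circ> F" unfolding Suc.IH by (simp add: comp_assoc)
  finally show ?case .
qed simp

lemma geom_commute: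
  assumes "cnt_add F" "F \<circ> G = G \<circ> F"
  shows "F \<circ> geom G = geom G \<circ> F"
proof
  fix q
  have "F (geom G q) = (\<lambda>x. \<Sum>\<^sub>\<infinity>s. F ((G ^^ s) q) x)"
    unfolding geom_def[abs_def] by (rule cnt_addD_sum[OF assms(1)])
  also have "\<dots> = geom G (F q)"
    using funpow_commute[OF assms(2)] by (auto simp: geom_def fun_eq_iff)
  finally show "(F \<circ> geom G) q = (geom G \<circ> F) q" by simp
qed

lemma geom_unfold:
  assumes "cnt_add F"
  shows "geom F q x = q x + F (geom F q) x"
proof -
  have "geom F q x = (\<Sum>\<^sub>\<infinity>s\<in>{0} \<union> Suc ` UNIV. (F ^^ s) q x)"
    by (simp add: geom_def flip: UNIV_nat_eq)
  also have "\<dots> = q x + (\<Sum>\<^sub>\<infinity>s\<in>Suc ` UNIV. (F ^^ s) q x)"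
    by (subst infsum_Un_disjoint) (auto intro: summable_ennreal)
  also have "(\<Sum>\<^sub>\<infinity>s\<in>Suc ` UNIV. (F ^^ s) q x) = (\<Sum>\<^sub>\<infinity>s. F ((F ^^ s) q) x)"
    by (subst infsum_reindex) (auto simp: o_def)
  also have "\<dots> = F (geom F q) x"
    unfolding geom_def[abs_def] by (simp add: cnt_addD_sum[OF assms])
  finally show ?thesis .
qed

text \<open>The hypothesis on p says z = (id - F) p in a form that survives infinite values.\<close>

lemma telescope:
  assumes F: "cnt_add F" and p: "\<And>x. p x = z x + F p x"
  shows "p x = (\<Sum>s<N. (F ^^ s) z x) + (F ^^ N) p x"
proof (induction N)
  case (Suc N)
  have "(F ^^ N) p = (F ^^ N) (\<lambda>x. z x + F p x)" using p by (metis ext)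
  also have "\<dots> = (\<lambda>x. (F ^^ N) z x + (F ^^ N) (F p) x)"
    by (rule cnt_add_add[OF cnt_add_funpow[OF F]])
  finally have "(F ^^ N) p x = (F ^^ N) z x + (F ^^ N) (F p) x" by (rule fun_cong)
  also have "(F ^^ N) (F p) = (F ^^ Suc N) p" by (simp add: funpow_swap1)
  finally show ?case using Suc by (simp add: add.assoc)
qed simp

text \<open>A solution p could contain a part fixed by \<open>F\<close>, which the Neumann series of
  z does not see; decay of the remainders \<open>(F ^^ N) p\<close> excludes it.\<close>

lemma geom_eqI:
  assumes F: "cnt_add F" and p: "\<And>x. p x = z x + F p x"
    and lim: "\<And>x. (\<lambda>N. (F ^^ N) p x) \<longlonglongrightarrow> 0"
  shows "geom F z = p"
proof
  fix x
  have "(\<lambda>N. \<Sum>s<N. (F ^^ s) z x) \<longlonglongrightarrow> geom F z x"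
    using sums_ennreal_infsum[of "\<lambda>s. (F ^^ s) z x"] by (simp add: sums_def geom_def)
  from tendsto_add[OF this lim[of x]]
  have "(\<lambda>N. p x) \<longlonglongrightarrow> geom F z x" by (simp flip: telescope[OF F p])
  then show "geom F z x = p x" by (simp add: LIMSEQ_const_iff)
qed

text \<open>\<open>(F ^^ N) (geom F z)\<close> is the N-th remainder of a series; finiteness of its
  sum at x allows the partial sums to be cancelled.\<close>

lemma geom_tail_tendsto_0:
  assumes F: "cnt_add F" and fin: "geom F z x < \<infinity>"
  shows "(\<lambda>N. (F ^^ N) (geom F z) x) \<longlonglongrightarrow> 0"
proof -
  let ?S = "\<lambda>N. \<Sum>s<N. (F ^^ s) z x"
  have eq: "geom F z x = ?S N + (F ^^ N) (geom F z) x" for N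
    by (rule telescope[OF F geom_unfold[OF F]])
  have "?S N < \<infinity>" for N using fin eq[of N] by (metis ennreal_add_less_top infinity_ennreal_def)
  then have b: "(F ^^ N) (geom F z) x = geom F z x - ?S N" for N
    using eq[of N] by (metis ennreal_add_diff_cancel_left infinity_ennreal_def less_irrefl)
  have "?S \<longlonglongrightarrow> geom F z x"
    using sums_ennreal_infsum[of "\<lambda>s. (F ^^ s) z x"] by (simp add: sums_def geom_def)
  then have "(\<lambda>N. geom F z x - ?S N) \<longlonglongrightarrow> geom F z x - geom F z x"
    using fin by (intro tendsto_diff_ennreal tendsto_const) auto
  then show ?thesis using fin by (simp add: b)
qed

lemma hockey_stick: "(\<Sum>t\<le>u. (t + m) choose m) = Suc (u + m) choose Suc m"
  by (induction u) auto

text \<open>The coefficients are those of (1 - z)^-(m + 1). One more factor \<open>geom F\<close>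
  sums them over t \<le> u, which is the hockey stick identity.\<close>

lemma geom_funpow:
  assumes F: "cnt_add F"
  shows "(geom F ^^ Suc m) q x = (\<Sum>\<^sub>\<infinity>t. of_nat ((t + m) choose m) * (F ^^ t) q x)"
proof (induction m arbitrary: x)
  case 0
  show ?case by (simp add: geom_def)
next
  case (Suc m)
  let ?c = "\<lambda>t. of_nat ((t + m) choose m) :: ennreal"
  have "(geom F ^^ Suc m) q = (\<lambda>x. \<Sum>\<^sub>\<infinity>t. ?c t * (F ^^ t) q x)" by (rule ext) (rule Suc.IH)
  then have "(geom F ^^ Suc (Suc m)) q x = geom F (\<lambda>x. \<Sum>\<^sub>\<infinity>t. ?c t * (F ^^ t) q x) x" by simp
  also have "\<dots> = (\<Sum>\<^sub>\<infinity>s. \<Sum>\<^sub>\<infinity>t. ?c t * (F ^^ (s + t)) q x)"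
    unfolding geom_def cnt_addD[OF cnt_add_funpow[OF F]] by (simp add: funpow_add)
  also have "\<dots> = (\<Sum>\<^sub>\<infinity>(s,t)\<in>UNIV. ?c t * (F ^^ (s + t)) q x)"
    by (simp add: infsum_ennreal_Sigma)
  also have "\<dots> = (\<Sum>\<^sub>\<infinity>(u,t)\<in>(SIGMA u:UNIV. {..u}). ?c t * (F ^^ u) q x)"
  proof -
    have "bij_betw (\<lambda>(s,t). (s + t, t)) UNIV (SIGMA u:UNIV. {..u::nat})"
      by (rule bij_betw_byWitness[where f' = "\<lambda>(u,t). (u - t, t)"]) auto
    from infsum_reindex_bij_betw[OF this, of "\<lambda>(u,t). ?c t * (F ^^ u) q x"]
    show ?thesis by (simp add: case_prod_unfold)
  qed
  also have "\<dots> = (\<Sum>\<^sub>\<infinity>u. \<Sum>t\<le>u. ?c t * (F ^^ u) q x)"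
    by (simp flip: infsum_ennreal_Sigma)
  also have "\<dots> = (\<Sum>\<^sub>\<infinity>u. of_nat ((u + Suc m) choose Suc m) * (F ^^ u) q x)"
    by (simp add: hockey_stick flip: sum_distrib_right of_nat_sum)
  finally show ?case .
qed

section \<open>Factorizations of words and the coefficients b\<close>

lemma Phif_funpow:
  assumes a: "\<And>\<alpha>. \<alpha> \<in> lists {1..n} \<Longrightarrow> 0 \<le> a \<alpha>"
  shows "(Phif n a C ^^ p) q x
    = (\<Sum>\<^sub>\<infinity>\<gamma> | length \<gamma> = p \<and> \<gamma> \<in> lists (lists {1..n}).
         ennreal (prod_list (map a \<gamma>)) * q (fold C (concat \<gamma>) x))"
proof (induction p arbitrary: x)
  case 0
  have "{\<gamma>. length \<gamma> = 0 \<and> \<gamma> \<in> lists (lists {1..n})} = {[]}" by auto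
  then show ?case by simp
next
  case (Suc p)
  let ?G = "\<lambda>p. {\<gamma>. length \<gamma> = p \<and> \<gamma> \<in> lists (lists {1..n})}"
  have "(Phif n a C ^^ Suc p) q x = (\<Sum>\<^sub>\<infinity>\<alpha>\<in>lists {1..n}. \<Sum>\<^sub>\<infinity>\<gamma>\<in>?G p.
      ennreal (a \<alpha>) * (ennreal (prod_list (map a \<gamma>)) * q (fold C (concat \<gamma>) (fold C \<alpha> x))))"
    by (simp add: Phif_def Suc.IH infsum_ennreal_cmult)
  also have "\<dots> = (\<Sum>\<^sub>\<infinity>\<alpha>\<in>lists {1..n}. \<Sum>\<^sub>\<infinity>\<gamma>\<in>?G p.
      ennreal (prod_list (map a (\<alpha> # \<gamma>))) * q (fold C (concat (\<alpha> # \<gamma>)) x))"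
    using a by (intro infsum_cong) (auto simp: ennreal_mult' mult.assoc)
  also have "\<dots> = (\<Sum>\<^sub>\<infinity>(\<alpha>,\<gamma>)\<in>lists {1..n} \<times> ?G p.
      ennreal (prod_list (map a (\<alpha> # \<gamma>))) * q (fold C (concat (\<alpha> # \<gamma>)) x))"
    by (rule infsum_ennreal_Sigma)
  also have "\<dots> = (\<Sum>\<^sub>\<infinity>\<gamma>\<in>?G (Suc p). ennreal (prod_list (map a \<gamma>)) * q (fold C (concat \<gamma>) x))"
  proof -
    have "bij_betw (\<lambda>(\<alpha>,\<gamma>). \<alpha> # \<gamma>) (lists {1..n} \<times> ?G p) (?G (Suc p))"
      by (rule bij_betw_byWitness[where f' = "\<lambda>\<gamma>. (hd \<gamma>, tl \<gamma>)"])
        (auto simp: length_Suc_conv)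
    from infsum_reindex_bij_betw[OF this, of "\<lambda>\<gamma>. ennreal (prod_list (map a \<gamma>)) * q (fold C (concat \<gamma>) x)"]
    show ?thesis by (simp add: case_prod_unfold)
  qed
  finally show ?case .
qed

lemma length_le_length_concat: "[] \<notin> set \<gamma> \<Longrightarrow> length \<gamma> \<le> length (concat \<gamma>)"
proof (induction \<gamma>)
  case (Cons w \<gamma>)
  then have "1 \<le> length w" by (cases w) auto
  then show ?case using Cons by auto
qed simp

lemma length_mem_le_length_concat: "w \<in> set \<gamma> \<Longrightarrow> length w \<le> length (concat \<gamma>)"
  by (induction \<gamma>) auto

lemma finite_factorizations: "finite {\<gamma>. concat \<gamma> = \<alpha> \<and> [] \<notin> set \<gamma>}"
proof (rule finite_subset)
  let ?W = "{w. set w \<subseteq> set \<alpha> \<and> length w \<le> length \<alpha>}"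
  show "{\<gamma>. concat \<gamma> = \<alpha> \<and> [] \<notin> set \<gamma>} \<subseteq> {\<gamma>. set \<gamma> \<subseteq> ?W \<and> length \<gamma> \<le> length \<alpha>}"
    using length_le_length_concat length_mem_le_length_concat by fastforce
  show "finite {\<gamma>. set \<gamma> \<subseteq> ?W \<and> length \<gamma> \<le> length \<alpha>}"
    by (intro finite_lists_length_le) simp
qed

text \<open>Removes the case distinction for the empty word: its only factorization is the empty
  one, with binomial coefficient 1, while a nonempty word has between 1 and
  \<open>length \<alpha>\<close> factors.\<close>

lemma bcoef_eq_sum_factorizations:
  "bcoef a m \<alpha> = (\<Sum>\<gamma> | concat \<gamma> = \<alpha> \<and> [] \<notin> set \<gamma>.
     prod_list (map a \<gamma>) * real ((length \<gamma> + m - 1) choose (m - 1)))"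
proof (cases "\<alpha> = []")
  case True
  have "{\<gamma>. concat \<gamma> = [] \<and> [] \<notin> set \<gamma>} = {[] :: nat list list}"
    by (auto simp: neq_Nil_conv) (metis list.exhaust list.set_intros(1))
  then show ?thesis using True by (simp add: bcoef_def)
next
  case False
  let ?S = "{\<gamma>. concat \<gamma> = \<alpha> \<and> [] \<notin> set \<gamma>}"
  let ?h = "\<lambda>\<gamma>. prod_list (map a \<gamma>) * real ((length \<gamma> + m - 1) choose (m - 1))"
  have "length ` ?S \<subseteq> {1..length \<alpha>}"
    using length_le_length_concat False by (auto simp: Suc_le_eq)
  from sum.group[OF finite_factorizations _ this, of ?h]
  have "sum ?h ?S = (\<Sum>p=1..length \<alpha>. sum ?h {\<gamma>. \<gamma> \<in> ?S \<and> length \<gamma> = p})" by simp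
  also have "\<dots> = bcoef a m \<alpha>"
    unfolding bcoef_def using False by (auto intro!: sum.cong)
  finally show ?thesis ..
qed

text \<open>Both sides run over all sequences of nonempty words, grouped on the left by the number
  of factors and on the right by the concatenation. Sequences with an empty factor drop out because
  \<open>a [] = 0\<close>.\<close>

lemma binomial_series_Phif:
  assumes a: "\<And>\<alpha>. \<alpha> \<in> lists {1..n} \<Longrightarrow> 0 \<le> a \<alpha>" and a0: "a [] = 0"
  shows "(\<Sum>\<^sub>\<infinity>t. of_nat ((t + m - 1) choose (m - 1)) * (Phif n a C ^^ t) q x)
    = (\<Sum>\<^sub>\<infinity>\<beta>\<in>lists {1..n}. ennreal (bcoef a m \<beta>) * q (fold C \<beta> x))"
proof -
  define c where "c t = ((t + m - 1) choose (m - 1))" for t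
  define G where "G = {\<gamma>. \<gamma> \<in> lists (lists {1..n}) \<and> [] \<notin> set \<gamma>}"
  define h where "h \<gamma> = ennreal (prod_list (map a \<gamma>) * real (c (length \<gamma>)))" for \<gamma>
  have pos: "0 \<le> prod_list (map a \<gamma>)" if "\<gamma> \<in> lists (lists {1..n})" for \<gamma>
    using that a by (induction \<gamma>) auto
  have zero: "prod_list (map a \<gamma>) = 0" if "[] \<in> set \<gamma>" for \<gamma>
    using that a0 by (auto simp: prod_list_zero_iff)
  have G_concat: "{\<gamma>. \<gamma> \<in> G \<and> concat \<gamma> = \<beta>} = {\<gamma>. concat \<gamma> = \<beta> \<and> [] \<notin> set \<gamma>}"
    if "\<beta> \<in> lists {1..n}" for \<beta>
    using that by (fastforce simp: G_def lists_eq_set)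
  have "(\<Sum>\<^sub>\<infinity>t. of_nat (c t) * (Phif n a C ^^ t) q x)
      = (\<Sum>\<^sub>\<infinity>t. \<Sum>\<^sub>\<infinity>\<gamma> | \<gamma> \<in> G \<and> length \<gamma> = t. h \<gamma> * q (fold C (concat \<gamma>) x))"
  proof (rule infsum_cong)
    fix t
    have "of_nat (c t) * (Phif n a C ^^ t) q x
        = (\<Sum>\<^sub>\<infinity>\<gamma> | length \<gamma> = t \<and> \<gamma> \<in> lists (lists {1..n}).
            of_nat (c t) * (ennreal (prod_list (map a \<gamma>)) * q (fold C (concat \<gamma>) x)))"
      by (simp only: Phif_funpow[OF a] infsum_ennreal_cmult)
    also have "\<dots> = (\<Sum>\<^sub>\<infinity>\<gamma> | \<gamma> \<in> G \<and> length \<gamma> = t. h \<gamma> * q (fold C (concat \<gamma>) x))"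
      by (rule infsum_cong_neutral)
        (auto simp: G_def h_def zero pos ennreal_mult' ennreal_of_nat_eq_real_of_nat mult_ac)
    finally show "of_nat (c t) * (Phif n a C ^^ t) q x
        = (\<Sum>\<^sub>\<infinity>\<gamma> | \<gamma> \<in> G \<and> length \<gamma> = t. h \<gamma> * q (fold C (concat \<gamma>) x))" .
  qed
  also have "\<dots> = (\<Sum>\<^sub>\<infinity>\<gamma>\<in>G. h \<gamma> * q (fold C (concat \<gamma>) x))"
    by (rule infsum_ennreal_fibres[symmetric]) simp
  also have "\<dots> = (\<Sum>\<^sub>\<infinity>\<beta>\<in>lists {1..n}. \<Sum>\<^sub>\<infinity>\<gamma> | \<gamma> \<in> G \<and> concat \<gamma> = \<beta>. h \<gamma> * q (fold C (concat \<gamma>) x))"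
    by (rule infsum_ennreal_fibres) (fastforce simp: G_def lists_eq_set)
  also have "\<dots> = (\<Sum>\<^sub>\<infinity>\<beta>\<in>lists {1..n}. ennreal (bcoef a m \<beta>) * q (fold C \<beta> x))"
  proof (rule infsum_cong)
    fix \<beta> assume \<beta>: "\<beta> \<in> lists {1..n}"
    let ?S = "{\<gamma>. concat \<gamma> = \<beta> \<and> [] \<notin> set \<gamma>}"
    have "?S \<subseteq> G" using G_concat[OF \<beta>] by auto
    then have "0 \<le> prod_list (map a \<gamma>) * real (c (length \<gamma>))" if "\<gamma> \<in> ?S" for \<gamma>
      using pos[of \<gamma>] that unfolding G_def by (intro mult_nonneg_nonneg) auto
    then have "ennreal (bcoef a m \<beta>) = (\<Sum>\<gamma>\<in>?S. h \<gamma>)"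
      unfolding bcoef_eq_sum_factorizations h_def c_def[symmetric] by (subst sum_ennreal) auto
    moreover have "(\<Sum>\<^sub>\<infinity>\<gamma>\<in>?S. h \<gamma> * q (fold C (concat \<gamma>) x)) = (\<Sum>\<gamma>\<in>?S. h \<gamma> * q (fold C \<beta> x))"
      by (simp add: finite_factorizations)
    ultimately show "(\<Sum>\<^sub>\<infinity>\<gamma> | \<gamma> \<in> G \<and> concat \<gamma> = \<beta>. h \<gamma> * q (fold C (concat \<gamma>) x))
        = ennreal (bcoef a m \<beta>) * q (fold C \<beta> x)"
      unfolding G_concat[OF \<beta>] by (simp add: sum_distrib_right)
  qed
  finally show ?thesis by (simp add: c_def)
qed

section \<open>Compositions over lists of indices\<close>

definition list_comp :: "('i \<Rightarrow> 'v \<Rightarrow> 'v) \<Rightarrow> 'i list \<Rightarrow> 'v \<Rightarrow> 'v" where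
  "list_comp F is = foldr (\<lambda>i T. F i \<circ> T) is id"

lemma list_comp_simps [simp]:
  "list_comp F [] x = x" "list_comp F (i # is) x = F i (list_comp F is x)"
  by (simp_all add: list_comp_def)

lemma list_comp_append [simp]: "list_comp F (is @ js) x = list_comp F is (list_comp F js x)"
  by (induction "is") auto

lemma list_comp_cong: "(\<And>i. i \<in> set is \<Longrightarrow> F i = G i) \<Longrightarrow> list_comp F is x = list_comp G is x"
  by (induction "is") auto

lemma ordered_comp_eq_list_comp: "ordered_comp k F = list_comp F [1..<Suc k]"
  by (simp add: ordered_comp_def list_comp_def)

lemma ordered_comp_0: "ordered_comp 0 F = id"
  by (simp add: ordered_comp_def)

lemma ordered_comp_Suc: "ordered_comp (Suc k) F = ordered_comp k F \<circ> F (Suc k)"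
proof
  have "[1..<Suc (Suc k)] = [1..<Suc k] @ [Suc k]" by simp
  then show "ordered_comp (Suc k) F x = (ordered_comp k F \<circ> F (Suc k)) x" for x
    unfolding ordered_comp_eq_list_comp by (simp only: list_comp_append list_comp_simps o_apply)
qed

lemma cnt_add_ordered_comp: "(\<And>i. cnt_add (F i)) \<Longrightarrow> cnt_add (ordered_comp k F)"
  by (induction k) (auto simp: ordered_comp_0 ordered_comp_Suc cnt_add_id intro!: cnt_add_comp)

lemma infsum_PiE_Suc:
  fixes f :: "(nat \<Rightarrow> 'b) \<Rightarrow> ennreal"
  shows "(\<Sum>\<^sub>\<infinity>s\<in>(\<Pi>\<^sub>E i\<in>{1..Suc k}. B i). f s)
    = (\<Sum>\<^sub>\<infinity>s\<in>(\<Pi>\<^sub>E i\<in>{1..k}. B i). \<Sum>\<^sub>\<infinity>t\<in>B (Suc k). f (s(Suc k := t)))"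
proof -
  have "{1..Suc k} = insert (Suc k) {1..k}" by auto
  then have eq: "(\<Pi>\<^sub>E i\<in>{1..Suc k}. B i)
      = (\<lambda>(t, s). s(Suc k := t)) ` (B (Suc k) \<times> (\<Pi>\<^sub>E i\<in>{1..k}. B i))"
    by (simp only: PiE_insert_eq)
  have "(\<Sum>\<^sub>\<infinity>s\<in>(\<Pi>\<^sub>E i\<in>{1..Suc k}. B i). f s)
      = (\<Sum>\<^sub>\<infinity>(t, s)\<in>B (Suc k) \<times> (\<Pi>\<^sub>E i\<in>{1..k}. B i). f (s(Suc k := t)))"
    unfolding eq by (subst infsum_reindex[OF inj_combinator]) (auto simp: o_def case_prod_unfold)
  also have "\<dots> = (\<Sum>\<^sub>\<infinity>s\<in>(\<Pi>\<^sub>E i\<in>{1..k}. B i). \<Sum>\<^sub>\<infinity>t\<in>B (Suc k). f (s(Suc k := t)))"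
    by (subst infsum_ennreal_swap) (simp add: infsum_ennreal_Sigma)
  finally show ?thesis .
qed

lemma ordered_comp_cong: "(\<And>i. i \<in> {1..k} \<Longrightarrow> F i = G i) \<Longrightarrow> ordered_comp k F = ordered_comp k G"
proof (induction k)
  case (Suc k)
  then show ?case by (simp add: ordered_comp_Suc)
qed (simp add: ordered_comp_0)

text \<open>The product of k series multiplied out. The induction splits off the innermost factor,
  whose series passes through the outer composition by countable additivity.\<close>

lemma ordered_comp_series:
  assumes F: "\<And>i. cnt_add (F i)"
  shows "(\<Sum>\<^sub>\<infinity>s\<in>(\<Pi>\<^sub>E i\<in>{1..k}. UNIV). (\<Prod>i=1..k. w i (s i)) * ordered_comp k (\<lambda>i. F i ^^ s i) r x)
    = ordered_comp k (\<lambda>i q x. \<Sum>\<^sub>\<infinity>t. w i t * (F i ^^ t) q x) r x"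
proof (induction k arbitrary: r)
  case 0
  show ?case by (simp add: ordered_comp_0)
next
  case (Suc k)
  let ?P = "ordered_comp k (\<lambda>i q x. \<Sum>\<^sub>\<infinity>t. w i t * (F i ^^ t) q x)"
  have cnt: "cnt_add ?P"
    by (intro cnt_add_ordered_comp cnt_add_infsum cnt_add_funpow F)
  have upd: "ordered_comp k (\<lambda>i. F i ^^ (s(Suc k := t)) i) = ordered_comp k (\<lambda>i. F i ^^ s i)" for s t
    by (rule ordered_comp_cong) auto
  have "(\<Sum>\<^sub>\<infinity>s\<in>(\<Pi>\<^sub>E i\<in>{1..Suc k}. UNIV). (\<Prod>i=1..Suc k. w i (s i)) * ordered_comp (Suc k) (\<lambda>i. F i ^^ s i) r x)
      = (\<Sum>\<^sub>\<infinity>s\<in>(\<Pi>\<^sub>E i\<in>{1..k}. UNIV). \<Sum>\<^sub>\<infinity>t. w (Suc k) t *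
          ((\<Prod>i=1..k. w i (s i)) * ordered_comp k (\<lambda>i. F i ^^ s i) ((F (Suc k) ^^ t) r) x))"
    unfolding infsum_PiE_Suc ordered_comp_Suc upd by (auto simp: mult_ac intro!: infsum_cong)
  also have "\<dots> = (\<Sum>\<^sub>\<infinity>t. w (Suc k) t * ?P ((F (Suc k) ^^ t) r) x)"
    by (subst infsum_ennreal_swap) (simp add: infsum_ennreal_cmult Suc.IH del: One_nat_def)
  also have "\<dots> = ?P (\<lambda>x. \<Sum>\<^sub>\<infinity>t. w (Suc k) t * (F (Suc k) ^^ t) r x) x"
    by (simp add: cnt_addD[OF cnt])
  finally show ?case by (simp add: ordered_comp_Suc)
qed

text \<open>If \<open>C\<close> consists of the adjoints of \<open>A\<close>, then \<open>mfold k C \<alpha>\<close> is the adjoint of \<open>A\<^sub>(\<^sub>\<alpha>\<^sub>)\<close>: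
  the first letter of the first word acts first.\<close>

definition mfold :: "nat \<Rightarrow> (nat \<Rightarrow> nat \<Rightarrow> 'v \<Rightarrow> 'v) \<Rightarrow> mword \<Rightarrow> 'v \<Rightarrow> 'v" where
  "mfold k C \<alpha> = fold (\<lambda>i. fold (C i) (\<alpha> i)) [1..<Suc k]"

lemma mfold_0: "mfold 0 C \<alpha> x = x"
  by (simp add: mfold_def)

lemma mfold_Suc: "mfold (Suc k) C \<alpha> x = fold (C (Suc k)) (\<alpha> (Suc k)) (mfold k C \<alpha> x)"
  by (simp add: mfold_def)

lemma mfold_cong: "(\<And>i. i \<in> {1..k} \<Longrightarrow> \<alpha> i = \<beta> i) \<Longrightarrow> mfold k C \<alpha> x = mfold k C \<beta> x"
  by (induction k) (auto simp: mfold_0 mfold_Suc)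

lemma ordered_comp_word_sums:
  fixes r :: "'v \<Rightarrow> ennreal"
  shows "ordered_comp k (\<lambda>i q x. \<Sum>\<^sub>\<infinity>\<beta>\<in>lists {1..n i}. v i \<beta> * q (fold (C i) \<beta> x)) r x
    = (\<Sum>\<^sub>\<infinity>\<alpha>\<in>mwords k n. (\<Prod>i=1..k. v i (\<alpha> i)) * r (mfold k C \<alpha> x))"
proof (induction k arbitrary: r)
  case 0
  show ?case by (simp add: ordered_comp_0 mfold_0 mwords_def)
next
  case (Suc k)
  have upd: "mfold k C (\<alpha>(Suc k := \<beta>)) x = mfold k C \<alpha> x" for \<alpha> \<beta>
    by (rule mfold_cong) auto
  have "(\<Sum>\<^sub>\<infinity>\<alpha>\<in>mwords (Suc k) n. (\<Prod>i=1..Suc k. v i (\<alpha> i)) * r (mfold (Suc k) C \<alpha> x))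
      = (\<Sum>\<^sub>\<infinity>\<alpha>\<in>mwords k n. \<Sum>\<^sub>\<infinity>\<beta>\<in>lists {1..n (Suc k)}.
          (\<Prod>i=1..k. v i (\<alpha> i)) * (v (Suc k) \<beta> * r (fold (C (Suc k)) \<beta> (mfold k C \<alpha> x))))"
    unfolding mwords_def
    by (subst infsum_PiE_Suc) (auto simp: mfold_Suc upd mult_ac intro!: infsum_cong)
  then show ?case
    unfolding ordered_comp_Suc o_apply Suc.IH infsum_ennreal_cmult ..
qed

text \<open>The extra factor \<open>T l\<close> moves outwards past the factors of the other
  indices, with which it commutes.\<close>

lemma list_comp_funpow_Suc:
  assumes "\<And>i j. i \<in> set is \<Longrightarrow> j \<in> set is \<Longrightarrow> i \<noteq> j \<Longrightarrow> T i \<circ> T j = T j \<circ> T i"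
    and "distinct is" "l \<in> set is"
  shows "list_comp (\<lambda>i. T i ^^ (p(l := Suc (p l))) i) is x = T l (list_comp (\<lambda>i. T i ^^ p i) is x)"
  using assms
proof (induction "is")
  case (Cons j js)
  show ?case
  proof (cases "j = l")
    case True
    then have "list_comp (\<lambda>i. T i ^^ (p(l := Suc (p l))) i) js x = list_comp (\<lambda>i. T i ^^ p i) js x"
      using Cons.prems by (intro list_comp_cong) auto
    then show ?thesis using True by simp
  next
    case False
    then have IH: "list_comp (\<lambda>i. T i ^^ (p(l := Suc (p l))) i) js x = T l (list_comp (\<lambda>i. T i ^^ p i) js x)"
      using Cons.prems by (intro Cons.IH) auto
    have "T l \<circ> T j ^^ p j = T j ^^ p j \<circ> T l"
      using Cons.prems(3) False by (intro funpow_commute Cons.prems(1)) auto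
    then have "(T j ^^ p j) (T l y) = T l ((T j ^^ p j) y)" for y by (metis o_apply)
    then show ?thesis using IH False by simp
  qed
qed simp

lemma list_comp_commute:
  assumes "\<And>i y. i \<in> set is \<Longrightarrow> G (F i y) = F i (G y)"
  shows "G (list_comp F is x) = list_comp F is (G x)"
  using assms by (induction "is") auto

section \<open>Positive operators and the maps \<open>\<Phi>\<close>\<close>

text \<open>Stated for forms because \<open>positive_series_wot_has_sum\<close> has to bound a sum
  of forms before an operator is available. \<open>q\<close> may vanish on nonzero vectors.\<close>

lemma form_cauchy_schwarz:
  fixes B :: "'a::complex_inner \<Rightarrow> 'a \<Rightarrow> complex"
  assumes addl: "\<And>x y z. B (x + y) z = B x z + B y z" and scl: "\<And>c x y. B (c *\<^sub>C x) y = c * B x y"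
    and herm: "\<And>x y. B y x = cnj (B x y)"
    and q: "\<And>x. B x x = complex_of_real (q x)" and nonneg: "\<And>x. 0 \<le> q x"
  shows "(cmod (B x y))\<^sup>2 \<le> q x * q y"
proof -
  have addr: "B z (u + v) = B z u + B z v" for z u v
    by (metis addl herm complex_cnj_add)
  have scr: "B u (c *\<^sub>C v) = cnj c * B u v" for c u v
    by (metis scl herm complex_cnj_mult)
  define r where "r = cmod (B x y)"
  \<comment> \<open>Positivity at x + t B(x, y) y; the factor B(x, y) makes the cross terms
    real.\<close>
  have *: "0 \<le> q x + 2 * t * r\<^sup>2 + t\<^sup>2 * r\<^sup>2 * q y" for t :: real
  proof -
    let ?c = "complex_of_real t * B x y"
    have "complex_of_real (q (x + ?c *\<^sub>C y))
        = of_real (q x) + cnj ?c * B x y + ?c * cnj (B x y) + ?c * cnj ?c * of_real (q y)"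
      unfolding q[symmetric] addl addr scl scr herm[of x y] by (simp add: algebra_simps)
    also have "\<dots> = complex_of_real (q x + 2 * t * r\<^sup>2 + t\<^sup>2 * r\<^sup>2 * q y)"
    proof -
      have "B x y * cnj (B x y) = complex_of_real (r\<^sup>2)"
        unfolding r_def by (simp only: complex_norm_square)
      then show ?thesis by (simp add: power2_eq_square algebra_simps)
    qed
    finally have "q (x + ?c *\<^sub>C y) = q x + 2 * t * r\<^sup>2 + t\<^sup>2 * r\<^sup>2 * q y"
      using of_real_eq_iff by blast
    then show ?thesis using nonneg by metis
  qed
  have "r\<^sup>2 \<le> q x * q y"
  proof (cases "q y = 0")
    case True
    have "r = 0"
    proof (rule ccontr)
      assume "r \<noteq> 0"
      \<comment> \<open>For \<open>q y = 0\<close> the bound is affine in t, and this t gives it the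
        negative value -(q x) - 2.\<close>
      then have "0 \<le> q x + 2 * (- (q x + 1) / r\<^sup>2) * r\<^sup>2" using *[of "- (q x + 1) / r\<^sup>2"] True by simp
      then show False using \<open>r \<noteq> 0\<close> nonneg[of x] by simp
    qed
    then show ?thesis using True by simp
  next
    case False
    then have qy: "q y > 0" using nonneg[of y] by simp
    \<comment> \<open>t = -1 / q y minimizes the quadratic.\<close>
    have "0 \<le> q x + 2 * (- 1 / q y) * r\<^sup>2 + (- 1 / q y)\<^sup>2 * r\<^sup>2 * q y" by (rule *)
    also have "\<dots> = q x - r\<^sup>2 / q y" using qy by (simp add: power2_eq_square field_simps)
    finally show ?thesis using qy by (simp add: field_simps)
  qed
  then show ?thesis by (simp add: r_def)
qed

lemma positive_op_cauchy_schwarz: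
  assumes "positive_op T"
  shows "(cmod (cinner (T x) y))\<^sup>2 \<le> qform T x * qform T y"
proof (rule form_cauchy_schwarz[where B = "\<lambda>x y. cinner (T x) y"])
  show "cinner (T y) x = cnj (cinner (T x) y)" for x y
    by (metis assms cinner_commute positive_op_symmetric)
qed (use positive_op_bounded[OF assms] assms in
    \<open>auto simp: bounded_op_on_def cinner_add_left cinner_scaleC_left cinner_qform qform_nonneg\<close>)

text \<open>Serves both the invertibility of Q in (ii) and the closed range of the Berezin kernel in
  (i).\<close>

lemma bounded_below_op:
  fixes Q :: "'a::chilbert_space \<Rightarrow> 'b::complex_inner"
  assumes b: "bounded_op Q" and c: "0 < c" and below: "\<And>x. c * norm x \<le> norm (Q x)"
  shows "csubspace (range Q)" "closed (range Q)" "invertible_op UNIV (range Q) Q"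
proof -
  have inj: "inj Q"
  proof (rule injI)
    fix x y assume "Q x = Q y"
    then show "x = y" using below[of "x - y"] c by (simp add: bounded_op_diff[OF b] mult_le_0_iff)
  qed
  show "csubspace (range Q)"
  proof (rule complex_vector.subspaceI)
    show "0 \<in> range Q" by (rule image_eqI[of _ _ 0]) (simp_all add: bounded_op_0[OF b])
    fix u assume "u \<in> range Q"
    then obtain x where u: "u = Q x" by blast
    show "r *\<^sub>C u \<in> range Q" for r
      unfolding u bounded_op_scaleC[OF b, symmetric] by (rule rangeI)
    fix v assume "v \<in> range Q"
    then obtain y where v: "v = Q y" by blast
    show "u + v \<in> range Q"
      unfolding u v bounded_op_add[OF b, symmetric] by (rule rangeI)
  qed
  show "closed (range Q)"
  proof (rule closed_sequential_limits[THEN iffD2], intro allI impI, elim conjE)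
    fix y l assume "\<forall>n. y n \<in> range Q" and l: "y \<longlonglongrightarrow> l"
    then obtain x where y: "\<And>n. y n = Q (x n)" unfolding image_iff by metis
    have "Cauchy x"
    proof (rule metric_CauchyI)
      fix e :: real assume "e > 0"
      then obtain M where M: "\<forall>i\<ge>M. \<forall>j\<ge>M. dist (y i) (y j) < c * e"
        using metric_CauchyD[OF LIMSEQ_imp_Cauchy[OF l], of "c * e"] c by auto
      have "dist (x i) (x j) < e" if "i \<ge> M" "j \<ge> M" for i j
      proof -
        have "c * norm (x i - x j) < c * e"
          using M that below[of "x i - x j"] by (force simp: dist_norm y bounded_op_diff[OF b])
        then show ?thesis using c by (simp add: dist_norm)
      qed
      then show "\<exists>M. \<forall>i\<ge>M. \<forall>j\<ge>M. dist (x i) (x j) < e" by blast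
    qed
    then obtain z where "x \<longlonglongrightarrow> z" by (auto simp: Cauchy_convergent_iff convergent_def)
    then have "y \<longlonglongrightarrow> Q z"
      unfolding y using bounded_linear.tendsto[OF bounded_op_bounded_linear[OF b]] by blast
    then show "l \<in> range Q" using l LIMSEQ_unique by blast
  qed
  have f: "Q (inv Q y) = y" if "y \<in> range Q" for y using that by (rule f_inv_into_f)
  have "bounded_op_on (range Q) (inv Q)"
  proof (rule bounded_op_onI)
    show "inv Q (x + y) = inv Q x + inv Q y" if "x \<in> range Q" "y \<in> range Q" for x y
      using that by (intro inv_f_eq[OF inj]) (simp add: f bounded_op_add[OF b])
    show "inv Q (r *\<^sub>C x) = r *\<^sub>C inv Q x" if "x \<in> range Q" for r x
      using that by (intro inv_f_eq[OF inj]) (simp add: f bounded_op_scaleC[OF b])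
    show "norm (inv Q x) \<le> 1 / c * norm x" if "x \<in> range Q" for x
      using below[of "inv Q x"] c by (simp add: f[OF that] field_simps)
  qed
  then show "invertible_op UNIV (range Q) Q" using b inj by (simp add: invertible_op_def bij_betw_def)
qed

section \<open>Quadratic forms and weak sums of positive operators\<close>

lemma qform_le_norm:
  assumes "bounded_op T"
  obtains K where "K > 0" "\<And>x. qform T x \<le> K * (norm x)\<^sup>2"
proof -
  obtain K where K: "K > 0" "\<And>x. norm (T x) \<le> K * norm x"
    using bounded_op_on_bound[OF assms] by (metis UNIV_I)
  have "qform T x \<le> K * (norm x)\<^sup>2" for x
  proof -
    have "qform T x \<le> norm (T x) * norm x"
      unfolding qform_def using complex_Re_le_cmod cmod_cinner_le order_trans by blast
    also have "\<dots> \<le> K * norm x * norm x" using K by (intro mult_right_mono) auto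
    finally show ?thesis by (simp add: power2_eq_square)
  qed
  then show ?thesis using K(1) that by blast
qed

lemma qform_diff: "qform (\<lambda>x. S x - T x) x = qform S x - qform T x"
  by (simp add: qform_def cinner_diff_left)

lemma qform_scaleR_id: "qform (\<lambda>x. c *\<^sub>R x) x = c * (norm x)\<^sup>2"
  by (simp add: qform_def cinner_scaleR_left cinner_self)

lemma qform_scaleR: "qform (\<lambda>x. c *\<^sub>R T x) x = c * qform T x"
  by (simp add: qform_def cinner_scaleR_left)

lemma positive_op_scaleR: "positive_op T \<Longrightarrow> 0 \<le> c \<Longrightarrow> positive_op (\<lambda>x. c *\<^sub>R T x)"
  by (rule positive_opI[where q = "\<lambda>x. c * qform T x"])
    (auto simp: positive_op_bounded bounded_op_scaleR_op cinner_scaleR_left cinner_qform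
      scaleR_conv_of_real qform_nonneg)

lemma positive_op_id: "positive_op id"
  by (rule positive_opI[where q = "\<lambda>x. (norm x)\<^sup>2"]) (auto simp: bounded_op_id cinner_self)

lemma positive_op_diff:
  assumes "positive_op S" "positive_op T" "\<And>x. qform T x \<le> qform S x"
  shows "positive_op (\<lambda>x. S x - T x)"
  by (rule positive_opI[where q = "\<lambda>x. qform S x - qform T x"])
    (use assms in \<open>auto simp: positive_op_bounded bounded_op_diff_op cinner_diff_left cinner_qform\<close>)

lemma op_le_iff:
  assumes "positive_op S" "positive_op T"
  shows "op_le S T \<longleftrightarrow> (\<forall>x. qform S x \<le> qform T x)"
proof
  assume "op_le S T"
  then show "\<forall>x. qform S x \<le> qform T x"
    unfolding op_le_def using qform_nonneg[of "\<lambda>x. T x - S x"] by (simp add: qform_diff)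
qed (simp add: op_le_def positive_op_diff assms)

definition enf :: "('a::complex_inner \<Rightarrow> 'a) \<Rightarrow> 'a \<Rightarrow> ennreal" where
  "enf T x = ennreal (qform T x)"

lemma enf_finite: "enf T x < \<infinity>"
  by (simp add: enf_def)

lemma ennreal_infsum_eq:
  assumes "(f has_sum s) I" "\<And>i. i \<in> I \<Longrightarrow> 0 \<le> f i"
  shows "(\<Sum>\<^sub>\<infinity>i\<in>I. ennreal (f i)) = ennreal s"
proof -
  have "(\<Sum>\<^sub>\<infinity>i\<in>I. ennreal (f i)) = (SUP F\<in>{F. finite F \<and> F \<subseteq> I}. \<Sum>i\<in>F. ennreal (f i))"
    by (rule nonneg_infsum_complete) simp
  also have "\<dots> = (SUP F\<in>{F. finite F \<and> F \<subseteq> I}. ennreal (sum f F))"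
    using assms(2) by (intro SUP_cong refl sum_ennreal) auto
  also have "\<dots> = ennreal (infsum f I)"
    using assms by (intro infsum_nonneg_is_SUPREMUM_ennreal[symmetric]) (auto simp: summable_on_def)
  finally show ?thesis using assms(1) by (simp add: infsumI)
qed

lemma has_sum_if_ennreal_infsum:
  assumes "(\<Sum>\<^sub>\<infinity>i\<in>I. ennreal (f i)) = ennreal s" "\<And>i. i \<in> I \<Longrightarrow> 0 \<le> f i" "0 \<le> s"
  shows "(f has_sum s) I"
proof -
  have "f summable_on I"
  proof (rule nonneg_bdd_above_summable_on)
    show "bdd_above (sum f ` {F. F \<subseteq> I \<and> finite F})"
    proof (rule bdd_aboveI, clarify)
      fix F assume F: "F \<subseteq> I" "finite F"
      have "ennreal (sum f F) = (\<Sum>i\<in>F. ennreal (f i))"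
        using F assms(2) by (intro sum_ennreal[symmetric]) auto
      also have "\<dots> = (\<Sum>\<^sub>\<infinity>i\<in>F. ennreal (f i))" using F by simp
      also have "\<dots> \<le> ennreal s" unfolding assms(1)[symmetric] by (rule infsum_ennreal_mono_set[OF F(1)])
      finally show "sum f F \<le> s" using assms(3) by (simp add: ennreal_le_iff)
    qed
  qed (use assms in auto)
  then have "(f has_sum infsum f I) I" by simp
  moreover have "infsum f I = s"
    using ennreal_infsum_eq[OF \<open>(f has_sum infsum f I) I\<close>] assms infsum_nonneg[of I f]
    by (simp add: ennreal_inj)
  ultimately show ?thesis by simp
qed

lemma wot_infsum_eqI:
  fixes T :: "'a::complex_inner \<Rightarrow> 'a"
  assumes "wot_has_sum X I T"
  shows "wot_infsum X I = T"
  unfolding wot_infsum_def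
proof (rule the_equality)
  show "wot_has_sum X I T" by (rule assms)
  fix S assume "wot_has_sum X I S"
  then have "cinner (S x) y = cinner (T x) y" for x y
    using assms unfolding wot_has_sum_def by (metis has_sum_unique)
  then show "S = T" by (intro ext) (rule cinner_extensionality)
qed

lemma wot_has_sum_positive:
  fixes T :: "'a::complex_inner \<Rightarrow> 'a"
  assumes "wot_has_sum X I T" "\<And>i. i \<in> I \<Longrightarrow> positive_op (X i)"
  shows "positive_op T" "enf T x = (\<Sum>\<^sub>\<infinity>i\<in>I. enf (X i) x)"
proof -
  have hs: "((\<lambda>i. cinner (X i x) x) has_sum cinner (T x) x) I" for x
    using assms(1) by (simp add: wot_has_sum_def)
  have re: "((\<lambda>i. qform (X i) x) has_sum qform T x) I" for x
    unfolding qform_def by (rule has_sum_Re[OF hs])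
  have "((\<lambda>i. complex_of_real (qform (X i) x)) has_sum complex_of_real (qform T x)) I" for x
    using re by (rule has_sum_of_real)
  moreover have "((\<lambda>i. complex_of_real (qform (X i) x)) has_sum cinner (T x) x) I" for x
    using hs[of x] by (rule has_sum_cong[THEN iffD1, rotated]) (simp add: cinner_qform assms(2))
  ultimately have "cinner (T x) x = complex_of_real (qform T x)" for x
    using has_sum_unique by blast
  moreover have "0 \<le> qform T x" for x
    using re[of x] by (rule has_sum_nonneg) (simp add: qform_nonneg assms(2))
  ultimately show "positive_op T"
    using assms(1) by (intro positive_opI) (auto simp: wot_has_sum_def)
  show "enf T x = (\<Sum>\<^sub>\<infinity>i\<in>I. enf (X i) x)"
    unfolding enf_def using ennreal_infsum_eq[OF re] assms(2) by (simp add: qform_nonneg)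
qed

text \<open>A bound on the diagonal suffices: polarization makes all matrix entries summable,
  Cauchy-Schwarz bounds the summed form, and the Riesz theorem supplies the operator.\<close>

lemma positive_series_wot_has_sum:
  fixes X :: "'i \<Rightarrow> 'a::chilbert_space \<Rightarrow> 'a"
  assumes X: "\<And>i. i \<in> I \<Longrightarrow> positive_op (X i)"
    and K: "\<And>x. (\<Sum>\<^sub>\<infinity>i\<in>I. enf (X i) x) \<le> ennreal (K * (norm x)\<^sup>2)"
  shows "\<exists>T. wot_has_sum X I T"
proof -
  note b = positive_op_bounded[OF X]
  define q where "q x = enn2real (\<Sum>\<^sub>\<infinity>i\<in>I. enf (X i) x)" for x
  have q0: "0 \<le> q x" for x by (simp add: q_def)
  have top: "(\<Sum>\<^sub>\<infinity>i\<in>I. enf (X i) x) < top" for x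
    using K[of x] by (rule order.strict_trans1) simp
  then have eq: "(\<Sum>\<^sub>\<infinity>i\<in>I. enf (X i) x) = ennreal (q x)" for x
    by (simp add: q_def)
  then have qs: "((\<lambda>i. qform (X i) x) has_sum q x) I" for x
    unfolding enf_def using X q0 by (intro has_sum_if_ennreal_infsum) (auto simp: qform_nonneg)
  have qK: "q x \<le> \<bar>K\<bar> * (norm x)\<^sup>2" for x
  proof -
    have "K * (norm x)\<^sup>2 \<le> \<bar>K\<bar> * (norm x)\<^sup>2" by (intro mult_right_mono) auto
    from order_trans[OF K[of x] ennreal_leI[OF this]]
    have "ennreal (q x) \<le> ennreal (\<bar>K\<bar> * (norm x)\<^sup>2)" unfolding eq .
    then show ?thesis by (simp add: ennreal_le_iff)
  qed
  have summ: "(\<lambda>i. cinner (X i x) y) summable_on I" for x y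
  proof -
    have "(\<lambda>i. \<Sum>c\<in>{1,-1,\<i>,-\<i>}. (c / 4) * complex_of_real (qform (X i) (x + c *\<^sub>C y))) summable_on I"
      unfolding sum_unit_roots4
      using has_sum_of_real[OF qs]
      by (intro summable_on_add summable_on_cmult_right) (auto simp: summable_on_def)
    then show ?thesis
    proof (rule summable_on_cong[THEN iffD1, rotated])
      fix i assume i: "i \<in> I"
      have "4 * cinner (X i x) y = (\<Sum>c\<in>{1,-1,\<i>,-\<i>}. c * complex_of_real (qform (X i) (x + c *\<^sub>C y)))"
        unfolding polarization[OF b[OF i]] cinner_qform[OF X[OF i]] ..
      then show "(\<Sum>c\<in>{1,-1,\<i>,-\<i>}. (c / 4) * complex_of_real (qform (X i) (x + c *\<^sub>C y))) = cinner (X i x) y"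
        unfolding times_divide_eq_left sum_divide_distrib[symmetric] by (metis nonzero_mult_div_cancel_left zero_neq_numeral)
    qed
  qed
  define B where "B x y = (\<Sum>\<^sub>\<infinity>i\<in>I. cinner (X i x) y)" for x y
  have addl: "B (x + y) z = B x z + B y z" for x y z
    unfolding B_def infsum_add[OF summ summ, symmetric]
    by (intro infsum_cong) (simp add: bounded_op_add[OF b] cinner_add_left)
  have scl: "B (c *\<^sub>C x) y = c * B x y" for c x y
    unfolding B_def infsum_cmult_right'[symmetric]
    by (intro infsum_cong) (simp add: bounded_op_scaleC[OF b] cinner_scaleC_left)
  have herm: "B y x = cnj (B x y)" for x y
    unfolding B_def infsum_cnj[symmetric]
  proof (rule infsum_cong)
    fix i assume "i \<in> I"
    then have "cinner (X i y) x = cinner y (X i x)" by (intro positive_op_symmetric X)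
    also have "\<dots> = cnj (cinner (X i x) y)" by (rule cinner_commute)
    finally show "cinner (X i y) x = cnj (cinner (X i x) y)" .
  qed
  have Bq: "B x x = complex_of_real (q x)" for x
    unfolding B_def using has_sum_of_real[OF qs[of x]]
    by (intro infsumI) (simp add: cinner_qform X cong: has_sum_cong)
  have addr: "B z (u + v) = B z u + B z v" for z u v
    by (metis addl herm complex_cnj_add)
  have scr: "B u (c *\<^sub>C v) = cnj c * B u v" for c u v
    by (metis scl herm complex_cnj_mult)
  have bd: "cmod (B x y) \<le> \<bar>K\<bar> * norm x * norm y" for x y
  proof (rule power2_le_imp_le)
    have "(cmod (B x y))\<^sup>2 \<le> q x * q y"
      by (rule form_cauchy_schwarz[OF addl scl herm Bq q0])
    also have "\<dots> \<le> (\<bar>K\<bar> * (norm x)\<^sup>2) * (\<bar>K\<bar> * (norm y)\<^sup>2)"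
      by (intro mult_mono qK q0) auto
    finally show "(cmod (B x y))\<^sup>2 \<le> (\<bar>K\<bar> * norm x * norm y)\<^sup>2"
      by (simp add: power2_eq_square mult_ac)
  qed simp
  obtain T where "bounded_op T" "\<And>x y. cinner (T x) y = B x y"
    using sesquilinear_form_operator[OF addl addr scl scr bd] by blast
  then have "wot_has_sum X I T"
    using summ by (simp add: wot_has_sum_def B_def)
  then show ?thesis by blast
qed

lemma bounded_op_word_op:
  "(\<And>j. j \<in> set w \<Longrightarrow> bounded_op (X j)) \<Longrightarrow> bounded_op (word_op X w)"
  by (induction w) (auto simp: word_op_def bounded_op_id intro!: bounded_op_comp)

lemma adj_word_op:
  fixes X :: "nat \<Rightarrow> 'a::chilbert_space \<Rightarrow> 'a"
  assumes "\<And>j. j \<in> set w \<Longrightarrow> bounded_op (X j)"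
  shows "adj (word_op X w) = fold (\<lambda>j. adj (X j)) w"
  using assms
proof (induction w)
  case Nil
  have "word_op X [] = id" by (simp add: word_op_def)
  then show ?case by (simp add: adj_id[unfolded id_def])
next
  case (Cons j w)
  have "word_op X (j # w) = X j \<circ> word_op X w" by (simp add: word_op_def)
  then have "adj (word_op X (j # w)) = adj (word_op X w) \<circ> adj (X j)"
    using Cons.prems by (simp add: adj_comp bounded_op_word_op)
  then show ?case using Cons by simp
qed

lemma Phi_term_positive:
  fixes W X :: "'a::chilbert_space \<Rightarrow> 'a"
  assumes W: "bounded_op W" and X: "positive_op X" and c: "0 \<le> c"
  shows "positive_op (\<lambda>x. c *\<^sub>R W (X (adj W x)))"
    and "qform (\<lambda>x. c *\<^sub>R W (X (adj W x))) x = c * qform X (adj W x)"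
proof -
  have eq: "cinner (W (X (adj W x))) x = cinner (X (adj W x)) (adj W x)" for x
    by (simp add: cinner_adj[OF W])
  have "bounded_op (W \<circ> X \<circ> adj W)"
    by (intro bounded_op_comp W positive_op_bounded[OF X] bounded_op_adj)
  then have "bounded_op (\<lambda>x. c *\<^sub>R W (X (adj W x)))"
    by (drule_tac bounded_op_scaleR_op) (simp add: o_def)
  then show "positive_op (\<lambda>x. c *\<^sub>R W (X (adj W x)))"
    by (rule positive_opI[where q = "\<lambda>x. c * qform X (adj W x)"])
      (use c in \<open>auto simp: cinner_scaleR_left eq cinner_qform[OF X] scaleR_conv_of_real qform_nonneg[OF X]\<close>)
  show "qform (\<lambda>x. c *\<^sub>R W (X (adj W x))) x = c * qform X (adj W x)"
    by (simp add: qform_def cinner_scaleR_left eq)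
qed

section \<open>The maps Phi_i of a commuting tuple and the series in (iii)\<close>

locale op_tuple =
  fixes k :: nat and n :: "nat \<Rightarrow> nat" and a :: "nat \<Rightarrow> nat list \<Rightarrow> real"
    and A :: "nat \<Rightarrow> nat \<Rightarrow> 'h \<Rightarrow> 'h::chilbert_space"
  assumes a_nonneg: "\<And>i \<alpha>. i \<in> {1..k} \<Longrightarrow> \<alpha> \<in> lists {1..n i} \<Longrightarrow> 0 \<le> a i \<alpha>"
    and a_Nil: "\<And>i. i \<in> {1..k} \<Longrightarrow> a i [] = 0"
    and A_tuple: "A \<in> commuting_tuples k n"
    and A_summable: "\<And>i. i \<in> {1..k} \<Longrightarrow>
      \<exists>T. wot_has_sum (\<lambda>\<alpha> x. a i \<alpha> *\<^sub>R word_op (A i) \<alpha> (adj (word_op (A i) \<alpha>) x)) (lists {1..n i}) T"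
begin

definition C :: "nat \<Rightarrow> nat \<Rightarrow> 'h \<Rightarrow> 'h" where "C i j = adj (A i j)"

definition F :: "nat \<Rightarrow> ('h \<Rightarrow> ennreal) \<Rightarrow> 'h \<Rightarrow> ennreal" where "F i = Phif (n i) (a i) (C i)"

abbreviation \<Phi> :: "nat \<Rightarrow> ('h \<Rightarrow> 'h) \<Rightarrow> 'h \<Rightarrow> 'h" where "\<Phi> i \<equiv> Phi (n i) (a i) (A i)"

lemma bounded_A: "i \<in> {1..k} \<Longrightarrow> j \<in> {1..n i} \<Longrightarrow> bounded_op (A i j)"
  using A_tuple by (simp add: commuting_tuples_def)

lemma bounded_C: "i \<in> {1..k} \<Longrightarrow> j \<in> {1..n i} \<Longrightarrow> bounded_op (C i j)"
  unfolding C_def by (intro bounded_op_adj bounded_A)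

lemma C_commute:
  assumes "s \<in> {1..k}" "t \<in> {1..k}" "s \<noteq> t" "j \<in> {1..n s}" "l \<in> {1..n t}"
  shows "C s j \<circ> C t l = C t l \<circ> C s j"
proof -
  have "A s j \<circ> A t l = A t l \<circ> A s j" using A_tuple assms by (simp add: commuting_tuples_def)
  then have "adj (A s j \<circ> A t l) = adj (A t l \<circ> A s j)" by simp
  then show ?thesis using assms by (simp add: C_def adj_comp bounded_A)
qed

lemma cnt_add_F: "cnt_add (F i)"
  unfolding F_def by (rule cnt_add_Phif)

lemma F_commute: "s \<in> {1..k} \<Longrightarrow> t \<in> {1..k} \<Longrightarrow> s \<noteq> t \<Longrightarrow> F s \<circ> F t = F t \<circ> F s"
  unfolding F_def by (intro Phif_commute C_commute)

lemma geom_F_commute: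
  "s \<in> {1..k} \<Longrightarrow> t \<in> {1..k} \<Longrightarrow> s \<noteq> t \<Longrightarrow> geom (F s) \<circ> geom (F t) = geom (F t) \<circ> geom (F s)"
  by (intro geom_commute cnt_add_geom cnt_add_F geom_commute[symmetric] F_commute)

lemma word_in_lists: "\<alpha> \<in> lists {1..n i} \<Longrightarrow> i \<in> {1..k} \<Longrightarrow> j \<in> set \<alpha> \<Longrightarrow> bounded_op (A i j)"
  by (intro bounded_A) (auto simp: lists_eq_set)

lemma adj_word: "i \<in> {1..k} \<Longrightarrow> \<alpha> \<in> lists {1..n i} \<Longrightarrow> adj (word_op (A i) \<alpha>) = fold (C i) \<alpha>"
  unfolding C_def by (rule adj_word_op) (rule word_in_lists)

lemma Phi_summands:
  assumes "i \<in> {1..k}" "positive_op X" "\<alpha> \<in> lists {1..n i}"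
  shows "positive_op (\<lambda>x. a i \<alpha> *\<^sub>R word_op (A i) \<alpha> (X (adj (word_op (A i) \<alpha>) x)))"
    and "enf (\<lambda>x. a i \<alpha> *\<^sub>R word_op (A i) \<alpha> (X (adj (word_op (A i) \<alpha>) x))) x
      = ennreal (a i \<alpha>) * enf X (fold (C i) \<alpha> x)"
proof -
  have W: "bounded_op (word_op (A i) \<alpha>)"
    using assms word_in_lists by (intro bounded_op_word_op) blast
  note t = Phi_term_positive[OF W assms(2) a_nonneg[OF assms(1,3)]]
  show "positive_op (\<lambda>x. a i \<alpha> *\<^sub>R word_op (A i) \<alpha> (X (adj (word_op (A i) \<alpha>) x)))" by (rule t)
  show "enf (\<lambda>x. a i \<alpha> *\<^sub>R word_op (A i) \<alpha> (X (adj (word_op (A i) \<alpha>) x))) x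
      = ennreal (a i \<alpha>) * enf X (fold (C i) \<alpha> x)"
    unfolding enf_def t(2) unfolding adj_word[OF assms(1,3)]
    by (simp add: ennreal_mult a_nonneg[OF assms(1,3)] qform_nonneg[OF assms(2)])
qed

text \<open>The assumed weak convergence is the case X = I. Any other positive X satisfies X \<le> L
  I for some L, so \<open>Phi_positive\<close> gets its bound by domination.\<close>

lemma F_norm_bounded:
  assumes i: "i \<in> {1..k}"
  obtains K where "K > 0" "\<And>x. F i (enf id) x \<le> ennreal (K * (norm x)\<^sup>2)"
proof -
  obtain T where T: "wot_has_sum (\<lambda>\<alpha> x. a i \<alpha> *\<^sub>R word_op (A i) \<alpha> (id (adj (word_op (A i) \<alpha>) x)))
      (lists {1..n i}) T"
    using A_summable[OF i] by auto
  note p = wot_has_sum_positive[OF T Phi_summands(1)[OF i positive_op_id]]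
  obtain K where "K > 0" "\<And>x. qform T x \<le> K * (norm x)\<^sup>2"
    using qform_le_norm[OF positive_op_bounded[OF p(1)]] by blast
  moreover have "F i (enf id) x = enf T x" for x
  proof -
    have "enf T x = (\<Sum>\<^sub>\<infinity>\<alpha>\<in>lists {1..n i}. ennreal (a i \<alpha>) * enf id (fold (C i) \<alpha> x))"
      by (rule trans[OF p(2)], assumption) (rule infsum_cong, rule Phi_summands(2)[OF i positive_op_id])
    then show ?thesis by (simp add: F_def Phif_def)
  qed
  ultimately show ?thesis using that by (simp add: enf_def ennreal_leI)
qed

lemma Phi_positive:
  assumes i: "i \<in> {1..k}" and X: "positive_op X"
  shows "positive_op (\<Phi> i X)" and "enf (\<Phi> i X) = F i (enf X)"
proof -
  let ?X = "\<lambda>\<alpha> x. a i \<alpha> *\<^sub>R word_op (A i) \<alpha> (X (adj (word_op (A i) \<alpha>) x))"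
  obtain K where K: "K > 0" "\<And>x. F i (enf id) x \<le> ennreal (K * (norm x)\<^sup>2)"
    using F_norm_bounded[OF i] by blast
  obtain L where L: "L > 0" "\<And>x. qform X x \<le> L * (norm x)\<^sup>2"
    using qform_le_norm[OF positive_op_bounded[OF X]] by blast
  have F: "(\<Sum>\<^sub>\<infinity>\<alpha>\<in>lists {1..n i}. enf (?X \<alpha>) x) = F i (enf X) x" for x
    unfolding F_def Phif_def by (rule infsum_cong) (rule Phi_summands(2)[OF i X])
  have "F i (enf X) x \<le> ennreal (L * K * (norm x)\<^sup>2)" for x
  proof -
    have "enf X y \<le> ennreal L * enf id y" for y
      using L(2)[of y] L(1) by (simp add: enf_def qform_def cinner_self ennreal_leI flip: ennreal_mult)
    then have "F i (enf X) x \<le> (\<Sum>\<^sub>\<infinity>\<alpha>\<in>lists {1..n i}. ennreal L * (ennreal (a i \<alpha>) * enf id (fold (C i) \<alpha> x)))"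
      unfolding F_def Phif_def
      by (intro infsum_ennreal_mono) (metis mult.left_commute mult_left_mono zero_le)
    also have "\<dots> = ennreal L * F i (enf id) x"
      by (simp add: infsum_ennreal_cmult F_def Phif_def)
    also have "\<dots> \<le> ennreal L * ennreal (K * (norm x)\<^sup>2)" by (intro mult_left_mono K) simp
    also have "\<dots> = ennreal (L * K * (norm x)\<^sup>2)"
      using L K by (simp add: mult.assoc flip: ennreal_mult)
    finally show ?thesis .
  qed
  then obtain T where T: "wot_has_sum ?X (lists {1..n i}) T"
    using positive_series_wot_has_sum[of "lists {1..n i}" ?X] Phi_summands(1)[OF i X] unfolding F by blast
  then have "\<Phi> i X = T" unfolding Phi_def by (rule wot_infsum_eqI)
  then show "positive_op (\<Phi> i X)" "enf (\<Phi> i X) = F i (enf X)"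
    using wot_has_sum_positive[OF T Phi_summands(1)[OF i X]] unfolding F by auto
qed

lemma Phi_funpow_positive:
  assumes "i \<in> {1..k}" "positive_op X"
  shows "positive_op ((\<Phi> i ^^ s) X) \<and> enf ((\<Phi> i ^^ s) X) = (F i ^^ s) (enf X)"
  by (induction s) (auto simp: assms Phi_positive[OF assms(1)] simp del: One_nat_def)

lemma ordered_comp_Phi_positive:
  assumes "positive_op X"
  shows "positive_op (ordered_comp k (\<lambda>i. \<Phi> i ^^ s i) X)"
    and "enf (ordered_comp k (\<lambda>i. \<Phi> i ^^ s i) X) = ordered_comp k (\<lambda>i. F i ^^ s i) (enf X)"
proof -
  have *: "positive_op (list_comp (\<lambda>i. \<Phi> i ^^ s i) is X) \<and>
      enf (list_comp (\<lambda>i. \<Phi> i ^^ s i) is X) = list_comp (\<lambda>i. F i ^^ s i) is (enf X)"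
    if "set is \<subseteq> {1..k}" for "is"
    using that
  proof (induction "is")
    case (Cons i js)
    then have "i \<in> {1..k}" by simp
    from Phi_funpow_positive[OF this] show ?case using Cons by simp
  qed (simp add: assms)
  have "positive_op (list_comp (\<lambda>i. \<Phi> i ^^ s i) [1..<Suc k] X) \<and>
      enf (list_comp (\<lambda>i. \<Phi> i ^^ s i) [1..<Suc k] X) = list_comp (\<lambda>i. F i ^^ s i) [1..<Suc k] (enf X)"
    by (rule *) auto
  then show "positive_op (ordered_comp k (\<lambda>i. \<Phi> i ^^ s i) X)"
    and "enf (ordered_comp k (\<lambda>i. \<Phi> i ^^ s i) X) = ordered_comp k (\<lambda>i. F i ^^ s i) (enf X)"
    unfolding ordered_comp_eq_list_comp by auto
qed

text \<open>The exponents are a parameter because a defect at index i cancels one of the factors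
  \<open>geom (F i)\<close>.\<close>

definition G :: "(nat \<Rightarrow> nat) \<Rightarrow> ('h \<Rightarrow> ennreal) \<Rightarrow> 'h \<Rightarrow> ennreal" where
  "G m = ordered_comp k (\<lambda>i. geom (F i) ^^ m i)"

lemma G_Suc: "i \<in> {1..k} \<Longrightarrow> G (m(i := Suc (m i))) r = geom (F i) (G m r)"
  unfolding G_def ordered_comp_eq_list_comp by (intro list_comp_funpow_Suc geom_F_commute) auto

definition series_term :: "(nat \<Rightarrow> nat) \<Rightarrow> ('h \<Rightarrow> 'h) \<Rightarrow> (nat \<Rightarrow> nat) \<Rightarrow> 'h \<Rightarrow> 'h" where
  "series_term m R s x = (\<Prod>i=1..k. real ((s i + m i - 1) choose (m i - 1))) *\<^sub>R
     ordered_comp k (\<lambda>i. \<Phi> i ^^ s i) R x"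

lemma series_term_positive: "positive_op R \<Longrightarrow> positive_op (series_term m R s)"
  unfolding series_term_def[abs_def]
  by (intro positive_op_scaleR ordered_comp_Phi_positive prod_nonneg) auto

lemma series_eq_ordered_comp:
  assumes "positive_op R"
  shows "(\<Sum>\<^sub>\<infinity>s\<in>(\<Pi>\<^sub>E i\<in>{1..k}. UNIV). enf (series_term m R s) x)
    = ordered_comp k (\<lambda>i q x. \<Sum>\<^sub>\<infinity>t. of_nat ((t + m i - 1) choose (m i - 1)) * (F i ^^ t) q x) (enf R) x"
proof -
  have "enf (series_term m R s) x
      = (\<Prod>i=1..k. of_nat ((s i + m i - 1) choose (m i - 1))) * ordered_comp k (\<lambda>i. F i ^^ s i) (enf R) x" for s
  proof -
    have "enf (series_term m R s) x
        = ennreal (\<Prod>i=1..k. real ((s i + m i - 1) choose (m i - 1))) * enf (ordered_comp k (\<lambda>i. \<Phi> i ^^ s i) R) x"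
      unfolding enf_def series_term_def[abs_def] qform_scaleR
      by (intro ennreal_mult prod_nonneg qform_nonneg ordered_comp_Phi_positive assms) auto
    also have "ennreal (\<Prod>i=1..k. real ((s i + m i - 1) choose (m i - 1)))
        = (\<Prod>i=1..k. of_nat ((s i + m i - 1) choose (m i - 1)))"
      unfolding ennreal_of_nat_eq_real_of_nat by (intro prod_ennreal[symmetric]) auto
    finally show ?thesis by (simp only: ordered_comp_Phi_positive(2)[OF assms])
  qed
  then show ?thesis
    by (simp only: ordered_comp_series[OF cnt_add_F,
          where w = "\<lambda>i t. of_nat ((t + m i - 1) choose (m i - 1))"])
qed

lemma series_eq_G:
  assumes "positive_op R" and m: "\<forall>i\<in>{1..k}. m i \<ge> 1"
  shows "(\<Sum>\<^sub>\<infinity>s\<in>(\<Pi>\<^sub>E i\<in>{1..k}. UNIV). enf (series_term m R s) x) = G m (enf R) x"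
  unfolding series_eq_ordered_comp[OF assms(1)] G_def
proof (rule arg_cong[where f = "\<lambda>H. H (enf R) x"], rule ordered_comp_cong, intro ext)
  fix i q x assume "i \<in> {1..k}"
  \<comment> \<open>For \<open>m i = 0\<close> truncated subtraction would turn every coefficient
    into 1: one geometric series instead of none.\<close>
  then obtain l where "m i = Suc l" using m by (metis Suc_le_D One_nat_def)
  then show "(\<Sum>\<^sub>\<infinity>t. of_nat ((t + m i - 1) choose (m i - 1)) * (F i ^^ t) q x) = (geom (F i) ^^ m i) q x"
    using geom_funpow[OF cnt_add_F, where m = l] by simp
qed

lemma series_eq_word_sum:
  assumes "positive_op R"
  shows "(\<Sum>\<^sub>\<infinity>s\<in>(\<Pi>\<^sub>E i\<in>{1..k}. UNIV). enf (series_term m R s) x)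
    = (\<Sum>\<^sub>\<infinity>\<alpha>\<in>mwords k n. (\<Prod>i=1..k. ennreal (bcoef (a i) (m i) (\<alpha> i))) * enf R (mfold k C \<alpha> x))"
  unfolding series_eq_ordered_comp[OF assms]
    ordered_comp_word_sums[where v = "\<lambda>i \<beta>. ennreal (bcoef (a i) (m i) \<beta>)", symmetric]
proof (rule arg_cong[where f = "\<lambda>H. H (enf R) x"], rule ordered_comp_cong, intro ext)
  fix i q x assume "i \<in> {1..k}"
  then show "(\<Sum>\<^sub>\<infinity>t. of_nat ((t + m i - 1) choose (m i - 1)) * (F i ^^ t) q x)
      = (\<Sum>\<^sub>\<infinity>\<beta>\<in>lists {1..n i}. ennreal (bcoef (a i) (m i) \<beta>) * q (fold (C i) \<beta> x))"
    unfolding F_def by (intro binomial_series_Phif a_nonneg a_Nil)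
qed

text \<open>The upper bound already forces weak convergence of the series, so the operator T can be
  eliminated from the condition.\<close>

lemma series_bounds_iff:
  "series_bounds k n m a A c d R \<longleftrightarrow> 0 < c \<and> c \<le> d \<and> positive_op R \<and>
    (\<forall>x. ennreal (c * (norm x)\<^sup>2) \<le> (\<Sum>\<^sub>\<infinity>s\<in>(\<Pi>\<^sub>E i\<in>{1..k}. UNIV). enf (series_term m R s) x) \<and>
         (\<Sum>\<^sub>\<infinity>s\<in>(\<Pi>\<^sub>E i\<in>{1..k}. UNIV). enf (series_term m R s) x) \<le> ennreal (d * (norm x)\<^sup>2))"
  (is "_ \<longleftrightarrow> 0 < c \<and> c \<le> d \<and> positive_op R \<and> ?B")
proof -
  have "(\<exists>T. wot_has_sum (series_term m R) (\<Pi>\<^sub>E i\<in>{1..k}. UNIV) T \<and>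
      op_le (\<lambda>x. c *\<^sub>R x) T \<and> op_le T (\<lambda>x. d *\<^sub>R x)) \<longleftrightarrow> ?B"
    if c: "0 < c" "c \<le> d" and R: "positive_op R"
  proof -
    have pc: "positive_op (\<lambda>x::'h. c *\<^sub>R x)" "positive_op (\<lambda>x::'h. d *\<^sub>R x)"
      using positive_op_scaleR[OF positive_op_id, of c] positive_op_scaleR[OF positive_op_id, of d] c
      by auto
    have iff: "op_le (\<lambda>x. c *\<^sub>R x) T \<and> op_le T (\<lambda>x. d *\<^sub>R x) \<longleftrightarrow> ?B"
      if T: "wot_has_sum (series_term m R) (\<Pi>\<^sub>E i\<in>{1..k}. UNIV) T" for T
    proof -
      note p = wot_has_sum_positive[OF T series_term_positive[OF R]]
      show ?thesis
        unfolding op_le_iff[OF pc(1) p(1)] op_le_iff[OF p(1) pc(2)] qform_scaleR_id p(2)[symmetric]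
        using c by (auto simp: enf_def ennreal_le_iff qform_nonneg[OF p(1)])
    qed
    have "?B \<Longrightarrow> \<exists>T. wot_has_sum (series_term m R) (\<Pi>\<^sub>E i\<in>{1..k}. UNIV) T"
      using positive_series_wot_has_sum[where X = "series_term m R" and K = d, OF series_term_positive[OF R]]
      by blast
    then show ?thesis using iff by auto
  qed
  moreover have "series_term m R = (\<lambda>s x. (\<Prod>i=1..k. real ((s i + m i - 1) choose (m i - 1))) *\<^sub>R
           ordered_comp k (\<lambda>i. Phi (n i) (a i) (A i) ^^ s i) R x)"
    by (simp add: series_term_def[abs_def] fun_eq_iff)
  ultimately show ?thesis unfolding series_bounds_def by auto
qed

section \<open>Defect operators and the equivalence of (ii) and (iii)\<close>

lemma defect_positive:
  assumes i: "i \<in> {1..k}" and X: "positive_op X" and z: "enf X = geom (F i) z"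
  shows "positive_op (\<lambda>x. X x - \<Phi> i X x)" "enf (\<lambda>x. X x - \<Phi> i X x) = z"
proof -
  note P = Phi_positive[OF i X]
  \<comment> \<open>\<open>geom (F i) z\<close> solves p = z + F p. Its values are finite here
    because they are those of the form of X, so the second summand can be subtracted.\<close>
  have eq: "enf X x = z x + enf (\<Phi> i X) x" for x
    using geom_unfold[OF cnt_add_F, of i z x] unfolding P z .
  then have "enf (\<Phi> i X) x \<le> enf X x" for x by simp
  then have le: "qform (\<Phi> i X) x \<le> qform X x" for x
    by (simp add: enf_def ennreal_le_iff qform_nonneg[OF X])
  then show "positive_op (\<lambda>x. X x - \<Phi> i X x)" by (rule positive_op_diff[OF X P(1)])
  show "enf (\<lambda>x. X x - \<Phi> i X x) = z"
  proof
    fix x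
    have "enf (\<lambda>x. X x - \<Phi> i X x) x = enf X x - enf (\<Phi> i X) x"
      using le qform_nonneg[OF P(1)] by (simp add: enf_def qform_diff ennreal_minus)
    also have "\<dots> = z x" unfolding eq using enf_finite[of "\<Phi> i X" x] by simp
    finally show "enf (\<lambda>x. X x - \<Phi> i X x) x = z x" .
  qed
qed

lemma defect_decomposition:
  assumes i: "i \<in> {1..k}" and X: "positive_op X" and D: "positive_op (\<lambda>x. X x - \<Phi> i X x)"
  shows "enf X x = enf (\<lambda>x. X x - \<Phi> i X x) x + F i (enf X) x"
  unfolding Phi_positive(2)[OF i X, symmetric]
  using qform_nonneg[OF D, of x] qform_nonneg[OF Phi_positive(1)[OF i X], of x]
  by (simp add: enf_def qform_diff flip: ennreal_plus)

text \<open>Each defect strips one factor \<open>geom (F i)\<close>, and \<open>t \<le> p i\<close>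
  guarantees that there is one left to strip.\<close>

lemma defect_power_of_G:
  assumes i: "i \<in> {1..k}"
  shows "positive_op X \<Longrightarrow> enf X = G p r \<Longrightarrow> t \<le> p i \<Longrightarrow>
    positive_op (((\<lambda>Y x. Y x - \<Phi> i Y x) ^^ t) X) \<and>
    enf (((\<lambda>Y x. Y x - \<Phi> i Y x) ^^ t) X) = G (p(i := p i - t)) r"
proof (induction t)
  case (Suc t)
  let ?Y = "((\<lambda>Y x. Y x - \<Phi> i Y x) ^^ t) X" and ?p = "p(i := p i - Suc t)"
  have "enf ?Y = G (p(i := p i - t)) r" using Suc by (simp only: Suc_leD)
  also have "p(i := p i - t) = ?p(i := Suc (?p i))" using Suc.prems(3) by (auto simp: fun_eq_iff)
  also have "G \<dots> r = geom (F i) (G ?p r)" by (rule G_Suc[OF i])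
  finally have "enf ?Y = geom (F i) (G ?p r)" .
  from defect_positive[OF i _ this] show ?case using Suc by (simp add: fun_upd_def)
qed simp

lemma Delta_of_G:
  assumes X: "positive_op X" "enf X = G m r" and p: "\<And>i. i \<in> {1..k} \<Longrightarrow> p i \<le> m i"
  shows "positive_op (Delta k n a A p X)"
proof -
  let ?D = "\<lambda>is. list_comp (\<lambda>i. (\<lambda>Y x. Y x - \<Phi> i Y x) ^^ p i) is X"
  \<comment> \<open>Exponents at the indices already treated are lowered to m - p, the others are
    still m; distinctness keeps an index from being lowered twice.\<close>
  have "positive_op (?D is) \<and> enf (?D is) = G (\<lambda>i. if i \<in> set is then m i - p i else m i) r"
    if "set is \<subseteq> {1..k}" "distinct is" for "is"
    using that
  proof (induction "is")
    case (Cons i js)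
    have IH: "positive_op (?D js)" "enf (?D js) = G (\<lambda>i. if i \<in> set js then m i - p i else m i) r"
      using Cons by auto
    have "p i \<le> (\<lambda>i. if i \<in> set js then m i - p i else m i) i" using Cons.prems p by auto
    from defect_power_of_G[OF _ IH this] Cons.prems
    have "positive_op (((\<lambda>Y x. Y x - \<Phi> i Y x) ^^ p i) (?D js))"
      "enf (((\<lambda>Y x. Y x - \<Phi> i Y x) ^^ p i) (?D js))
        = G ((\<lambda>i. if i \<in> set js then m i - p i else m i)(i := m i - p i)) r"
      by auto
    moreover have "(\<lambda>i. if i \<in> set js then m i - p i else m i)(i := m i - p i)
        = (\<lambda>l. if l \<in> set (i # js) then m l - p l else m l)"
      by auto
    ultimately show ?case by simp
  qed (simp add: X)
  moreover have "set [1..<Suc k] \<subseteq> {1..k}" by auto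
  ultimately have "positive_op (?D [1..<Suc k])" using distinct_upt by blast
  then show ?thesis unfolding Delta_def ordered_comp_eq_list_comp .
qed

lemma wot_tendsto_zeroI:
  fixes Y :: "nat \<Rightarrow> 'h \<Rightarrow> 'h"
  assumes Y: "\<And>s. positive_op (Y s)" and lim: "\<And>x. (\<lambda>s. enf (Y s) x) \<longlonglongrightarrow> 0"
  shows "wot_tendsto_zero Y"
  unfolding wot_tendsto_zero_def
proof (intro allI)
  fix x y
  have q: "(\<lambda>s. qform (Y s) z) \<longlonglongrightarrow> 0" for z
  proof -
    have "(\<lambda>s. enn2real (enf (Y s) z)) \<longlonglongrightarrow> enn2real 0"
      using lim[of z] by (intro tendsto_intros) auto
    then show ?thesis by (simp add: enf_def qform_nonneg[OF Y])
  qed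
  have "(\<lambda>s. (\<Sum>c\<in>{1,-1,\<i>,-\<i>}. c * complex_of_real (qform (Y s) (x + c *\<^sub>C y))) / 4)
      \<longlonglongrightarrow> (\<Sum>c\<in>{1,-1,\<i>,-\<i>}. c * complex_of_real 0) / 4"
    by (intro tendsto_intros q) auto
  moreover have "(\<Sum>c\<in>{1,-1,\<i>,-\<i>}. c * complex_of_real (qform (Y s) (x + c *\<^sub>C y))) / 4 = cinner (Y s x) y" for s
    unfolding cinner_qform[OF Y, symmetric] polarization[OF positive_op_bounded[OF Y], symmetric] by simp
  ultimately show "(\<lambda>s. cinner (Y s x) y) \<longlonglongrightarrow> 0" by simp
qed

text \<open>The range is closed, and a vector w orthogonal to it satisfies <w, Q w> = 0, hence is
  zero by the lower bound.\<close>

lemma bounded_below_positive_invertible: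
  fixes Q :: "'h \<Rightarrow> 'h"
  assumes Q: "positive_op Q" and c: "0 < c" "\<And>x. c * (norm x)\<^sup>2 \<le> qform Q x"
  shows "invertible_op UNIV UNIV Q"
proof -
  have below: "c * norm x \<le> norm (Q x)" for x
  proof (cases "x = 0")
    case False
    have "c * (norm x)\<^sup>2 \<le> norm (Q x) * norm x"
      using c(2)[of x] complex_Re_le_cmod[of "cinner (Q x) x"] cmod_cinner_le[of "Q x" x]
      by (simp add: qform_def)
    then show ?thesis using False by (simp add: power2_eq_square)
  qed simp
  note r = bounded_below_op[OF positive_op_bounded[OF Q] c(1) below]
  have "range Q = UNIV"
  proof (rule orthogonal_complement_trivial_imp_UNIV[OF r(1,2)])
    fix w assume "\<And>y. y \<in> range Q \<Longrightarrow> cinner w y = 0"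
    then have "qform Q w = 0" using positive_op_symmetric[OF Q, of w w] by (simp add: qform_def)
    then show "w = 0" using c(1) c(2)[of w] by (simp add: mult_le_0_iff)
  qed
  then show ?thesis using r(3) by simp
qed

text \<open>Invertibility gives norm x \<le> L norm (Q x), and Cauchy-Schwarz for the form of Q at x
  and Q x gives norm (Q x)^2 \<le> K \<open>qform Q x\<close>; together they yield the constant 1 /
  (L^2 K).\<close>

lemma positive_invertible_bounded_below:
  fixes Q :: "'h \<Rightarrow> 'h"
  assumes Q: "positive_op Q" and inv: "invertible_op UNIV UNIV Q"
  obtains c where "0 < c" "\<And>x. c * (norm x)\<^sup>2 \<le> qform Q x"
proof -
  obtain L where L: "L > 0" "\<And>x. norm (inv Q x) \<le> L * norm x"
    using inv bounded_op_on_bound[of UNIV "inv Q"] by (auto simp: invertible_op_def)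
  obtain K where K: "K > 0" "\<And>x. qform Q x \<le> K * (norm x)\<^sup>2"
    using qform_le_norm[OF positive_op_bounded[OF Q]] by blast
  have "(norm x)\<^sup>2 \<le> L\<^sup>2 * K * qform Q x" for x
  proof -
    have "norm x \<le> L * norm (Q x)"
      using L(2)[of "Q x"] inv by (simp add: invertible_op_def bij_betw_def)
    then have 1: "(norm x)\<^sup>2 \<le> L\<^sup>2 * (norm (Q x))\<^sup>2"
      using power_mono[of "norm x" "L * norm (Q x)" 2] by (simp add: power_mult_distrib)
    have "((norm (Q x))\<^sup>2)\<^sup>2 = (cmod (cinner (Q x) (Q x)))\<^sup>2" by (simp add: cinner_self norm_power)
    also have "\<dots> \<le> qform Q x * qform Q (Q x)" by (rule positive_op_cauchy_schwarz[OF Q])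
    also have "\<dots> \<le> qform Q x * (K * (norm (Q x))\<^sup>2)"
      by (intro mult_left_mono K qform_nonneg[OF Q])
    finally have "(norm (Q x))\<^sup>2 \<le> K * qform Q x"
      using qform_nonneg[OF Q, of x] K(1)
      by (cases "Q x = 0") (auto simp: power2_eq_square mult_ac)
    then show ?thesis
      using mult_left_mono[of "(norm (Q x))\<^sup>2" "K * qform Q x" "L\<^sup>2"] 1 by (simp add: mult.assoc)
  qed
  then show ?thesis using L(1) K(1) by (intro that[of "1 / (L\<^sup>2 * K)"]) (auto simp: field_simps)
qed

text \<open>Q is the sum of the series itself. Its form is \<open>G m (enf R)\<close>, and defects
  of order at most m merely remove factors from it.\<close>

lemma cone_of_series_bounds:
  assumes m: "\<forall>i\<in>{1..k}. m i \<ge> 1" and sb: "series_bounds k n m a A c d R"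
  shows "\<exists>Q. Q \<in> cone_ge k n m a A \<and> invertible_op UNIV UNIV Q \<and>
    (\<forall>i\<in>{1..k}. wot_tendsto_zero (\<lambda>s. (\<Phi> i ^^ s) Q))"
proof -
  have c: "0 < c" and R: "positive_op R"
    and lo: "\<And>x. ennreal (c * (norm x)\<^sup>2) \<le> G m (enf R) x"
    and hi: "\<And>x. G m (enf R) x \<le> ennreal (d * (norm x)\<^sup>2)"
    using sb unfolding series_bounds_iff using series_eq_G[OF _ m] by auto
  obtain Q where "wot_has_sum (series_term m R) (\<Pi>\<^sub>E i\<in>{1..k}. UNIV) Q"
    using positive_series_wot_has_sum[where X = "series_term m R" and I = "\<Pi>\<^sub>E i\<in>{1..k}. UNIV" and K = d,
        OF series_term_positive[OF R]]
    unfolding series_eq_G[OF R m] using hi by blast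
  from wot_has_sum_positive[OF this series_term_positive[OF R]]
  have Q: "positive_op Q" and QG: "enf Q = G m (enf R)"
    unfolding series_eq_G[OF R m] by auto
  have "invertible_op UNIV UNIV Q"
  proof (rule bounded_below_positive_invertible[OF Q c])
    show "c * (norm x)\<^sup>2 \<le> qform Q x" for x
      using lo[of x] by (simp add: enf_def ennreal_le_iff qform_nonneg[OF Q] flip: QG)
  qed
  moreover have "Q \<in> cone_ge k n m a A"
    unfolding cone_ge_def using Q Delta_of_G[OF Q QG] by auto
  moreover have "wot_tendsto_zero (\<lambda>s. (\<Phi> i ^^ s) Q)" if i: "i \<in> {1..k}" for i
  proof (rule wot_tendsto_zeroI)
    let ?p = "m(i := m i - 1)"
    \<comment> \<open>Since \<open>m i \<ge> 1\<close>, one factor \<open>geom (F i)\<close> can be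
      pulled out; the powers of \<open>F i\<close> on the form of Q are then remainders of a finite
      series.\<close>
    have "m = ?p(i := Suc (?p i))" using bspec[OF m i] by (auto simp: fun_eq_iff)
    then have "enf Q = geom (F i) (G ?p (enf R))" using G_Suc[OF i, of ?p] QG by metis
    then show "(\<lambda>s. enf ((\<Phi> i ^^ s) Q) x) \<longlonglongrightarrow> 0" for x
      using geom_tail_tendsto_0[OF cnt_add_F, of i _ x] enf_finite[of Q x] Phi_funpow_positive[OF i Q] by simp
  qed (use Phi_funpow_positive[OF i Q] in blast)
  ultimately show ?thesis by blast
qed

lemma F_funpow_mono:
  assumes "\<And>x. p x \<le> q x"
  shows "(F i ^^ s) p x \<le> (F i ^^ s) q x"
proof (induction s arbitrary: x)
  case (Suc s)
  then show ?case unfolding F_def Phif_def funpow.simps o_apply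
    by (intro infsum_ennreal_mono mult_left_mono) auto
qed (simp add: assms)

text \<open>Decay of the powers is known for a larger form q, later that of the original Q; the
  domination transfers it to X.\<close>

lemma geom_defect:
  assumes i: "i \<in> {1..k}" and X: "positive_op X" and D: "positive_op (\<lambda>x. X x - \<Phi> i X x)"
    and le: "\<And>x. enf X x \<le> q x" and lim: "\<And>x. (\<lambda>s. (F i ^^ s) q x) \<longlonglongrightarrow> 0"
  shows "geom (F i) (enf (\<lambda>x. X x - \<Phi> i X x)) = enf X"
proof (rule geom_eqI[OF cnt_add_F defect_decomposition[OF i X D]])
  show "(\<lambda>s. (F i ^^ s) (enf X) x) \<longlonglongrightarrow> 0" for x
    by (rule tendsto_sandwich[OF _ _ tendsto_const lim[of x]])
      (auto intro!: always_eventually F_funpow_mono le)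
qed

text \<open>The second conclusion keeps the domination by q available when the next index is
  treated.\<close>

lemma geom_defect_power:
  assumes i: "i \<in> {1..k}" and D: "\<And>s. s \<le> t \<Longrightarrow> positive_op (((\<lambda>Y x. Y x - \<Phi> i Y x) ^^ s) X)"
    and le: "\<And>x. enf X x \<le> q x" and lim: "\<And>x. (\<lambda>s. (F i ^^ s) q x) \<longlonglongrightarrow> 0"
  shows "(geom (F i) ^^ t) (enf (((\<lambda>Y x. Y x - \<Phi> i Y x) ^^ t) X)) = enf X \<and>
    (\<forall>x. enf (((\<lambda>Y x. Y x - \<Phi> i Y x) ^^ t) X) x \<le> q x)"
  using D
proof (induction t)
  case (Suc t)
  let ?Y = "((\<lambda>Y x. Y x - \<Phi> i Y x) ^^ t) X"
  have Y: "positive_op ?Y" "positive_op (\<lambda>x. ?Y x - \<Phi> i ?Y x)"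
    using Suc.prems[of t] Suc.prems[of "Suc t"] by auto
  have IH: "(geom (F i) ^^ t) (enf ?Y) = enf X" "\<And>x. enf ?Y x \<le> q x" using Suc by auto
  have "geom (F i) (enf (\<lambda>x. ?Y x - \<Phi> i ?Y x)) = enf ?Y"
    by (rule geom_defect[OF i Y IH(2) lim])
  moreover have "enf (\<lambda>x. ?Y x - \<Phi> i ?Y x) x \<le> q x" for x
    by (rule order_trans[OF _ IH(2)]) (subst defect_decomposition[OF i Y], simp)
  ultimately show ?case using IH(1) by (simp add: funpow_swap1)
qed (simp add: le)

text \<open>The indices are treated from k downwards, in the order in which \<open>Delta\<close>
  applies its factors. At each stage \<open>geom (F l) ^^ m l\<close> cancels the defects at l, and
  domination by Q supplies the decay of the remainders.\<close>

lemma G_Delta_eq: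
  assumes Q: "Q \<in> cone_ge k n m a A"
    and lim: "\<And>i x. i \<in> {1..k} \<Longrightarrow> (\<lambda>s. (F i ^^ s) (enf Q) x) \<longlonglongrightarrow> 0"
  shows "G m (enf (Delta k n a A m Q)) = enf Q"
proof -
  let ?D = "\<lambda>p is. list_comp (\<lambda>i. (\<lambda>Y x. Y x - \<Phi> i Y x) ^^ p i) is Q"
  let ?G = "list_comp (\<lambda>i. geom (F i) ^^ m i)"
  have D: "positive_op (?D p [1..<Suc k])" if "\<And>i. i \<in> {1..k} \<Longrightarrow> p i \<le> m i" for p
    using Q that unfolding cone_ge_def Delta_def ordered_comp_eq_list_comp by blast
  have "?G [l..<Suc k] (enf (?D m [l..<Suc k])) = enf Q \<and> (\<forall>x. enf (?D m [l..<Suc k]) x \<le> enf Q x)"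
    if "l \<ge> 1" "l \<le> Suc k" for l
    using that(2,1)
  proof (induction l rule: inc_induct)
    case (step l)
    let ?X = "?D m [Suc l..<Suc k]"
    have l: "l \<in> {1..k}" and split: "[l..<Suc k] = l # [Suc l..<Suc k]"
      using step by (auto simp: upt_conv_Cons simp del: upt_Suc)
    have IH: "?G [Suc l..<Suc k] (enf ?X) = enf Q" "\<And>x. enf ?X x \<le> enf Q x"
      using step by (auto simp del: upt_Suc)
    have pos: "positive_op (((\<lambda>Y x. Y x - \<Phi> l Y x) ^^ s) ?X)" if "s \<le> m l" for s
    proof -
      \<comment> \<open>The cone condition at this p gives positivity of the intermediate operator:
        no defects below l, s of them at l, all \<open>m i\<close> of them above.\<close>
      define p where "p i = (if i < l then 0 else if i = l then s else m i)" for i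
      have "[1..<Suc k] = [1..<l] @ l # [Suc l..<Suc k]"
        unfolding split[symmetric] using l by (metis atLeastAtMost_iff le_SucI le_add_diff_inverse upt_add_eq_append)
      then have "?D p [1..<Suc k] = list_comp (\<lambda>i. (\<lambda>Y x. Y x - \<Phi> i Y x) ^^ p i) [1..<l]
          (((\<lambda>Y x. Y x - \<Phi> l Y x) ^^ p l) (?D p [Suc l..<Suc k]))"
        by (simp only: list_comp_append list_comp_simps)
      also have "?D p [Suc l..<Suc k] = ?X"
        by (rule list_comp_cong) (auto simp: p_def)
      also have "list_comp (\<lambda>i. (\<lambda>Y x. Y x - \<Phi> i Y x) ^^ p i) [1..<l] Z = list_comp (\<lambda>_. id) [1..<l] Z" for Z
        by (rule list_comp_cong) (auto simp: p_def)
      also have "list_comp (\<lambda>_. id) is Z = Z" for "is" :: "nat list" and Z :: "'h \<Rightarrow> 'h"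
        by (induction "is") auto
      finally show ?thesis using D[of p] that by (simp add: p_def del: upt_Suc)
    qed
    have g: "(geom (F l) ^^ m l) (enf (?D m [l..<Suc k])) = enf ?X \<and> (\<forall>x. enf (?D m [l..<Suc k]) x \<le> enf Q x)"
      using geom_defect_power[OF l pos IH(2) lim[OF l]] unfolding split by simp
    have "?G [l..<Suc k] (enf (?D m [l..<Suc k])) = (geom (F l) ^^ m l) (?G [Suc l..<Suc k] (enf (?D m [l..<Suc k])))"
      unfolding split by simp
    \<comment> \<open>The defects at l are outermost in \<open>?D\<close>, so the factor cancelling
      them has to be moved inside, past those of the larger indices.\<close>
    also have "\<dots> = ?G [Suc l..<Suc k] ((geom (F l) ^^ m l) (enf (?D m [l..<Suc k])))"
    proof (rule list_comp_commute)
      fix i y assume "i \<in> set [Suc l..<Suc k]"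
      then have "i \<in> {1..k}" "i \<noteq> l" by auto
      then have "geom (F l) ^^ m l \<circ> geom (F i) ^^ m i = geom (F i) ^^ m i \<circ> geom (F l) ^^ m l"
        by (intro funpow_commute funpow_commute[symmetric] geom_F_commute l) auto
      then show "(geom (F l) ^^ m l) ((geom (F i) ^^ m i) y) = (geom (F i) ^^ m i) ((geom (F l) ^^ m l) y)"
        by (metis o_apply)
    qed
    also have "\<dots> = enf Q" using g IH(1) by simp
    finally show ?case using g by blast
  qed simp
  from this[of 1] show ?thesis by (simp add: G_def Delta_def ordered_comp_eq_list_comp)
qed

lemma series_bounds_of_cone:
  assumes m: "\<forall>i\<in>{1..k}. m i \<ge> 1" and Q: "Q \<in> cone_ge k n m a A"
    and inv: "invertible_op UNIV UNIV Q"
    and lim: "\<And>i. i \<in> {1..k} \<Longrightarrow> wot_tendsto_zero (\<lambda>s. (\<Phi> i ^^ s) Q)"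
  shows "\<exists>c d R. series_bounds k n m a A c d R"
proof -
  have pos: "positive_op Q" "positive_op (Delta k n a A m Q)" using Q by (auto simp: cone_ge_def)
  have G: "G m (enf (Delta k n a A m Q)) = enf Q"
  proof (rule G_Delta_eq[OF Q])
    fix i x assume i: "i \<in> {1..k}"
    have "(\<lambda>s. qform ((\<Phi> i ^^ s) Q) x) \<longlonglongrightarrow> Re 0"
      unfolding qform_def using lim[OF i] by (intro tendsto_Re) (simp add: wot_tendsto_zero_def)
    then have "(\<lambda>s. enf ((\<Phi> i ^^ s) Q) x) \<longlonglongrightarrow> 0"
      unfolding enf_def using tendsto_ennrealI by fastforce
    then show "(\<lambda>s. (F i ^^ s) (enf Q) x) \<longlonglongrightarrow> 0" using Phi_funpow_positive[OF i pos(1)] by simp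
  qed
  obtain c where c: "0 < c" "\<And>x. c * (norm x)\<^sup>2 \<le> qform Q x"
    using positive_invertible_bounded_below[OF pos(1) inv] by blast
  obtain d where d: "0 < d" "\<And>x. qform Q x \<le> d * (norm x)\<^sup>2"
    using qform_le_norm[OF positive_op_bounded[OF pos(1)]] by blast
  \<comment> \<open>The upper constant is c + d rather than d, so that it visibly exceeds the lower
    one.\<close>
  have "c * (norm x)\<^sup>2 \<le> qform Q x \<and> qform Q x \<le> (c + d) * (norm x)\<^sup>2" for x
    using c(1) c(2)[of x] d(2)[of x] by (simp add: distrib_right add_increasing)
  then have "series_bounds k n m a A c (c + d) (Delta k n a A m Q)"
    unfolding series_bounds_iff series_eq_G[OF pos(2) m] G unfolding enf_def
    using pos(2) c(1) d(1) by (auto intro!: ennreal_leI)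
  then show ?thesis by blast
qed

end

section \<open>Factorization of positive operators\<close>

text \<open>The Taylor coefficients of sqrt (1 - t) at 0.\<close>

definition sqrt_coeff :: "nat \<Rightarrow> real" where
  "sqrt_coeff i = (1/2 gchoose i) * (-1) ^ i"

lemma sqrt_coeff_0: "sqrt_coeff 0 = 1"
  by (simp add: sqrt_coeff_def)

lemma sqrt_coeff_Suc_le_0: "sqrt_coeff (Suc i) \<le> 0"
proof -
  have "sqrt_coeff (Suc i) = pochhammer (- (1/2)) (Suc i) / fact (Suc i)"
    by (simp add: sqrt_coeff_def gbinomial_pochhammer flip: power_mult_distrib)
  also have "pochhammer (- (1/2)) (Suc i) = - (1/2) * pochhammer (1/2 :: real) i"
    by (simp add: pochhammer_rec)
  finally show ?thesis by (simp add: pochhammer_nonneg divide_nonpos_pos)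
qed

text \<open>Only the zeroth coefficient is positive, so the absolute sum is 2 minus the plain
  partial sum, which is nonnegative by its closed form.\<close>

lemma sum_abs_sqrt_coeff_le: "(\<Sum>i\<le>N. \<bar>sqrt_coeff i\<bar>) \<le> 2"
proof -
  have "(\<Sum>i\<le>N. sqrt_coeff i) = (-1) ^ N * (1/2 - 1 gchoose N)"
    unfolding sqrt_coeff_def by (rule gbinomial_sum_lower_neg)
  also have "\<dots> = pochhammer (1/2) N / fact N"
    by (simp add: gbinomial_pochhammer flip: power_mult_distrib)
  finally have "0 \<le> (\<Sum>i\<le>N. sqrt_coeff i)" by (simp add: pochhammer_nonneg)
  moreover have "(\<Sum>i\<le>N. \<bar>sqrt_coeff i\<bar>) = 2 - (\<Sum>i\<le>N. sqrt_coeff i)"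
    by (induction N) (simp_all add: sqrt_coeff_0 sqrt_coeff_Suc_le_0 abs_of_nonpos)
  ultimately show ?thesis by simp
qed

lemma summable_abs_sqrt_coeff: "summable (\<lambda>i. \<bar>sqrt_coeff i\<bar>)"
  by (rule bounded_imp_summable[OF _ sum_abs_sqrt_coeff_le]) simp

text \<open>The identity (sqrt (1 - t))^2 = 1 - t on coefficients, by the Vandermonde convolution at
  1/2 + 1/2 = 1.\<close>

lemma sqrt_coeff_convolution:
  "(\<Sum>i\<le>s. sqrt_coeff i * sqrt_coeff (s - i)) = (if s = 0 then 1 else if s = 1 then -1 else 0)"
proof -
  have "(\<Sum>i\<le>s. sqrt_coeff i * sqrt_coeff (s - i))
      = (\<Sum>i\<le>s. (1/2 gchoose i) * (1/2 gchoose (s - i))) * (-1) ^ s"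
    unfolding sum_distrib_right sqrt_coeff_def
  proof (rule sum.cong)
    fix i assume "i \<in> {..s}"
    then have "(-1) ^ i * (-1) ^ (s - i) = ((-1) ^ s :: real)" by (simp flip: power_add)
    then show "(1/2 gchoose i) * (-1) ^ i * ((1/2 gchoose (s - i)) * (-1) ^ (s - i))
        = (1/2 gchoose i) * (1/2 gchoose (s - i)) * (-1 :: real) ^ s" by (metis mult.assoc mult.left_commute)
  qed simp
  also have "\<dots> = real (1 choose s) * (-1) ^ s"
    using gbinomial_Vandermonde[of "1/2 :: real" "1/2" s] binomial_gbinomial[of 1 s, where 'a = real]
    by (simp add: atLeast0AtMost)
  finally show ?thesis by (auto simp: binomial_eq_0)
qed

text \<open>The same identity paired with a bounded sequence, later \<mu> s = <T^s x, x>. Absolute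
  summability of the coefficients permits summation along the antidiagonals s = i + j.\<close>

lemma sum_sqrt_coeff_products:
  fixes \<mu> :: "nat \<Rightarrow> real"
  assumes \<mu>: "\<And>s. \<bar>\<mu> s\<bar> \<le> B"
  shows "(\<Sum>\<^sub>\<infinity>i. \<Sum>\<^sub>\<infinity>j. sqrt_coeff i * sqrt_coeff j * \<mu> (i + j)) = \<mu> 0 - \<mu> 1"
proof -
  let ?f = "\<lambda>(i,j). sqrt_coeff i * sqrt_coeff j * \<mu> (i + j)"
  have c: "(\<lambda>i. \<bar>sqrt_coeff i\<bar>) summable_on UNIV"
    by (rule summable_nonneg_imp_summable_on[OF summable_abs_sqrt_coeff]) simp
  have "(\<lambda>(i,j). \<bar>sqrt_coeff i\<bar> * \<bar>sqrt_coeff j\<bar>) summable_on UNIV \<times> UNIV"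
  proof (rule summable_on_SigmaI)
    show "((\<lambda>j. case (i, j) of (i, j) \<Rightarrow> \<bar>sqrt_coeff i\<bar> * \<bar>sqrt_coeff j\<bar>) has_sum
        \<bar>sqrt_coeff i\<bar> * (\<Sum>\<^sub>\<infinity>j. \<bar>sqrt_coeff j\<bar>)) UNIV" for i
      using has_sum_cmult_right[OF has_sum_infsum[OF c]] by simp
    show "(\<lambda>i. \<bar>sqrt_coeff i\<bar> * (\<Sum>\<^sub>\<infinity>j. \<bar>sqrt_coeff j\<bar>)) summable_on UNIV"
      by (intro summable_on_cmult_left c)
  qed auto
  then have "(\<lambda>p. B * (case p of (i,j) \<Rightarrow> \<bar>sqrt_coeff i\<bar> * \<bar>sqrt_coeff j\<bar>)) summable_on UNIV"
    by (intro summable_on_cmult_right) simp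
  then have "(\<lambda>p. norm (?f p)) summable_on UNIV"
  proof (rule summable_on_comparison_test)
    fix p :: "nat \<times> nat"
    obtain i j where p: "p = (i, j)" by (cases p)
    show "norm (?f p) \<le> B * (case p of (i,j) \<Rightarrow> \<bar>sqrt_coeff i\<bar> * \<bar>sqrt_coeff j\<bar>)"
      using mult_left_mono[OF \<mu>[of "i + j"], of "\<bar>sqrt_coeff i\<bar> * \<bar>sqrt_coeff j\<bar>"]
      by (simp add: p abs_mult mult_ac)
  qed simp
  then have f: "?f summable_on UNIV" by (rule abs_summable_summable)
  have bij: "bij_betw (\<lambda>(s,i). (i, s - i)) (SIGMA s:UNIV. {..s}) (UNIV :: (nat \<times> nat) set)"
    by (rule bij_betw_byWitness[where f' = "\<lambda>(i,j). (i + j, i)"]) auto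
  have f': "(\<lambda>(s,i). ?f (i, s - i)) summable_on (SIGMA s:UNIV. {..s})"
    using summable_on_reindex_bij_betw[OF bij, of ?f] f by (simp add: case_prod_unfold)
  have "(\<Sum>\<^sub>\<infinity>i. \<Sum>\<^sub>\<infinity>j. sqrt_coeff i * sqrt_coeff j * \<mu> (i + j)) = infsum ?f (UNIV \<times> UNIV)"
    using infsum_Sigma_banach[of ?f UNIV "\<lambda>_. UNIV"] f by simp
  also have "\<dots> = (\<Sum>\<^sub>\<infinity>(s,i)\<in>(SIGMA s:UNIV. {..s}). ?f (i, s - i))"
    using infsum_reindex_bij_betw[OF bij, of ?f] by (simp add: case_prod_unfold)
  also have "\<dots> = (\<Sum>\<^sub>\<infinity>s. \<Sum>i\<le>s. ?f (i, s - i))"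
    using infsum_Sigma_banach[OF f'] by simp
  also have "\<dots> = (\<Sum>\<^sub>\<infinity>s. (\<Sum>i\<le>s. sqrt_coeff i * sqrt_coeff (s - i)) * \<mu> s)"
    by (simp add: sum_distrib_right)
  also have "\<dots> = (\<Sum>\<^sub>\<infinity>s\<in>{0,1}. (if s = 0 then 1 else - 1) * \<mu> s)"
    unfolding sqrt_coeff_convolution by (rule infsum_cong_neutral) auto
  finally show ?thesis by simp
qed

text \<open>\<open>D\<close> is the binomial series of sqrt (I - T). The squared norm of
  \<open>D x\<close> expands into a double series of the <T^(i + j) x, x>, to which
  \<open>sum_sqrt_coeff_products\<close> applies.\<close>

lemma positive_contraction_sqrt_complement:
  fixes T :: "'h::chilbert_space \<Rightarrow> 'h"
  assumes T: "positive_op T" and le: "\<And>x. qform T x \<le> (norm x)\<^sup>2"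
  obtains D :: "'h \<Rightarrow> 'h" where "bounded_op D" "\<And>x. (norm (D x))\<^sup>2 = (norm x)\<^sup>2 - qform T x"
proof -
  note b = positive_op_bounded[OF T]
  \<comment> \<open>Cauchy-Schwarz for the form of T turns the bound on the diagonal into a bound on
    the operator norm.\<close>
  have contr: "norm (T x) \<le> norm x" for x
  proof (cases "T x = 0")
    case False
    have "((norm (T x))\<^sup>2)\<^sup>2 = (cmod (cinner (T x) (T x)))\<^sup>2" by (simp add: cinner_self norm_power)
    also have "\<dots> \<le> qform T x * qform T (T x)" by (rule positive_op_cauchy_schwarz[OF T])
    also have "\<dots> \<le> (norm x)\<^sup>2 * (norm (T x))\<^sup>2" by (intro mult_mono le qform_nonneg[OF T]) simp
    finally have "(norm (T x))\<^sup>2 \<le> (norm x)\<^sup>2" using False by (simp add: power2_eq_square)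
    then show ?thesis by (rule power2_le_imp_le) simp
  qed simp
  have pow: "norm ((T ^^ i) x) \<le> norm x" for i x
    by (induction i) (auto intro: order_trans[OF contr])
  have b_pow: "bounded_op (T ^^ i)" for i
  proof (induction i)
    case (Suc i)
    show ?case unfolding funpow.simps by (rule bounded_op_comp[OF b Suc.IH])
  next
    case 0
    show ?case unfolding funpow.simps by (rule bounded_op_id)
  qed
  have sym: "inner ((T ^^ i) x) ((T ^^ j) x) = inner ((T ^^ (i + j)) x) x" for i j x
  proof (induction j arbitrary: i)
    case (Suc j)
    have "inner ((T ^^ i) x) (T ((T ^^ j) x)) = inner (T ((T ^^ i) x)) ((T ^^ j) x)"
      unfolding inner_eq_Re_cinner by (simp add: positive_op_symmetric[OF T])
    then show ?case using Suc.IH[of "Suc i"] by simp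
  qed simp
  define D where "D x = (\<Sum>\<^sub>\<infinity>i. sqrt_coeff i *\<^sub>R (T ^^ i) x)" for x
  have summ: "(\<lambda>i. sqrt_coeff i *\<^sub>R (T ^^ i) x) summable_on UNIV" for x
  proof (rule norm_summable_imp_summable_on, rule summable_comparison_test')
    show "summable (\<lambda>i. \<bar>sqrt_coeff i\<bar> * norm x)"
      by (intro summable_mult2 summable_abs_sqrt_coeff)
    show "norm (norm (sqrt_coeff i *\<^sub>R (T ^^ i) x)) \<le> \<bar>sqrt_coeff i\<bar> * norm x" for i
      by (simp add: mult_left_mono pow)
  qed
  have inner_D: "inner (D x) y = (\<Sum>\<^sub>\<infinity>i. sqrt_coeff i * inner ((T ^^ i) x) y)" for x y
    using infsumI[OF has_sum_bounded_linear[OF bounded_linear_inner_left[of y] has_sum_infsum[OF summ[of x]]]]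
    by (simp add: D_def o_def)
  have nD: "(norm (D x))\<^sup>2 = (norm x)\<^sup>2 - qform T x" for x
  proof -
    have "(norm (D x))\<^sup>2 = (\<Sum>\<^sub>\<infinity>i. sqrt_coeff i * inner (D x) ((T ^^ i) x))"
      unfolding power2_norm_eq_inner inner_D[of x "D x"] by (simp add: inner_commute)
    also have "\<dots> = (\<Sum>\<^sub>\<infinity>i. \<Sum>\<^sub>\<infinity>j. sqrt_coeff i * sqrt_coeff j * inner ((T ^^ (i + j)) x) x)"
      unfolding inner_D infsum_cmult_right'[symmetric] by (simp add: sym add.commute mult.assoc)
    also have "\<dots> = inner ((T ^^ 0) x) x - inner ((T ^^ 1) x) x"
    proof (rule sum_sqrt_coeff_products)
      fix s
      have "\<bar>inner ((T ^^ s) x) x\<bar> \<le> norm ((T ^^ s) x) * norm x" by (rule Cauchy_Schwarz_ineq2)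
      also have "\<dots> \<le> norm x * norm x" by (intro mult_right_mono pow) simp
      finally show "\<bar>inner ((T ^^ s) x) x\<bar> \<le> norm x * norm x" .
    qed
    finally show ?thesis by (simp add: power2_norm_eq_inner qform_def inner_eq_Re_cinner)
  qed
  have "bounded_op D"
  proof (rule bounded_op_onI)
    show "D (x + y) = D x + D y" for x y
      unfolding D_def by (simp add: bounded_op_add[OF b_pow] scaleR_add_right infsum_add summ)
    show "D (c *\<^sub>C x) = c *\<^sub>C D x" for c x
    proof -
      have "bounded_linear (\<lambda>x::'h. c *\<^sub>C x)"
        by (rule bounded_op_bounded_linear, rule bounded_op_onI[where K = "cmod c"])
          (auto simp: scaleC_add_right scaleC_scaleC mult.commute)
      from infsumI[OF has_sum_bounded_linear[OF this has_sum_infsum[OF summ[of x]]]]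
      show ?thesis
        unfolding D_def by (simp add: bounded_op_scaleC[OF b_pow] o_def scaleR_scaleC scaleC_scaleC mult.commute)
    qed
    show "norm (D x) \<le> 1 * norm x" for x
      by (rule power2_le_imp_le) (simp_all add: nD qform_nonneg[OF T])
  qed
  then show ?thesis using nD that by blast
qed

lemma positive_op_factorization:
  fixes R :: "'h::chilbert_space \<Rightarrow> 'h"
  assumes R: "positive_op R"
  obtains D :: "'h \<Rightarrow> 'h" where "bounded_op D" "\<And>x. (norm (D x))\<^sup>2 = qform R x"
proof -
  obtain K where K: "K > 0" "\<And>x. qform R x \<le> K * (norm x)\<^sup>2"
    using qform_le_norm[OF positive_op_bounded[OF R]] by blast
  \<comment> \<open>Dividing by \<open>K\<close> gives a positive contraction T with I - T = R / K;
    the factor sqrt K is restored at the end.\<close>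
  define T where "T x = x - (1 / K) *\<^sub>R R x" for x
  have qT: "qform T x = (norm x)\<^sup>2 - qform R x / K" for x
    unfolding T_def qform_def by (simp add: cinner_diff_left cinner_scaleR_left cinner_self flip: of_real_power)
  have RK: "positive_op (\<lambda>x. (1 / K) *\<^sub>R R x)" using K by (intro positive_op_scaleR R) simp
  have "positive_op (\<lambda>x. id x - (1 / K) *\<^sub>R R x)"
  proof (rule positive_op_diff[OF positive_op_id RK])
    show "qform (\<lambda>x. (1 / K) *\<^sub>R R x) x \<le> qform id x" for x
      using K by (simp add: qform_scaleR qform_def[of id] cinner_self field_simps flip: of_real_power)
  qed
  then have T: "positive_op T" by (simp add: T_def[abs_def])
  obtain D :: "'h \<Rightarrow> 'h" where D: "bounded_op D" "\<And>x. (norm (D x))\<^sup>2 = (norm x)\<^sup>2 - qform T x"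
  proof (rule positive_contraction_sqrt_complement[OF T])
    show "qform T x \<le> (norm x)\<^sup>2" for x using K(1) qform_nonneg[OF R, of x] by (simp add: qT)
  qed blast
  show ?thesis
  proof (rule that[of "\<lambda>x. sqrt K *\<^sub>R D x"])
    show "bounded_op (\<lambda>x. sqrt K *\<^sub>R D x)" by (intro bounded_op_scaleR_op D)
    show "(norm (sqrt K *\<^sub>R D x))\<^sup>2 = qform R x" for x
      using K(1) by (simp add: power_mult_distrib D(2) qT)
  qed
qed

section \<open>Vectors in \<open>\<ell>\<^sup>2\<close> and their slices\<close>

lemma bcoef_Nil: "bcoef a m [] = 1"
  by (simp add: bcoef_def)

text \<open>Prepending the factor \<open>[j]\<close> maps factorizations of \<alpha> injectively to
  factorizations of \<open>j # \<alpha>\<close> without decreasing the binomial coefficient. This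
  yields positivity of b and the bound on the weights of the shifts.\<close>

lemma bcoef_Cons_ge:
  assumes a: "\<And>\<gamma>. \<gamma> \<in> lists {1..n} \<Longrightarrow> 0 \<le> a \<gamma>" and j: "j \<in> {1..n}" and \<alpha>: "\<alpha> \<in> lists {1..n}"
  shows "a [j] * bcoef a m \<alpha> \<le> bcoef a m (j # \<alpha>)"
proof -
  let ?S = "\<lambda>\<alpha>. {\<gamma>. concat \<gamma> = \<alpha> \<and> [] \<notin> set \<gamma>}"
  let ?h = "\<lambda>\<gamma>. prod_list (map a \<gamma>) * real ((length \<gamma> + m - 1) choose (m - 1))"
  have pos: "0 \<le> prod_list (map a \<gamma>)" if "concat \<gamma> \<in> lists {1..n}" for \<gamma>
    using that a by (induction \<gamma>) (auto simp: lists_eq_set)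
  have j\<alpha>: "j # \<alpha> \<in> lists {1..n}" using j \<alpha> by simp
  have "a [j] * bcoef a m \<alpha> = (\<Sum>\<gamma>\<in>?S \<alpha>. a [j] * ?h \<gamma>)"
    unfolding bcoef_eq_sum_factorizations sum_distrib_left ..
  also have "\<dots> \<le> (\<Sum>\<gamma>\<in>?S \<alpha>. ?h ([j] # \<gamma>))"
  proof (rule sum_mono)
    fix \<gamma> assume "\<gamma> \<in> ?S \<alpha>"
    then have "0 \<le> a [j] * prod_list (map a \<gamma>)" using pos \<alpha> a[of "[j]"] j by simp
    moreover have "(length \<gamma> + m - 1) choose (m - 1) \<le> (length ([j] # \<gamma>) + m - 1) choose (m - 1)"
      by (intro binomial_right_mono) simp
    ultimately have "a [j] * prod_list (map a \<gamma>) * real ((length \<gamma> + m - 1) choose (m - 1))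
        \<le> a [j] * prod_list (map a \<gamma>) * real ((length ([j] # \<gamma>) + m - 1) choose (m - 1))"
      by (intro mult_left_mono) auto
    then show "a [j] * ?h \<gamma> \<le> ?h ([j] # \<gamma>)" by (simp only: prod_list.Cons list.map mult.assoc)
  qed
  also have "\<dots> = sum ?h ((#) [j] ` ?S \<alpha>)"
    by (subst sum.reindex) auto
  also have "\<dots> \<le> bcoef a m (j # \<alpha>)"
    unfolding bcoef_eq_sum_factorizations
    using pos j\<alpha> by (intro sum_mono2 finite_factorizations) auto
  finally show ?thesis .
qed

lemma bcoef_pos:
  assumes a: "\<And>\<gamma>. \<gamma> \<in> lists {1..n} \<Longrightarrow> 0 \<le> a \<gamma>" and aj: "\<And>j. j \<in> {1..n} \<Longrightarrow> 0 < a [j]"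
    and "\<alpha> \<in> lists {1..n}"
  shows "0 < bcoef a m \<alpha>"
  using assms(3)
proof (induction \<alpha>)
  case (Cons j \<alpha>)
  then have "0 < a [j] * bcoef a m \<alpha>" using aj by simp
  also have "\<dots> \<le> bcoef a m (j # \<alpha>)" using Cons by (intro bcoef_Cons_ge[of n] a) auto
  finally show ?case .
qed (simp add: bcoef_Nil)

text \<open>The coordinate form of the adjoint of a bounded weighted shift along an injection; it
  makes \<open>L\<close> well defined and bounded.\<close>

lemma l2_pullback:
  fixes v :: "('i, 'h::complex_inner) l2"
  assumes g: "inj_on g S" and c: "\<And>\<alpha>. \<alpha> \<in> S \<Longrightarrow> \<bar>c \<alpha>\<bar> \<le> K"
  defines "f \<equiv> \<lambda>\<alpha>. if \<alpha> \<in> S then c \<alpha> *\<^sub>R Rep_l2 v (g \<alpha>) else 0"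
  shows "(\<lambda>\<alpha>. (norm (f \<alpha>))\<^sup>2) summable_on UNIV"
    and "(\<Sum>\<^sub>\<infinity>\<alpha>. (norm (f \<alpha>))\<^sup>2) \<le> K\<^sup>2 * (norm v)\<^sup>2"
proof -
  have fin: "(\<Sum>\<alpha>\<in>X. (norm (f \<alpha>))\<^sup>2) \<le> K\<^sup>2 * (norm v)\<^sup>2" if "finite X" for X
  proof -
    have "(\<Sum>\<alpha>\<in>X. (norm (f \<alpha>))\<^sup>2) = (\<Sum>\<alpha>\<in>X \<inter> S. (\<bar>c \<alpha>\<bar>)\<^sup>2 * (norm (Rep_l2 v (g \<alpha>)))\<^sup>2)"
      using that by (intro sum.mono_neutral_cong_right) (auto simp: f_def power_mult_distrib)
    also have "\<dots> \<le> (\<Sum>\<alpha>\<in>X \<inter> S. K\<^sup>2 * (norm (Rep_l2 v (g \<alpha>)))\<^sup>2)"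
      using c by (intro sum_mono mult_right_mono power_mono) auto
    also have "\<dots> = K\<^sup>2 * (\<Sum>\<gamma>\<in>g ` (X \<inter> S). (norm (Rep_l2 v \<gamma>))\<^sup>2)"
      using g by (subst sum.reindex) (auto simp: sum_distrib_left intro: inj_on_subset)
    also have "\<dots> \<le> K\<^sup>2 * (norm v)\<^sup>2"
      using that by (intro mult_left_mono sum_norm_l2_le) auto
    finally show ?thesis .
  qed
  show "(\<lambda>\<alpha>. (norm (f \<alpha>))\<^sup>2) summable_on UNIV"
    using fin by (intro nonneg_bdd_above_summable_on bdd_aboveI[of _ "K\<^sup>2 * (norm v)\<^sup>2"]) auto
  then show "(\<Sum>\<^sub>\<infinity>\<alpha>. (norm (f \<alpha>))\<^sup>2) \<le> K\<^sup>2 * (norm v)\<^sup>2"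
    using fin by (rule infsum_le_finite_sums)
qed

section \<open>Coordinates, orthogonal series and slices\<close>

lemma cinner_ket: "cinner v (ket \<gamma>) = Rep_l2 v \<gamma>"
proof -
  have "cinner v (ket \<gamma>) = (\<Sum>\<^sub>\<infinity>i\<in>{\<gamma>}. Rep_l2 v i)"
    unfolding cinner_l2_def by (rule infsum_cong_neutral) (auto simp: Rep_ket cinner_complex_def)
  then show ?thesis by simp
qed

lemma Rep_l2_sum: "Rep_l2 (sum f S) i = (\<Sum>s\<in>S. Rep_l2 (f s) i)"
  by (induction S rule: infinite_finite_induct) (auto simp: zero_l2.rep_eq plus_l2.rep_eq)

text \<open>The partial sums of an orthogonal series converge to the vector with the prescribed
  coordinates because the squared distance is the tail of a convergent series.\<close>

lemma ket_series_summable: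
  assumes g: "inj_on g S" and c: "(\<lambda>\<alpha>. (cmod (c \<alpha>))\<^sup>2) summable_on S"
  shows "(\<lambda>\<alpha>. c \<alpha> *\<^sub>C ket (g \<alpha>)) summable_on S"
proof -
  define l0 where "l0 \<gamma> = (if \<gamma> \<in> g ` S then c (inv_into S g \<gamma>) else 0)" for \<gamma>
  have l0_g: "l0 (g \<alpha>) = c \<alpha>" if "\<alpha> \<in> S" for \<alpha> using that g by (simp add: l0_def)
  have hs: "((\<lambda>\<alpha>. (cmod (c \<alpha>))\<^sup>2) has_sum (\<Sum>\<^sub>\<infinity>\<alpha>\<in>S. (cmod (c \<alpha>))\<^sup>2)) S" using c by simp
  define T where "T = (\<Sum>\<^sub>\<infinity>\<alpha>\<in>S. (cmod (c \<alpha>))\<^sup>2)"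
  have "((\<lambda>\<gamma>. (cmod (l0 \<gamma>))\<^sup>2) has_sum T) (g ` S)"
    unfolding has_sum_reindex[OF g] T_def using hs by (simp add: o_def l0_g cong: has_sum_cong)
  then have l0_hs: "((\<lambda>\<gamma>. (cmod (l0 \<gamma>))\<^sup>2) has_sum T) UNIV"
    by (rule has_sum_cong_neutral[THEN iffD1, rotated -1]) (auto simp: l0_def)
  then have Rep: "Rep_l2 (Abs_l2 l0) = l0"
    by (intro Abs_l2_inverse) (auto simp: summable_on_def)
  define l where "l = Abs_l2 l0"
  have nl: "(norm l)\<^sup>2 = T"
    unfolding norm_l2_square l_def Rep using l0_hs by (rule infsumI)
  have dist: "(norm ((\<Sum>\<alpha>\<in>Y. c \<alpha> *\<^sub>C ket (g \<alpha>)) - l))\<^sup>2 = T - (\<Sum>\<alpha>\<in>Y. (cmod (c \<alpha>))\<^sup>2)"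
    if Y: "finite Y" "Y \<subseteq> S" for Y
  proof -
    let ?s = "\<Sum>\<alpha>\<in>Y. c \<alpha> *\<^sub>C ket (g \<alpha>)"
    have ip: "cinner v ?s = (\<Sum>\<alpha>\<in>Y. complex_of_real ((cmod (c \<alpha>))\<^sup>2))"
      if "\<And>\<alpha>. \<alpha> \<in> Y \<Longrightarrow> Rep_l2 v (g \<alpha>) = c \<alpha>" for v
      unfolding cinner_sum_right cinner_scaleC_right cinner_ket complex_norm_square
      using that by (intro sum.cong) (auto simp: mult.commute)
    have "Rep_l2 ?s (g \<alpha>) = c \<alpha>" if "\<alpha> \<in> Y" for \<alpha>
    proof -
      have "Rep_l2 ?s (g \<alpha>) = (\<Sum>\<beta>\<in>Y. if \<beta> = \<alpha> then c \<beta> else 0)"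
        unfolding Rep_l2_sum scaleC_l2.rep_eq Rep_ket scaleC_complex_def
        using that Y g by (intro sum.cong) (auto dest: inj_onD)
      then show ?thesis using that Y by simp
    qed
    then have "inner ?s ?s = (\<Sum>\<alpha>\<in>Y. (cmod (c \<alpha>))\<^sup>2)"
      unfolding inner_eq_Re_cinner by (subst ip) auto
    moreover have "inner l ?s = (\<Sum>\<alpha>\<in>Y. (cmod (c \<alpha>))\<^sup>2)"
      unfolding inner_eq_Re_cinner using Y by (subst ip) (auto simp: l_def Rep l0_g)
    ultimately show ?thesis
      using nl by (simp add: power2_norm_eq_inner inner_diff_left inner_diff_right inner_commute[of ?s l])
  qed
  have "(sum (\<lambda>\<alpha>. c \<alpha> *\<^sub>C ket (g \<alpha>)) \<longlongrightarrow> l) (finite_subsets_at_top S)"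
  proof (rule LIM_zero_cancel, rule tendsto_norm_zero_cancel)
    have "((\<lambda>Y. sqrt (T - (\<Sum>\<alpha>\<in>Y. (cmod (c \<alpha>))\<^sup>2))) \<longlongrightarrow> sqrt (T - T)) (finite_subsets_at_top S)"
      using hs unfolding has_sum_def T_def by (intro tendsto_intros)
    then have "((\<lambda>Y. sqrt (T - (\<Sum>\<alpha>\<in>Y. (cmod (c \<alpha>))\<^sup>2))) \<longlongrightarrow> 0) (finite_subsets_at_top S)"
      by simp
    moreover have "\<forall>\<^sub>F Y in finite_subsets_at_top S. sqrt (T - (\<Sum>\<alpha>\<in>Y. (cmod (c \<alpha>))\<^sup>2))
        = norm ((\<Sum>\<alpha>\<in>Y. c \<alpha> *\<^sub>C ket (g \<alpha>)) - l)"
      by (rule eventually_finite_subsets_at_top_weakI) (simp flip: dist)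
    ultimately show "((\<lambda>Y. norm ((\<Sum>\<alpha>\<in>Y. c \<alpha> *\<^sub>C ket (g \<alpha>)) - l)) \<longlongrightarrow> 0) (finite_subsets_at_top S)"
      by (rule Lim_transform_eventually)
  qed
  then show ?thesis unfolding summable_on_def has_sum_def by blast
qed

text \<open>The partial inner product against h, adjoint to x \<mapsto> x \<otimes> h by
  \<open>cinner_tensor_right\<close>. It reduces membership in a tensor space to scalar
  families.\<close>

lift_definition slice :: "'h::complex_inner \<Rightarrow> ('i, 'h) l2 \<Rightarrow> ('i, complex) l2"
  is "\<lambda>h v i. cinner (v i) h"
proof -
  fix h :: 'h and v :: "'i \<Rightarrow> 'h" assume "(\<lambda>i. (norm (v i))\<^sup>2) summable_on UNIV"
  then have "(\<lambda>i. (norm (v i))\<^sup>2 * (norm h)\<^sup>2) summable_on UNIV" by (rule summable_on_cmult_left)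
  then show "(\<lambda>i. (cmod (cinner (v i) h))\<^sup>2) summable_on UNIV"
    by (rule summable_on_comparison_test)
      (auto simp flip: power_mult_distrib intro!: power_mono cmod_cinner_le)
qed

lemma cinner_tensor_right: "cinner v (x \<otimes>\<^sub>H h) = cinner (slice h v) x"
  unfolding cinner_l2_def tensor.rep_eq slice.rep_eq
  by (simp add: cinner_scaleC_right cinner_complex_def mult.commute)

lemma slice_tensor: "slice h (x \<otimes>\<^sub>H g) = cinner g h *\<^sub>C x"
  by (rule l2_eqI) (simp add: slice.rep_eq tensor.rep_eq scaleC_l2.rep_eq cinner_scaleC_left
      scaleC_complex_def mult.commute)

lemma slice_add: "slice h (v + w) = slice h v + slice h w"
  and slice_diff: "slice h (v - w) = slice h v - slice h w"
  and slice_scaleC: "slice h (c *\<^sub>C v) = c *\<^sub>C slice h v"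
  and slice_0: "slice h 0 = 0"
  by (auto intro!: l2_eqI simp: slice.rep_eq plus_l2.rep_eq minus_l2.rep_eq scaleC_l2.rep_eq
      zero_l2.rep_eq cinner_add_left cinner_diff_left cinner_scaleC_left scaleC_complex_def)

lemma norm_slice_le: "norm (slice h v) \<le> norm h * norm v"
proof -
  have "(norm (slice h v))\<^sup>2 \<le> (\<Sum>\<^sub>\<infinity>i. (norm h)\<^sup>2 * (norm (Rep_l2 v i))\<^sup>2)"
    unfolding norm_l2_square
  proof (rule infsum_mono)
    show "(\<lambda>i. (norm h)\<^sup>2 * (norm (Rep_l2 v i))\<^sup>2) summable_on UNIV"
      by (intro summable_on_cmult_right l2_summable)
    show "(norm (Rep_l2 (slice h v) i))\<^sup>2 \<le> (norm h)\<^sup>2 * (norm (Rep_l2 v i))\<^sup>2" for i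
      using cmod_cinner_le[of "Rep_l2 v i" h]
      by (simp add: slice.rep_eq mult.commute power_mono flip: power_mult_distrib)
  qed (rule l2_summable)
  also have "\<dots> = (norm h * norm v)\<^sup>2"
    by (simp add: infsum_cmult_right' power_mult_distrib flip: norm_l2_square)
  finally show ?thesis by (rule power2_le_imp_le) simp
qed

lemma bounded_op_slice: "bounded_op (slice h)"
  by (rule bounded_op_onI[where K = "norm h"]) (auto simp: slice_add slice_scaleC norm_slice_le)

section \<open>Closed spans and tensor products with a Hilbert space\<close>

lemma csubspace_closure:
  fixes S :: "'a::complex_inner set"
  assumes "csubspace S"
  shows "csubspace (closure S)"
proof (rule complex_vector.subspaceI)
  show "0 \<in> closure S" using csubspace_0[OF assms] closure_subset by blast
  fix x assume "x \<in> closure S"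
  then obtain f where f: "\<And>i. f i \<in> S" "f \<longlonglongrightarrow> x" unfolding closure_sequential by blast
  have sc: "bounded_linear (\<lambda>x::'a. c *\<^sub>C x)" for c
    by (rule bounded_op_bounded_linear, rule bounded_op_onI[where K = "cmod c"])
      (auto simp: scaleC_add_right scaleC_scaleC mult.commute)
  show "c *\<^sub>C x \<in> closure S" for c
    unfolding closure_sequential
    by (intro exI[of _ "\<lambda>i. c *\<^sub>C f i"] conjI allI csubspace_scaleC[OF assms f(1)]
        bounded_linear.tendsto[OF sc f(2)])
  fix y assume "y \<in> closure S"
  then obtain g where g: "\<And>i. g i \<in> S" "g \<longlonglongrightarrow> y" unfolding closure_sequential by blast
  show "x + y \<in> closure S"
    unfolding closure_sequential
    by (intro exI[of _ "\<lambda>i. f i + g i"] conjI allI csubspace_add[OF assms f(1) g(1)]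
        tendsto_add[OF f(2) g(2)])
qed

lemma csubspace_cspan: "csubspace (cspan S)"
  for S :: "'a::complex_inner set"
  by (fact complex_vector.subspace_span)

lemma closure_cspan_minimal:
  fixes E :: "'a::complex_inner set"
  assumes "E \<subseteq> V" "csubspace V" "closed V"
  shows "closure (cspan E) \<subseteq> V"
  using assms by (intro closure_minimal complex_vector.span_minimal)

lemma generators_in_closure_cspan: "E \<subseteq> closure (cspan E)"
  for E :: "'a::complex_inner set"
  using closure_subset complex_vector.span_superset by blast

lemma orthogonal_complement_closed_csubspace:
  fixes E :: "'a::complex_inner set"
  shows "csubspace {x. \<forall>e\<in>E. cinner x e = 0}" "closed {x. \<forall>e\<in>E. cinner x e = 0}"
    "csubspace {x. \<forall>e\<in>E. cinner e x = 0}" "closed {x. \<forall>e\<in>E. cinner e x = 0}"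
proof -
  show "csubspace {x. \<forall>e\<in>E. cinner x e = 0}" "csubspace {x. \<forall>e\<in>E. cinner e x = 0}"
    by (auto intro!: complex_vector.subspaceI
        simp: cinner_add_left cinner_add_right cinner_scaleC_left cinner_scaleC_right)
  have l: "bounded_linear (\<lambda>x. cinner x e)" "bounded_linear (\<lambda>x. cinner e x)" for e :: 'a
    by (rule bounded_bilinear.bounded_linear_left[OF bounded_bilinear_cinner],
        rule bounded_bilinear.bounded_linear_right[OF bounded_bilinear_cinner])
  have "{x. \<forall>e\<in>E. cinner x e = 0} = (\<Inter>e\<in>E. {x. cinner x e = 0})"
    "{x. \<forall>e\<in>E. cinner e x = 0} = (\<Inter>e\<in>E. {x. cinner e x = 0})" by auto
  then show "closed {x. \<forall>e\<in>E. cinner x e = 0}" "closed {x. \<forall>e\<in>E. cinner e x = 0}"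
    by (auto intro!: closed_INT closed_Collect_eq linear_continuous_on[OF l(1)] linear_continuous_on[OF l(2)])
qed

text \<open>For the converse, let p be the projection of v onto the tensor space. The slices of v -
  p lie in V, so v - p is orthogonal to \<open>slice h (v - p) \<otimes>\<^sub>H h\<close>, which
  says that the slice has norm 0.\<close>

lemma tensor_space_iff_slices:
  fixes v :: "('i, 'h::chilbert_space) l2"
  assumes V: "csubspace V" "closed V"
  shows "v \<in> tensor_space V \<longleftrightarrow> (\<forall>h. slice h v \<in> V)"
proof
  let ?E = "{x \<otimes>\<^sub>H h :: ('i, 'h) l2 | x h. x \<in> V}"
  have sub: "slice h u \<in> V" if "u \<in> tensor_space V" for h and u :: "('i, 'h) l2"
  proof -
    have "closure (cspan ?E) \<subseteq> slice h -` V"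
    proof (rule closure_cspan_minimal)
      show "?E \<subseteq> slice h -` V" using csubspace_scaleC[OF V(1)] by (auto simp: slice_tensor)
      show "csubspace (slice h -` V)"
        using V(1) by (auto intro!: complex_vector.subspaceI
            simp: slice_add slice_scaleC slice_0 csubspace_add csubspace_scaleC csubspace_0)
      show "closed (slice h -` V)"
        by (intro closed_vimage V(2) linear_continuous_on bounded_op_bounded_linear bounded_op_slice)
    qed
    then show ?thesis using that by (auto simp: tensor_space_def)
  qed
  then show "v \<in> tensor_space V \<Longrightarrow> \<forall>h. slice h v \<in> V" by blast
  assume v: "\<forall>h. slice h v \<in> V"
  have T: "csubspace (tensor_space V :: ('i, 'h) l2 set)" "closed (tensor_space V :: ('i, 'h) l2 set)"
    by (auto simp: tensor_space_def csubspace_closure csubspace_cspan)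
  define p where "p = orth_proj (tensor_space V) v"
  have p: "p \<in> tensor_space V" and orth: "\<And>y. y \<in> tensor_space V \<Longrightarrow> cinner (v - p) y = 0"
    unfolding p_def by (rule orth_proj[OF T])+
  have "slice h (v - p) = 0" for h
  proof -
    have mem: "slice h (v - p) \<in> V"
      using v sub[OF p] csubspace_diff[OF V(1)] by (simp add: slice_diff)
    have "slice h (v - p) \<otimes>\<^sub>H h \<in> tensor_space V"
      unfolding tensor_space_def by (rule subsetD[OF generators_in_closure_cspan]) (use mem in blast)
    then have "cinner (slice h (v - p)) (slice h (v - p)) = 0"
      using orth by (simp flip: cinner_tensor_right)
    then show ?thesis by (rule cinner_eq_zeroD)
  qed
  then have z: "cinner (Rep_l2 (v - p) i) h = 0" for h i
    by (metis slice.rep_eq zero_l2.rep_eq)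
  have "v - p = 0"
    by (rule l2_eqI) (simp add: zero_l2.rep_eq cinner_eq_zeroD[OF z])
  then show "v \<in> tensor_space V" using p by simp
qed

text \<open>\<open>F\<close> shows that the choice in \<open>tensor_id\<close> has a candidate; any
  two bounded candidates agree on elementary tensors, hence by density on the whole tensor
  space.\<close>

lemma tensor_id_eqI:
  fixes F :: "('i, 'h::complex_inner) l2 \<Rightarrow> ('i, 'h) l2"
  assumes F: "bounded_op F" "\<And>x h. x \<in> V \<Longrightarrow> F (x \<otimes>\<^sub>H h) = T x \<otimes>\<^sub>H h"
    and v: "v \<in> tensor_space V"
  shows "tensor_id V T v = F v"
proof -
  let ?E = "{x \<otimes>\<^sub>H h :: ('i, 'h) l2 | x h. x \<in> V}"
  define G :: "('i, 'h) l2 \<Rightarrow> ('i, 'h) l2" where "G = tensor_id V T"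
  have "bounded_op_on (tensor_space V) F \<and> (\<forall>x\<in>V. \<forall>h. F (x \<otimes>\<^sub>H h) = T x \<otimes>\<^sub>H h)"
    using F by (auto simp: bounded_op_on_def)
  from someI[of "\<lambda>F. bounded_op_on (tensor_space V) F \<and> (\<forall>x\<in>V. \<forall>h. F (x \<otimes>\<^sub>H h) = T x \<otimes>\<^sub>H h)", OF this]
  have G: "bounded_op_on (tensor_space V) G" "\<And>x h. x \<in> V \<Longrightarrow> G (x \<otimes>\<^sub>H h) = T x \<otimes>\<^sub>H h"
    by (auto simp: G_def tensor_id_def)
  have T: "csubspace (tensor_space V :: ('i, 'h) l2 set)"
    by (auto simp: tensor_space_def csubspace_closure csubspace_cspan)
  have G_add: "G (x + y) = G x + G y" and G_sc: "G (c *\<^sub>C x) = c *\<^sub>C G x"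
    if "x \<in> tensor_space V" "y \<in> tensor_space V" for x y c
    using G(1) that by (auto simp: bounded_op_on_def)
  obtain K where K: "K > 0" "\<And>x. x \<in> tensor_space V \<Longrightarrow> norm (G x) \<le> K * norm x"
    using bounded_op_on_bound[OF G(1)] by blast
  obtain L where L: "L > 0" "\<And>x. norm (F x) \<le> L * norm x"
    using bounded_op_on_bound[OF F(1)] by (metis UNIV_I)
  let ?U = "{u \<in> tensor_space V. G u = F u}"
  have span: "cspan ?E \<subseteq> ?U"
  proof (rule complex_vector.span_minimal)
    show "?E \<subseteq> ?U"
    proof
      fix u assume u: "u \<in> ?E"
      then have "u \<in> tensor_space V"
        unfolding tensor_space_def by (rule subsetD[OF generators_in_closure_cspan])
      then show "u \<in> ?U" using u F(2) G(2) by auto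
    qed
    have "G 0 = F 0" using G_sc[of 0 0 0] bounded_op_0[OF F(1)] csubspace_0[OF T] by simp
    then show "csubspace ?U"
      using T by (auto intro!: complex_vector.subspaceI
          simp: G_add G_sc bounded_op_add[OF F(1)] bounded_op_scaleC[OF F(1)] csubspace_add csubspace_scaleC csubspace_0)
  qed
  have "norm (G v - F v) \<le> 0 + e" if "e > 0" for e
  proof -
    have "v \<in> closure (cspan ?E)" using v by (simp add: tensor_space_def)
    moreover have "e / (K + L) > 0" using K L that by simp
    ultimately obtain u where u: "u \<in> cspan ?E" "dist u v < e / (K + L)"
      unfolding closure_approachable by blast
    have uV: "u \<in> tensor_space V" "G u = F u" using span u by auto
    then have "v - u \<in> tensor_space V" using v csubspace_diff[OF T] by blast
    have "G v - F v = G (v - u) - F (v - u)"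
      using G_add[OF \<open>v - u \<in> tensor_space V\<close> uV(1)] uV(2) by (simp add: bounded_op_diff[OF F(1)])
    also have "norm \<dots> \<le> norm (G (v - u)) + norm (F (v - u))" by (rule norm_triangle_ineq4)
    also have "\<dots> \<le> K * norm (v - u) + L * norm (v - u)"
      by (intro add_mono K L) fact
    also have "\<dots> = (K + L) * dist u v" by (simp add: dist_norm norm_minus_commute distrib_right)
    also have "\<dots> \<le> e" using u(2) K(1) L(1) by (simp add: field_simps)
    finally show ?thesis by simp
  qed
  then have "norm (G v - F v) \<le> 0" by (rule field_le_epsilon)
  then show ?thesis by (simp add: G_def)
qed

section \<open>The universal model\<close>

lemma mwordsD: "\<alpha> \<in> mwords k n \<Longrightarrow> i \<in> {1..k} \<Longrightarrow> \<alpha> i \<in> lists {1..n i}"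
  unfolding mwords_def by (rule PiE_mem)

lemma mwords_upd:
  assumes "\<alpha> \<in> mwords k n" "i \<in> {1..k}" "w \<in> lists {1..n i}"
  shows "\<alpha>(i := w) \<in> mwords k n"
  using assms by (auto simp: mwords_def PiE_iff extensional_def)

lemma mwords_Cons:
  assumes "\<alpha> \<in> mwords k n" "i \<in> {1..k}" "j \<in> {1..n i}"
  shows "\<alpha>(i := j # \<alpha> i) \<in> mwords k n"
  using mwordsD[OF assms(1,2)] assms(3) by (intro mwords_upd[OF assms(1,2)]) simp

lemma vacuum_word_in_mwords: "(\<lambda>i\<in>{1..k}. []) \<in> mwords k n"
  by (auto simp: mwords_def)

lemma cinner_fold:
  assumes "\<And>j x y. j \<in> set w \<Longrightarrow> cinner (C j x) y = cinner x (X j y)"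
  shows "cinner (fold C w x) y = cinner x (word_op X w y)"
  using assms
proof (induction w arbitrary: x)
  case (Cons j w)
  have "cinner (fold C w (C j x)) y = cinner (C j x) (word_op X w y)"
    using Cons.prems by (intro Cons.IH) auto
  then show ?case using Cons.prems by (simp add: word_op_def)
qed (simp add: word_op_def)

lemma cinner_mfold:
  assumes "\<And>i j x y. i \<in> {1..k} \<Longrightarrow> j \<in> set (\<gamma> i) \<Longrightarrow> cinner (C i j x) y = cinner x (X i j y)"
  shows "cinner (mfold k C \<gamma> x) y = cinner x (mword_op k X \<gamma> y)"
  using assms
proof (induction k arbitrary: y)
  case 0
  show ?case by (simp add: mfold_0 mword_op_def ordered_comp_0)
next
  case (Suc k)
  have "cinner (mfold (Suc k) C \<gamma> x) y = cinner (mfold k C \<gamma> x) (word_op (X (Suc k)) (\<gamma> (Suc k)) y)"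
    unfolding mfold_Suc using Suc.prems by (intro cinner_fold) auto
  also have "\<dots> = cinner x (mword_op k X \<gamma> (word_op (X (Suc k)) (\<gamma> (Suc k)) y))"
    using Suc.prems by (intro Suc.IH) auto
  finally show ?case by (simp add: mword_op_def ordered_comp_Suc)
qed

lemma mfold_commute:
  assumes "\<And>l t y. l \<in> {1..k} \<Longrightarrow> t \<in> set (\<alpha> l) \<Longrightarrow> C l t (f y) = f (C l t y)"
  shows "mfold k C \<alpha> (f x) = f (mfold k C \<alpha> x)"
  using assms
proof (induction k)
  case 0
  show ?case by (simp add: mfold_0)
next
  case (Suc k)
  have "fold (C (Suc k)) w (f y) = f (fold (C (Suc k)) w y)" if "set w \<subseteq> set (\<alpha> (Suc k))" for w y
    using that Suc.prems[of "Suc k"] by (induction w arbitrary: y) auto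
  then show ?case using Suc by (simp add: mfold_Suc)
qed

lemma mfold_intertwine:
  assumes "\<And>i j x. i \<in> {1..k} \<Longrightarrow> j \<in> {1..n i} \<Longrightarrow> f (C i j x) = D i j (f x)" and \<alpha>: "\<alpha> \<in> mwords k n"
  shows "f (mfold k C \<alpha> x) = mfold k D \<alpha> (f x)"
proof -
  have fold: "f (fold (C i) w x) = fold (D i) w (f x)" if "i \<in> {1..k}" "w \<in> lists {1..n i}" for i w x
    using that(2) by (induction w arbitrary: x) (auto simp: assms(1)[OF that(1)] simp del: One_nat_def)
  have "f (mfold l C \<alpha> x) = mfold l D \<alpha> (f x)" if "l \<le> k" for l
    using that
  proof (induction l)
    case (Suc l)
    then show ?case using mwordsD[OF \<alpha>] by (simp add: mfold_Suc fold)
  qed (simp add: mfold_0)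
  then show ?thesis by simp
qed

text \<open>The blocks act in the order 1, ..., k. A letter prepended to block i comes first within
  it, and commuting it past the earlier blocks makes it act first of all.\<close>

lemma mfold_step:
  assumes "i \<in> {1..k}"
    and "\<And>l t y. l \<in> {1..k} \<Longrightarrow> l \<noteq> i \<Longrightarrow> t \<in> set (\<alpha> l) \<Longrightarrow> C l t (C i j y) = C i j (C l t y)"
  shows "mfold k C (\<alpha>(i := j # \<alpha> i)) x = mfold k C \<alpha> (C i j x)"
  using assms
proof (induction k)
  case (Suc k)
  show ?case
  proof (cases "i = Suc k")
    case True
    have "mfold k C (\<alpha>(i := j # \<alpha> i)) x = mfold k C \<alpha> x"
      using True by (intro mfold_cong) auto
    moreover have "mfold k C \<alpha> (C i j x) = C i j (mfold k C \<alpha> x)"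
      using Suc.prems True by (intro mfold_commute) auto
    ultimately show ?thesis using True by (simp add: mfold_Suc fun_upd_same del: fun_upd_apply)
  next
    case False
    then have "mfold k C (\<alpha>(i := j # \<alpha> i)) x = mfold k C \<alpha> (C i j x)"
      using Suc.prems by (intro Suc.IH) auto
    then show ?thesis
      using False[symmetric] by (simp add: mfold_Suc fun_upd_other del: fun_upd_apply)
  qed
qed simp

section \<open>Adjoint shifts in coordinates and the space N_Q\<close>

locale model_data =
  fixes k :: nat and n m :: "nat \<Rightarrow> nat" and a :: "nat \<Rightarrow> nat list \<Rightarrow> real"
  assumes regular: "\<And>i. i \<in> {1..k} \<Longrightarrow> positive_regular (n i) (a i)"
begin

abbreviation bc :: "nat \<Rightarrow> nat list \<Rightarrow> real" where "bc i \<equiv> bcoef (a i) (m i)"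

abbreviation MW :: "mword set" where "MW \<equiv> mwords k n"

abbreviation W :: "nat \<Rightarrow> nat \<Rightarrow> (mword, complex) l2 \<Rightarrow> (mword, complex) l2" where
  "W \<equiv> model_W k n m a"

definition bm :: "mword \<Rightarrow> real" where "bm \<alpha> = (\<Prod>i=1..k. bc i (\<alpha> i))"

definition wt :: "nat \<Rightarrow> nat \<Rightarrow> mword \<Rightarrow> real" where
  "wt i j \<alpha> = sqrt (bc i (\<alpha> i) / bc i (j # \<alpha> i))"

text \<open>\<open>L i j\<close> is \<open>W\<^sub>i\<^sub>,\<^sub>j\<^sup>* \<otimes> I\<close>, in coordinates.\<close>

definition L :: "nat \<Rightarrow> nat \<Rightarrow> (mword, 'g::complex_inner) l2 \<Rightarrow> (mword, 'g) l2" where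
  "L i j v = Abs_l2 (\<lambda>\<alpha>. if \<alpha> \<in> MW then wt i j \<alpha> *\<^sub>R Rep_l2 v (\<alpha>(i := j # \<alpha> i)) else 0)"

lemma a_nonneg': "i \<in> {1..k} \<Longrightarrow> \<gamma> \<in> lists {1..n i} \<Longrightarrow> 0 \<le> a i \<gamma>"
  and a_single_pos: "i \<in> {1..k} \<Longrightarrow> j \<in> {1..n i} \<Longrightarrow> 0 < a i [j]"
  using regular by (auto simp: positive_regular_def)

lemma bc_pos: "i \<in> {1..k} \<Longrightarrow> \<alpha> \<in> lists {1..n i} \<Longrightarrow> 0 < bc i \<alpha>"
  by (rule bcoef_pos[of "n i"]) (auto intro: a_nonneg' a_single_pos)

lemma bm_pos: "\<alpha> \<in> MW \<Longrightarrow> 0 < bm \<alpha>"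
  unfolding bm_def by (intro prod_pos ballI bc_pos mwordsD)

lemma wt_bound:
  assumes "i \<in> {1..k}" "j \<in> {1..n i}" "\<alpha> \<in> MW"
  shows "\<bar>wt i j \<alpha>\<bar> \<le> sqrt (1 / a i [j])"
proof -
  have \<alpha>: "\<alpha> i \<in> lists {1..n i}" "j # \<alpha> i \<in> lists {1..n i}" using mwordsD[OF assms(3,1)] assms(2) by auto
  note p = bc_pos[OF assms(1) \<alpha>(1)] bc_pos[OF assms(1) \<alpha>(2)] a_single_pos[OF assms(1,2)]
  have "a i [j] * bc i (\<alpha> i) \<le> bc i (j # \<alpha> i)"
    by (rule bcoef_Cons_ge[of "n i"]) (use assms \<alpha> in \<open>auto intro: a_nonneg'\<close>)
  then have "bc i (\<alpha> i) / bc i (j # \<alpha> i) \<le> 1 / a i [j]" using p by (simp add: field_simps)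
  then show ?thesis using p by (simp add: wt_def)
qed

lemma step_inj: "inj_on (\<lambda>\<alpha>. \<alpha>(i := j # \<alpha> i)) S" for i :: nat and j :: nat
proof (rule inj_onI, rule ext)
  fix \<alpha> \<beta> :: mword and l assume eq: "\<alpha>(i := j # \<alpha> i) = \<beta>(i := j # \<beta> i)"
  show "\<alpha> l = \<beta> l" using fun_cong[OF eq, of l] by (cases "l = i") auto
qed

lemma L_facts:
  fixes v :: "(mword, 'g::complex_inner) l2"
  assumes "i \<in> {1..k}" "j \<in> {1..n i}"
  shows Rep_L: "Rep_l2 (L i j v) = (\<lambda>\<alpha>. if \<alpha> \<in> MW then wt i j \<alpha> *\<^sub>R Rep_l2 v (\<alpha>(i := j # \<alpha> i)) else 0)"
    and norm_L: "(norm (L i j v))\<^sup>2 \<le> (sqrt (1 / a i [j]))\<^sup>2 * (norm v)\<^sup>2"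
proof -
  note p = l2_pullback[OF step_inj wt_bound[OF assms], where v = v]
  show R: "Rep_l2 (L i j v) = (\<lambda>\<alpha>. if \<alpha> \<in> MW then wt i j \<alpha> *\<^sub>R Rep_l2 v (\<alpha>(i := j # \<alpha> i)) else 0)"
    unfolding L_def using p(1) by (simp add: Abs_l2_inverse)
  show "(norm (L i j v))\<^sup>2 \<le> (sqrt (1 / a i [j]))\<^sup>2 * (norm v)\<^sup>2"
    unfolding norm_l2_square[of "L i j v"] R using p(2) by simp
qed

lemma bounded_op_L:
  assumes "i \<in> {1..k}" "j \<in> {1..n i}"
  shows "bounded_op (L i j :: (mword, 'g::complex_inner) l2 \<Rightarrow> (mword, 'g) l2)"
proof (rule bounded_op_onI[where K = "sqrt (1 / a i [j])"])
  fix v w :: "(mword, 'g) l2" and c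
  show "L i j (v + w) = L i j v + L i j w"
    by (rule l2_eqI) (simp add: Rep_L[OF assms] plus_l2.rep_eq scaleR_add_right)
  show "L i j (c *\<^sub>C v) = c *\<^sub>C L i j v"
    by (rule l2_eqI) (simp add: Rep_L[OF assms] scaleC_l2.rep_eq scaleR_scaleC scaleC_scaleC mult.commute)
  show "norm (L i j v) \<le> sqrt (1 / a i [j]) * norm v"
    by (rule power2_le_imp_le)
      (use norm_L[OF assms, of v] a_single_pos[OF assms] in \<open>auto simp: power_mult_distrib\<close>)
qed

lemma wt_upd: "l \<noteq> i \<Longrightarrow> wt i j (\<alpha>(l := w)) = wt i j \<alpha>"
  by (simp add: wt_def)

lemma L_commute:
  assumes i: "i \<in> {1..k}" "j \<in> {1..n i}" and l: "l \<in> {1..k}" "t \<in> {1..n l}" and ne: "l \<noteq> i"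
  shows "L l t (L i j v) = L i j (L l t v)"
proof (rule l2_eqI)
  fix \<alpha>
  have "\<alpha>(l := t # \<alpha> l) \<in> MW" "\<alpha>(i := j # \<alpha> i) \<in> MW" if "\<alpha> \<in> MW"
    using that i l by (auto intro!: mwords_Cons simp del: One_nat_def)
  moreover have "\<alpha>(l := t # \<alpha> l, i := j # \<alpha> i) = \<alpha>(i := j # \<alpha> i, l := t # \<alpha> l)"
    using ne by (rule fun_upd_twist)
  ultimately show "Rep_l2 (L l t (L i j v)) \<alpha> = Rep_l2 (L i j (L l t v)) \<alpha>"
    using ne by (simp add: Rep_L[OF i] Rep_L[OF l] wt_upd)
qed

text \<open>The weights telescope along the word, leaving the ratio of the coefficients at its two
  ends.\<close>

lemma Rep_fold_L:
  assumes i: "i \<in> {1..k}" and w: "w \<in> lists {1..n i}" and \<alpha>: "\<alpha> \<in> MW"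
  shows "Rep_l2 (fold (L i) w v) \<alpha>
    = sqrt (bc i (\<alpha> i) / bc i (w @ \<alpha> i)) *\<^sub>R Rep_l2 v (\<alpha>(i := w @ \<alpha> i))"
  using w
proof (induction w arbitrary: v)
  case Nil
  then show ?case using bc_pos[OF i mwordsD[OF \<alpha> i]] by simp
next
  case (Cons j w)
  then have j: "j \<in> {1..n i}" and w: "w \<in> lists {1..n i}" by auto
  have w\<alpha>: "w @ \<alpha> i \<in> lists {1..n i}" using w mwordsD[OF \<alpha> i] by auto
  have "Rep_l2 (fold (L i) (j # w) v) \<alpha>
      = sqrt (bc i (\<alpha> i) / bc i (w @ \<alpha> i)) *\<^sub>R Rep_l2 (L i j v) (\<alpha>(i := w @ \<alpha> i))"
    by (simp add: Cons.IH del: fun_upd_apply)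
  also have "\<dots> = (sqrt (bc i (\<alpha> i) / bc i (w @ \<alpha> i)) * sqrt (bc i (w @ \<alpha> i) / bc i (j # w @ \<alpha> i)))
      *\<^sub>R Rep_l2 v (\<alpha>(i := j # w @ \<alpha> i))"
    using mwords_upd[OF \<alpha> i w\<alpha>] by (simp add: Rep_L[OF i j] wt_def)
  also have "sqrt (bc i (\<alpha> i) / bc i (w @ \<alpha> i)) * sqrt (bc i (w @ \<alpha> i) / bc i (j # w @ \<alpha> i))
      = sqrt (bc i (\<alpha> i) / bc i (j # w @ \<alpha> i))"
    using bc_pos[OF i w\<alpha>] by (simp flip: real_sqrt_mult)
  finally show ?case by simp
qed

text \<open>Stated for the first l blocks for the induction. The last block acts last, so it is the
  first to change the word at which the coordinate is read.\<close>

lemma Rep_mfold_L: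
  assumes \<gamma>: "\<gamma> \<in> MW" and "\<alpha> \<in> MW" and "l \<le> k"
  shows "Rep_l2 (mfold l L \<gamma> v) \<alpha>
    = sqrt (\<Prod>i=1..l. bc i (\<alpha> i) / bc i (\<gamma> i @ \<alpha> i)) *\<^sub>R
      Rep_l2 v (\<lambda>i. if i \<in> {1..l} then \<gamma> i @ \<alpha> i else \<alpha> i)"
  using assms(2,3)
proof (induction l arbitrary: \<alpha>)
  case 0
  show ?case by (simp add: mfold_0)
next
  case (Suc l)
  let ?i = "Suc l"
  have i: "?i \<in> {1..k}" using Suc.prems by simp
  have \<gamma>i: "\<gamma> ?i \<in> lists {1..n ?i}" by (rule mwordsD[OF \<gamma> i])
  let ?\<alpha> = "\<alpha>(?i := \<gamma> ?i @ \<alpha> ?i)"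
  have \<alpha>': "?\<alpha> \<in> MW"
    using \<gamma>i mwordsD[OF Suc.prems(1) i] by (intro mwords_upd Suc.prems i) auto
  have p: "(\<Prod>i=1..l. bc i (?\<alpha> i) / bc i (\<gamma> i @ ?\<alpha> i)) = (\<Prod>i=1..l. bc i (\<alpha> i) / bc i (\<gamma> i @ \<alpha> i))"
    by (rule prod.cong) auto
  have w: "(\<lambda>i. if i \<in> {1..l} then \<gamma> i @ ?\<alpha> i else ?\<alpha> i)
      = (\<lambda>i. if i \<in> {1..Suc l} then \<gamma> i @ \<alpha> i else \<alpha> i)"
    by (auto simp: fun_eq_iff)
  have "Rep_l2 (mfold ?i L \<gamma> v) \<alpha>
      = sqrt (bc ?i (\<alpha> ?i) / bc ?i (\<gamma> ?i @ \<alpha> ?i)) *\<^sub>R Rep_l2 (mfold l L \<gamma> v) ?\<alpha>"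
    unfolding mfold_Suc by (rule Rep_fold_L[OF i \<gamma>i Suc.prems(1)])
  also have "Rep_l2 (mfold l L \<gamma> v) ?\<alpha> = sqrt (\<Prod>i=1..l. bc i (\<alpha> i) / bc i (\<gamma> i @ \<alpha> i)) *\<^sub>R
      Rep_l2 v (\<lambda>i. if i \<in> {1..Suc l} then \<gamma> i @ \<alpha> i else \<alpha> i)"
    using Suc.IH[OF \<alpha>' Suc_leD[OF Suc.prems(2)]] unfolding p w .
  finally show ?case
    by (simp add: mult.commute flip: real_sqrt_mult)
qed

abbreviation vac :: mword where "vac \<equiv> (\<lambda>i\<in>{1..k}. [])"

text \<open>b is 1 at the vacuum, so only the factor from \<gamma> survives. All coordinates of v on
  \<open>MW\<close> can thus be read off at the vacuum, which justifies building R from the vacuum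
  coordinate in (i) to (iii).\<close>

lemma Rep_mfold_L_vac:
  assumes \<gamma>: "\<gamma> \<in> MW"
  shows "Rep_l2 (mfold k L \<gamma> v) vac = (1 / sqrt (bm \<gamma>)) *\<^sub>R Rep_l2 v \<gamma>"
proof -
  have "(\<Prod>i=1..k. bc i (vac i) / bc i (\<gamma> i @ vac i)) = (\<Prod>i=1..k. 1 / bc i (\<gamma> i))"
    by (rule prod.cong) (auto simp: bcoef_Nil)
  also have "\<dots> = 1 / bm \<gamma>" by (simp add: prod_dividef bm_def)
  finally have p: "(\<Prod>i=1..k. bc i (vac i) / bc i (\<gamma> i @ vac i)) = 1 / bm \<gamma>" .
  have "(\<lambda>i. if i \<in> {1..k} then \<gamma> i @ vac i else vac i) = \<gamma>"
    using \<gamma> by (auto simp: fun_eq_iff mwords_def PiE_iff extensional_def)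
  then show ?thesis
    unfolding Rep_mfold_L[OF \<gamma> vacuum_word_in_mwords order_refl] p by (simp add: real_sqrt_divide)
qed

lemma model_W_adjoint:
  assumes i: "i \<in> {1..k}" and j: "j \<in> {1..n i}"
  shows "cinner (W i j \<xi>) \<eta> = cinner \<xi> (L i j \<eta>)"
proof -
  let ?g = "\<lambda>\<alpha>. \<alpha>(i := j # \<alpha> i)"
  let ?c = "\<lambda>\<alpha>. Rep_l2 \<xi> \<alpha> * complex_of_real (wt i j \<alpha>)"
  have summand: "Rep_l2 \<xi> \<alpha> *\<^sub>C tensor_vec k n ((\<lambda>l. ket (\<alpha> l))(i := weighted_shift (n i) (a i) (m i) j (ket (\<alpha> i))))
      = ?c \<alpha> *\<^sub>C ket (?g \<alpha>)" if \<alpha>: "\<alpha> \<in> MW" for \<alpha>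
  proof -
    have "tensor_vec k n ((\<lambda>l. ket (\<alpha> l))(i := weighted_shift (n i) (a i) (m i) j (ket (\<alpha> i)))) = W i j (ket \<alpha>)"
      unfolding model_W_def at_position_def by (rule infsum_ket[OF \<alpha>, symmetric])
    also have "\<dots> = complex_of_real (wt i j \<alpha>) *\<^sub>C ket (?g \<alpha>)"
      unfolding wt_def by (rule model_W_ket[OF \<alpha> i j])
    finally show ?thesis by (simp add: scaleC_scaleC)
  qed
  \<comment> \<open>\<open>infsum\<close> is 0 for a family that is not summable, so the series
    defining W must be shown to converge before it is paired term by term; for distinct kets
    square-summable coefficients suffice.\<close>
  have "(\<lambda>\<alpha>. (cmod (?c \<alpha>))\<^sup>2) summable_on MW"
  proof (rule summable_on_comparison_test)
    show "(\<lambda>\<alpha>. (sqrt (1 / a i [j]))\<^sup>2 * (cmod (Rep_l2 \<xi> \<alpha>))\<^sup>2) summable_on MW"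
      by (intro summable_on_cmult_right summable_on_subset_banach[OF l2_summable]) auto
    show "(cmod (?c \<alpha>))\<^sup>2 \<le> (sqrt (1 / a i [j]))\<^sup>2 * (cmod (Rep_l2 \<xi> \<alpha>))\<^sup>2" if "\<alpha> \<in> MW" for \<alpha>
      using power_mono[OF wt_bound[OF i j that], of 2]
      by (simp add: norm_mult power_mult_distrib mult.commute mult_left_mono)
  qed simp
  from ket_series_summable[OF step_inj this]
  have s: "(\<lambda>\<alpha>. ?c \<alpha> *\<^sub>C ket (?g \<alpha>)) summable_on MW" .
  have W: "W i j \<xi> = (\<Sum>\<^sub>\<infinity>\<alpha>\<in>MW. ?c \<alpha> *\<^sub>C ket (?g \<alpha>))"
    unfolding model_W_def at_position_def by (rule infsum_cong) (rule summand)
  have "cinner (W i j \<xi>) \<eta> = (\<Sum>\<^sub>\<infinity>\<alpha>\<in>MW. cinner (?c \<alpha> *\<^sub>C ket (?g \<alpha>)) \<eta>)"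
    unfolding W
    by (rule infsumI[symmetric], rule has_sum_bounded_linear[OF
          bounded_bilinear.bounded_linear_left[OF bounded_bilinear_cinner] has_sum_infsum[OF s]])
  also have "\<dots> = (\<Sum>\<^sub>\<infinity>\<alpha>. cinner (Rep_l2 \<xi> \<alpha>) (Rep_l2 (L i j \<eta>) \<alpha>))"
  proof (rule infsum_cong_neutral)
    fix \<alpha>
    have "cinner (ket (?g \<alpha>)) \<eta> = cnj (Rep_l2 \<eta> (?g \<alpha>))" by (metis cinner_commute cinner_ket)
    then show "cinner (?c \<alpha> *\<^sub>C ket (?g \<alpha>)) \<eta> = cinner (Rep_l2 \<xi> \<alpha>) (Rep_l2 (L i j \<eta>) \<alpha>)"
      if "\<alpha> \<in> MW \<inter> UNIV"
      using that by (simp add: Rep_L[OF i j] cinner_scaleC_left cinner_complex_def scaleR_conv_of_real)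
  qed (auto simp: Rep_L[OF i j])
  finally show ?thesis by (simp add: cinner_l2_def)
qed

lemma L_adjoint:
  assumes "i \<in> {1..k}" "j \<in> {1..n i}"
  shows "cinner (L i j \<xi>) \<eta> = cinner \<xi> (W i j \<eta>)"
  by (metis model_W_adjoint[OF assms] cinner_commute)

lemma mword_letters: "\<alpha> \<in> MW \<Longrightarrow> i \<in> {1..k} \<Longrightarrow> j \<in> set (\<alpha> i) \<Longrightarrow> j \<in> {1..n i}"
  using mwordsD by (fastforce simp: lists_eq_set)

lemma mfold_L_adjoint:
  "\<gamma> \<in> MW \<Longrightarrow> cinner (mfold k L \<gamma> \<xi>) \<eta> = cinner \<xi> (mword_op k W \<gamma> \<eta>)"
  by (rule cinner_mfold, rule L_adjoint) (auto dest: mword_letters simp del: One_nat_def)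

lemma mfold_L_step:
  assumes "\<alpha> \<in> MW" "i \<in> {1..k}" "j \<in> {1..n i}"
  shows "mfold k L (\<alpha>(i := j # \<alpha> i)) v = mfold k L \<alpha> (L i j v)"
  by (rule mfold_step[OF assms(2)], rule L_commute) (use assms mword_letters in auto)

text \<open>The inner product of \<zeta> with \<open>q(W) W\<^sub>\<beta> 1\<close>, with all shifts
  moved to the left argument, where coordinates are explicit.\<close>

definition poly_pairing :: "ncpoly \<Rightarrow> mword \<Rightarrow> (mword, complex) l2 \<Rightarrow> complex" where
  "poly_pairing q \<beta> \<zeta> = (\<Sum>\<gamma>\<in>Poly_Mapping.keys q. cnj (Poly_Mapping.lookup q \<gamma>) *
     Rep_l2 (mfold k L \<beta> (mfold k L \<gamma> \<zeta>)) vac)"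

lemma cinner_generator:
  assumes q: "q \<in> ncpolys k n" and \<alpha>: "\<alpha> \<in> MW" and \<beta>: "\<beta> \<in> MW"
  shows "cinner \<zeta> (mword_op k W \<alpha> (poly_op k W q (mword_op k W \<beta> (c *\<^sub>C vacuum k))))
    = cnj c * poly_pairing q \<beta> (mfold k L \<alpha> \<zeta>)"
proof -
  have "cinner \<zeta>' (Poly_Mapping.lookup q \<gamma> *\<^sub>C mword_op k W \<gamma> (mword_op k W \<beta> (c *\<^sub>C vacuum k)))
      = cnj c * (cnj (Poly_Mapping.lookup q \<gamma>) * Rep_l2 (mfold k L \<beta> (mfold k L \<gamma> \<zeta>')) vac)"
    if "\<gamma> \<in> Poly_Mapping.keys q" for \<gamma> \<zeta>'
  proof -
    have \<gamma>: "\<gamma> \<in> MW" using q that by (auto simp: ncpolys_def)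
    show ?thesis
      unfolding cinner_scaleC_right mfold_L_adjoint[OF \<gamma>, symmetric] mfold_L_adjoint[OF \<beta>, symmetric]
        vacuum_def cinner_ket by (simp add: mult_ac)
  qed
  then show ?thesis
    unfolding mfold_L_adjoint[OF \<alpha>, symmetric] poly_op_def cinner_sum_right poly_pairing_def sum_distrib_left
    by (intro sum.cong) auto
qed

text \<open>Turns orthogonality to a closed span into conditions on coordinates, which can be
  verified for the slices of the Berezin kernel.\<close>

lemma model_N_iff:
  assumes Q: "\<Q> \<subseteq> ncpolys k n"
  shows "\<xi> \<in> model_N k n m a \<Q> \<longleftrightarrow> \<xi> \<in> fock_tensor k n \<and>
    (\<forall>\<alpha>\<in>MW. \<forall>\<beta>\<in>MW. \<forall>q\<in>\<Q>. poly_pairing q \<beta> (mfold k L \<alpha> \<xi>) = 0)" (is "_ \<longleftrightarrow> _ \<and> ?P")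
proof -
  define E where "E = {mword_op k W \<alpha> (poly_op k W q (mword_op k W \<beta> (c *\<^sub>C vacuum k))) | \<alpha> \<beta> q c.
      \<alpha> \<in> MW \<and> \<beta> \<in> MW \<and> q \<in> \<Q>}"
  have M: "model_M k n m a \<Q> = closure (cspan E)" by (simp add: model_M_def E_def)
  have "(\<forall>\<eta>\<in>model_M k n m a \<Q>. cinner \<xi> \<eta> = 0) \<longleftrightarrow> (\<forall>\<eta>\<in>E. cinner \<xi> \<eta> = 0)"
  proof
    assume E: "\<forall>\<eta>\<in>E. cinner \<xi> \<eta> = 0"
    have "closure (cspan E) \<subseteq> {\<eta>. \<forall>e\<in>{\<xi>}. cinner e \<eta> = 0}"
      using E by (intro closure_cspan_minimal orthogonal_complement_closed_csubspace) auto
    then show "\<forall>\<eta>\<in>model_M k n m a \<Q>. cinner \<xi> \<eta> = 0" unfolding M by blast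
  next
    show "\<forall>\<eta>\<in>model_M k n m a \<Q>. cinner \<xi> \<eta> = 0 \<Longrightarrow> \<forall>\<eta>\<in>E. cinner \<xi> \<eta> = 0"
      unfolding M using generators_in_closure_cspan[of E] by blast
  qed
  also have "\<dots> \<longleftrightarrow> ?P"
  proof
    assume E: "\<forall>\<eta>\<in>E. cinner \<xi> \<eta> = 0"
    show ?P
    proof (intro ballI)
      fix \<alpha> \<beta> q assume h: "\<alpha> \<in> MW" "\<beta> \<in> MW" "q \<in> \<Q>"
      then have "cinner \<xi> (mword_op k W \<alpha> (poly_op k W q (mword_op k W \<beta> (1 *\<^sub>C vacuum k)))) = 0"
        using E unfolding E_def by blast
      moreover have "q \<in> ncpolys k n" using h Q by blast
      ultimately show "poly_pairing q \<beta> (mfold k L \<alpha> \<xi>) = 0" using h by (subst (asm) cinner_generator) auto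
    qed
  next
    assume P: ?P
    show "\<forall>\<eta>\<in>E. cinner \<xi> \<eta> = 0"
    proof
      fix \<eta> assume "\<eta> \<in> E"
      then obtain \<alpha> \<beta> q c where h: "\<alpha> \<in> MW" "\<beta> \<in> MW" "q \<in> \<Q>"
        and \<eta>: "\<eta> = mword_op k W \<alpha> (poly_op k W q (mword_op k W \<beta> (c *\<^sub>C vacuum k)))"
        unfolding E_def by blast
      have "q \<in> ncpolys k n" using h Q by blast
      then show "cinner \<xi> \<eta> = 0" unfolding \<eta> using P h by (subst cinner_generator) auto
    qed
  qed
  finally show ?thesis by (simp add: model_N_def)
qed

lemma model_N_closed_csubspace: "csubspace (model_N k n m a \<Q>)" "closed (model_N k n m a \<Q>)"
proof -
  have "model_N k n m a \<Q> = {\<xi>. \<forall>e\<in>ket ` (- MW) \<union> model_M k n m a \<Q>. cinner \<xi> e = 0}"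
    unfolding model_N_def fock_tensor_def ball_Un ball_simps cinner_ket by auto
  then show "csubspace (model_N k n m a \<Q>)" "closed (model_N k n m a \<Q>)"
    by (simp_all only: orthogonal_complement_closed_csubspace)
qed

text \<open>Applying \<open>L i j\<close> replaces \<alpha> by the multi-word with j prepended at i,
  so the conditions for \<open>L i j \<xi>\<close> are among those for \<xi>.\<close>

lemma L_invariant:
  assumes Q: "\<Q> \<subseteq> ncpolys k n" and ij: "i \<in> {1..k}" "j \<in> {1..n i}" and \<xi>: "\<xi> \<in> model_N k n m a \<Q>"
  shows "L i j \<xi> \<in> model_N k n m a \<Q>"
  unfolding model_N_iff[OF Q]
proof (intro conjI ballI)
  show "L i j \<xi> \<in> fock_tensor k n" by (simp add: fock_tensor_def Rep_L[OF ij])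
  fix \<alpha> \<beta> q assume h: "\<alpha> \<in> MW" "\<beta> \<in> MW" "q \<in> \<Q>"
  have "\<alpha>(i := j # \<alpha> i) \<in> MW" using h ij by (intro mwords_Cons)
  then show "poly_pairing q \<beta> (mfold k L \<alpha> (L i j \<xi>)) = 0"
    using \<xi> h unfolding model_N_iff[OF Q] mfold_L_step[OF h(1) ij, symmetric] by blast
qed

text \<open>The projection in S is invisible to vectors of N_Q, and \<open>L i j\<close> leaves N_Q
  invariant; so the adjoint of the compression is a restriction of \<open>L i j\<close>.\<close>

lemma adjoint_model_S:
  assumes Q: "\<Q> \<subseteq> ncpolys k n" and ij: "i \<in> {1..k}" "j \<in> {1..n i}" and \<eta>: "\<eta> \<in> model_N k n m a \<Q>"
  shows "adjoint_on (model_N k n m a \<Q>) (model_S k n m a \<Q> i j) \<eta> = L i j \<eta>"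
proof (rule adjoint_onI[OF model_N_closed_csubspace(1) L_invariant[OF assms]])
  fix \<xi>
  have "cinner (W i j \<xi> - model_S k n m a \<Q> i j \<xi>) \<eta> = 0"
    unfolding model_S_def using \<eta> by (intro orth_proj(2) model_N_closed_csubspace)
  then show "cinner (model_S k n m a \<Q> i j \<xi>) \<eta> = cinner \<xi> (L i j \<eta>)"
    by (simp add: cinner_diff_left model_W_adjoint[OF ij])
qed

lemma L_tensor: "i \<in> {1..k} \<Longrightarrow> j \<in> {1..n i} \<Longrightarrow> L i j (x \<otimes>\<^sub>H h) = L i j x \<otimes>\<^sub>H h"
  by (rule l2_eqI)
    (simp add: Rep_L tensor.rep_eq scaleR_scaleC scaleC_scaleC scaleC_complex_def)

lemma model_S_adj_id_eq:
  fixes v :: "(mword, 'g::complex_inner) l2"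
  assumes Q: "\<Q> \<subseteq> ncpolys k n" and ij: "i \<in> {1..k}" "j \<in> {1..n i}"
    and v: "v \<in> tensor_space (model_N k n m a \<Q>)"
  shows "model_S_adj_id k n m a \<Q> i j v = L i j v"
  unfolding model_S_adj_id_def
  by (rule tensor_id_eqI[OF bounded_op_L[OF ij] _ v]) (simp add: adjoint_model_S[OF Q ij] L_tensor[OF ij])

lemma slice_L: "i \<in> {1..k} \<Longrightarrow> j \<in> {1..n i} \<Longrightarrow> slice h (L i j v) = L i j (slice h v)"
  by (rule l2_eqI) (simp add: Rep_L slice.rep_eq cinner_scaleR_left)

lemma mfold_L_slice: "\<alpha> \<in> MW \<Longrightarrow> mfold k L \<alpha> (slice h v) = slice h (mfold k L \<alpha> v)"
  by (rule mfold_intertwine[symmetric]) (rule slice_L)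

text \<open>Norms in \<open>l2\<close> sum over all indices of the type, the series in (iii) over
  \<open>MW\<close> only; this reconciles the two.\<close>

lemma tensor_space_model_N_support:
  fixes v :: "(mword, 'g::chilbert_space) l2"
  assumes v: "v \<in> tensor_space (model_N k n m a \<Q>)" and \<alpha>: "\<alpha> \<notin> MW"
  shows "Rep_l2 v \<alpha> = 0"
proof (rule cinner_eq_zeroD)
  have "slice (Rep_l2 v \<alpha>) v \<in> model_N k n m a \<Q>"
    using v tensor_space_iff_slices[OF model_N_closed_csubspace] by blast
  then have "Rep_l2 (slice (Rep_l2 v \<alpha>) v) \<alpha> = 0" using \<alpha> by (simp add: model_N_def fock_tensor_def)
  then show "cinner (Rep_l2 v \<alpha>) (Rep_l2 v \<alpha>) = 0" by (simp add: slice.rep_eq)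
qed

end

section \<open>The Berezin kernel and the equivalence of (i) and (iii)\<close>

locale model_op_tuple = model_data k n m a + op_tuple k n a A
  for k n m a and A :: "nat \<Rightarrow> nat \<Rightarrow> 'h \<Rightarrow> 'h::chilbert_space"
begin

lemma mfold_C_adjoint:
  "\<gamma> \<in> MW \<Longrightarrow> cinner (mfold k C \<gamma> x) y = cinner x (mword_op k A \<gamma> y)"
  by (rule cinner_mfold) (auto simp: C_def intro!: cinner_adj_left bounded_A dest: mword_letters simp del: One_nat_def)

lemma mfold_C_step:
  assumes "\<alpha> \<in> MW" "i \<in> {1..k}" "j \<in> {1..n i}"
  shows "mfold k C (\<alpha>(i := j # \<alpha> i)) x = mfold k C \<alpha> (C i j x)"
proof (rule mfold_step[OF assms(2)])
  fix l t y assume "l \<in> {1..k}" "l \<noteq> i" "t \<in> set (\<alpha> l)"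
  then have "C l t \<circ> C i j = C i j \<circ> C l t" using assms mword_letters by (intro C_commute) auto
  then show "C l t (C i j y) = C i j (C l t y)" by (metis o_apply)
qed

lemma mfold_C_linear:
  assumes "\<alpha> \<in> MW"
  shows "bounded_op (mfold k C \<alpha>)"
proof -
  have fold: "bounded_op (fold (C i) w)" if "i \<in> {1..k}" "w \<in> lists {1..n i}" for i w
    using that(2)
  proof (induction w)
    case (Cons j w)
    have "fold (C i) (j # w) = fold (C i) w \<circ> C i j" by simp
    have "bounded_op (fold (C i) w \<circ> C i j)" using Cons by (intro bounded_op_comp bounded_C that(1))
    then show ?case by (simp only: \<open>fold (C i) (j # w) = fold (C i) w \<circ> C i j\<close>)
  next
    case Nil
    have "fold (C i) [] = id" by simp
    then show ?case using bounded_op_id by metis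
  qed
  have "bounded_op (mfold l C \<alpha>)" if "l \<le> k" for l
    using that
  proof (induction l)
    case (Suc l)
    have "mfold (Suc l) C \<alpha> = fold (C (Suc l)) (\<alpha> (Suc l)) \<circ> mfold l C \<alpha>"
      by (simp add: fun_eq_iff mfold_Suc)
    moreover have "bounded_op (fold (C (Suc l)) (\<alpha> (Suc l)) \<circ> mfold l C \<alpha>)"
      using Suc by (intro bounded_op_comp fold mwordsD[OF assms]) auto
    ultimately show ?case by (simp only:)
  next
    case 0
    have "mfold 0 C \<alpha> = id" by (simp add: fun_eq_iff mfold_0)
    then show ?case using bounded_op_id by metis
  qed
  then show ?thesis by simp
qed

lemma word_sum:
  assumes R: "positive_op R"
  shows "(\<Sum>\<^sub>\<infinity>s\<in>(\<Pi>\<^sub>E i\<in>{1..k}. UNIV). enf (series_term m R s) x)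
    = (\<Sum>\<^sub>\<infinity>\<alpha>\<in>MW. ennreal (bm \<alpha> * qform R (mfold k C \<alpha> x)))"
  unfolding series_eq_word_sum[OF R]
proof (rule infsum_cong)
  fix \<alpha> assume \<alpha>: "\<alpha> \<in> MW"
  have "(\<Prod>i=1..k. ennreal (bc i (\<alpha> i))) = ennreal (bm \<alpha>)"
    unfolding bm_def using bc_pos[OF _ mwordsD[OF \<alpha>]] by (intro prod_ennreal) (auto intro: less_imp_le simp del: One_nat_def)
  then show "(\<Prod>i=1..k. ennreal (bc i (\<alpha> i))) * enf R (mfold k C \<alpha> x) = ennreal (bm \<alpha> * qform R (mfold k C \<alpha> x))"
    using bm_pos[OF \<alpha>] qform_nonneg[OF R] by (simp add: enf_def ennreal_mult)
qed

lemma similarity_of_series_bounds: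
  assumes Q: "\<Q> \<subseteq> ncpolys k n" and QA: "\<And>q. q \<in> \<Q> \<Longrightarrow> poly_op k A q = (\<lambda>_. 0)"
    and sb: "series_bounds k n m a A c d R"
  shows "\<exists>G Y. model_similarity k n m a \<Q> A G Y \<and>
    opnorm_on UNIV Y * opnorm_on G (inv_into UNIV Y) \<le> sqrt (d / c)"
proof -
  have cd: "0 < c" "c \<le> d" and R: "positive_op R"
    using sb unfolding series_bounds_iff by auto
  have lo: "\<And>x. ennreal (c * (norm x)\<^sup>2) \<le> (\<Sum>\<^sub>\<infinity>\<alpha>\<in>MW. ennreal (bm \<alpha> * qform R (mfold k C \<alpha> x)))"
    and hi: "\<And>x. (\<Sum>\<^sub>\<infinity>\<alpha>\<in>MW. ennreal (bm \<alpha> * qform R (mfold k C \<alpha> x))) \<le> ennreal (d * (norm x)\<^sup>2)"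
    using sb unfolding series_bounds_iff word_sum[OF R] by blast+
  obtain D :: "'h \<Rightarrow> 'h" where D: "bounded_op D" and nD: "\<And>x. (norm (D x))\<^sup>2 = qform R x"
    using positive_op_factorization[OF R] by blast
  define f where "f x \<alpha> = (if \<alpha> \<in> MW then sqrt (bm \<alpha>) *\<^sub>R D (mfold k C \<alpha> x) else 0)" for x \<alpha>
  define Y :: "'h \<Rightarrow> (mword, 'h) l2" where "Y x = Abs_l2 (f x)" for x
  define s where "s x = enn2real (\<Sum>\<^sub>\<infinity>\<alpha>\<in>MW. ennreal (bm \<alpha> * qform R (mfold k C \<alpha> x)))" for x
  have s: "(\<Sum>\<^sub>\<infinity>\<alpha>\<in>MW. ennreal (bm \<alpha> * qform R (mfold k C \<alpha> x))) = ennreal (s x)" for x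
  proof -
    have "(\<Sum>\<^sub>\<infinity>\<alpha>\<in>MW. ennreal (bm \<alpha> * qform R (mfold k C \<alpha> x))) < top"
      using hi[of x] by (rule order.strict_trans1) simp
    then show ?thesis by (simp add: s_def)
  qed
  have s0: "0 \<le> s x" for x by (simp add: s_def)
  have nf: "(norm (f x \<alpha>))\<^sup>2 = bm \<alpha> * qform R (mfold k C \<alpha> x)" if "\<alpha> \<in> MW" for x \<alpha>
    using that bm_pos[OF that] by (simp add: f_def power_mult_distrib nD)
  have f_outside: "f x \<alpha> = 0" if "\<alpha> \<notin> MW" for x \<alpha> using that by (simp add: f_def)
  have "((\<lambda>\<alpha>. bm \<alpha> * qform R (mfold k C \<alpha> x)) has_sum s x) MW" for x
    using bm_pos qform_nonneg[OF R]
    by (intro has_sum_if_ennreal_infsum s s0 mult_nonneg_nonneg) (auto intro: less_imp_le)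
  then have hs: "((\<lambda>\<alpha>. (norm (f x \<alpha>))\<^sup>2) has_sum s x) UNIV" for x
    by (rule has_sum_cong_neutral[THEN iffD1, rotated -1]) (auto simp: nf f_outside)
  then have Rep_Y: "Rep_l2 (Y x) = f x" for x
    unfolding Y_def by (intro Abs_l2_inverse) (auto simp: summable_on_def)
  have nY: "(norm (Y x))\<^sup>2 = s x" for x
    unfolding norm_l2_square Rep_Y using hs by (rule infsumI)
  have up: "norm (Y x) \<le> sqrt d * norm x" for x
  proof -
    have "s x \<le> d * (norm x)\<^sup>2" using hi[of x] cd by (simp add: s ennreal_le_iff)
    show ?thesis
      by (rule power2_le_imp_le) (use \<open>s x \<le> d * (norm x)\<^sup>2\<close> cd in \<open>auto simp: nY power_mult_distrib\<close>)
  qed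
  have down: "sqrt c * norm x \<le> norm (Y x)" for x
  proof -
    have "c * (norm x)\<^sup>2 \<le> s x" using lo[of x] s0 by (simp add: s ennreal_le_iff)
    show ?thesis
      by (rule power2_le_imp_le) (use \<open>c * (norm x)\<^sup>2 \<le> s x\<close> cd in \<open>auto simp: nY power_mult_distrib\<close>)
  qed
  have bY: "bounded_op Y"
  proof (rule bounded_op_onI[OF _ _ up])
    show "Y (x + y) = Y x + Y y" for x y
      by (rule l2_eqI) (auto simp: Rep_Y f_def plus_l2.rep_eq bounded_op_add[OF mfold_C_linear]
          bounded_op_add[OF D] scaleR_add_right)
    show "Y (r *\<^sub>C x) = r *\<^sub>C Y x" for r x
      by (rule l2_eqI) (auto simp: Rep_Y f_def scaleC_l2.rep_eq bounded_op_scaleC[OF mfold_C_linear]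
          bounded_op_scaleC[OF D] scaleR_scaleC scaleC_scaleC mult.commute)
  qed
  have "0 < sqrt c" using cd by simp
  note r = bounded_below_op[OF bY this down]
  have L_Y: "L i j (Y x) = Y (C i j x)" if ij: "i \<in> {1..k}" "j \<in> {1..n i}" for i j x
  proof (rule l2_eqI)
    fix \<alpha>
    show "Rep_l2 (L i j (Y x)) \<alpha> = Rep_l2 (Y (C i j x)) \<alpha>"
    proof (cases "\<alpha> \<in> MW")
      case True
      let ?\<alpha> = "\<alpha>(i := j # \<alpha> i)"
      have \<alpha>': "?\<alpha> \<in> MW" using ij by (intro mwords_Cons True)
      have split: "bm \<beta> = bc i (\<beta> i) * (\<Prod>l\<in>{1..k} - {i}. bc l (\<beta> l))" for \<beta>
        unfolding bm_def using ij(1) by (intro prod.remove) auto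
      have "(\<Prod>l\<in>{1..k} - {i}. bc l (?\<alpha> l)) = (\<Prod>l\<in>{1..k} - {i}. bc l (\<alpha> l))"
        by (rule prod.cong) auto
      \<comment> \<open>The weight of \<open>L i j\<close> is exactly the ratio of the square roots
        of b in the kernel; this is what makes the kernel intertwine.\<close>
      then have "wt i j \<alpha> * sqrt (bm ?\<alpha>) = sqrt (bm \<alpha>)"
        unfolding wt_def split using bc_pos[OF ij(1) mwordsD[OF \<alpha>' ij(1)]]
        by (simp flip: real_sqrt_mult)
      then show ?thesis using True \<alpha>' by (simp add: Rep_L[OF ij] Rep_Y f_def mfold_C_step[OF True ij])
    qed (simp add: Rep_L[OF ij] Rep_Y f_def)
  qed
  have mfold_Y: "mfold k L \<alpha> (Y x) = Y (mfold k C \<alpha> x)" if "\<alpha> \<in> MW" for \<alpha> x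
    by (rule mfold_intertwine[where f = Y and C = C and D = L, OF _ that, symmetric]) (rule L_Y[symmetric])
  have slice_N: "slice h (Y x) \<in> model_N k n m a \<Q>" for h x
    unfolding model_N_iff[OF Q]
  proof (intro conjI ballI)
    show "slice h (Y x) \<in> fock_tensor k n" by (simp add: fock_tensor_def slice.rep_eq Rep_Y f_def)
    fix \<alpha> \<beta> q assume \<alpha>: "\<alpha> \<in> MW" and \<beta>: "\<beta> \<in> MW" and q: "q \<in> \<Q>"
    define x' where "x' = mfold k C \<alpha> x"
    have keys: "\<gamma> \<in> MW" if "\<gamma> \<in> Poly_Mapping.keys q" for \<gamma>
      using that q Q by (auto simp: ncpolys_def)
    \<comment> \<open>The adjoint of q(A) applied to x', hence 0. The coefficients are conjugated
      because q was moved to the other argument.\<close>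
    define u where "u = (\<Sum>\<gamma>\<in>Poly_Mapping.keys q. cnj (Poly_Mapping.lookup q \<gamma>) *\<^sub>C mfold k C \<gamma> x')"
    have "cinner u y = cinner 0 y" for y
    proof -
      have "cinner u y = cinner x' (poly_op k A q y)"
        unfolding u_def poly_op_def cinner_sum_left cinner_sum_right cinner_scaleC_left cinner_scaleC_right
        by (intro sum.cong) (auto simp: mfold_C_adjoint keys)
      then show ?thesis by (simp add: QA[OF q])
    qed
    then have "u = 0" by (rule cinner_extensionality)
    have "poly_pairing q \<beta> (mfold k L \<alpha> (slice h (Y x)))
        = (\<Sum>\<gamma>\<in>Poly_Mapping.keys q. cnj (Poly_Mapping.lookup q \<gamma>) *
            cinner (Rep_l2 (Y (mfold k C \<beta> (mfold k C \<gamma> x'))) vac) h)"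
      unfolding poly_pairing_def x'_def
      by (intro sum.cong) (auto simp: mfold_L_slice mfold_Y \<alpha> \<beta> keys slice.rep_eq)
    also have "\<dots> = cinner (Rep_l2 (Y (mfold k C \<beta> u)) vac) h"
      unfolding u_def bounded_op_sum[OF mfold_C_linear[OF \<beta>]] bounded_op_scaleC[OF mfold_C_linear[OF \<beta>]]
        bounded_op_sum[OF bY] bounded_op_scaleC[OF bY] Rep_l2_sum scaleC_l2.rep_eq cinner_sum_left cinner_scaleC_left ..
    also have "\<dots> = 0"
      by (simp add: \<open>u = 0\<close> bounded_op_0[OF mfold_C_linear[OF \<beta>]] bounded_op_0[OF bY] zero_l2.rep_eq)
    finally show "poly_pairing q \<beta> (mfold k L \<alpha> (slice h (Y x))) = 0" .
  qed
  have Y_mem: "Y x \<in> tensor_space (model_N k n m a \<Q>)" for x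
    unfolding tensor_space_iff_slices[OF model_N_closed_csubspace] using slice_N by blast
  have S_Y: "model_S_adj_id k n m a \<Q> i j (Y x) = Y (C i j x)" if "i \<in> {1..k}" "j \<in> {1..n i}" for i j x
    using model_S_adj_id_eq[OF Q that Y_mem] L_Y[OF that] by simp
  have inj: "inj Y" using r(3) by (simp add: invertible_op_def bij_betw_def)
  have "model_similarity k n m a \<Q> A (range Y) Y"
    unfolding model_similarity_def
  proof (intro conjI ballI)
    show "range Y \<subseteq> tensor_space (model_N k n m a \<Q>)" using Y_mem by blast
    fix i j assume ij: "i \<in> {1..k}" "j \<in> {1..n i}"
    show "model_S_adj_id k n m a \<Q> i j ` range Y \<subseteq> range Y" using S_Y[OF ij] by auto
    show "adj (A i j) = inv Y \<circ> model_S_adj_id k n m a \<Q> i j \<circ> Y"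
      by (simp add: fun_eq_iff S_Y[OF ij] inv_f_f[OF inj] C_def)
  qed (use r in auto)
  moreover have "opnorm_on UNIV Y * opnorm_on (range Y) (inv Y) \<le> sqrt (d / c)"
  proof -
    have 1: "opnorm_on UNIV Y \<le> sqrt d"
      unfolding opnorm_on_def
    proof (rule cSUP_least)
      show "norm (Y x) / norm x \<le> sqrt d" for x
        using up[of x] cd by (cases "x = 0") (auto simp: field_simps)
    qed simp
    have le: "norm (inv Y y) / norm y \<le> 1 / sqrt c" if "y \<in> range Y" for y
    proof -
      obtain x where y: "y = Y x" using \<open>y \<in> range Y\<close> by blast
      show ?thesis
      proof (cases "Y x = 0")
        case False
        then show ?thesis using down[of x] cd by (simp add: y inv_f_f[OF inj] field_simps)
      qed (use cd y in simp)
    qed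
    have 2: "opnorm_on (range Y) (inv Y) \<le> 1 / sqrt c"
      unfolding opnorm_on_def by (rule cSUP_least) (use le in auto)
    \<comment> \<open>With 0 / 0 = 0 the vector \<open>Y 0 = 0\<close> contributes the value 0, so
      the supremum is nonnegative, as the product of the two bounds requires.\<close>
    have "norm (inv Y (Y 0)) / norm (Y 0) \<le> opnorm_on (range Y) (inv Y)"
      unfolding opnorm_on_def using le by (intro cSUP_upper bdd_aboveI2[of _ _ "1 / sqrt c"]) auto
    then have 3: "0 \<le> opnorm_on (range Y) (inv Y)" by (simp add: bounded_op_0[OF bY])
    have "opnorm_on UNIV Y * opnorm_on (range Y) (inv Y) \<le> sqrt d * (1 / sqrt c)"
      using 1 2 3 cd by (intro mult_mono) auto
    then show ?thesis by (simp add: real_sqrt_divide)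
  qed
  ultimately show ?thesis by blast
qed

text \<open>The summand of the series at \<alpha> is the squared norm of the \<alpha>-th coordinate
  of \<open>Y x\<close>, because b_\<alpha> cancels the factor in \<open>Rep_mfold_L_vac\<close>. So
  the series sums to norm (Y x)^2, and its bounds come from those of Y and its inverse.\<close>

lemma series_bounds_of_similarity:
  assumes Q: "\<Q> \<subseteq> ncpolys k n" and ms: "model_similarity k n m a \<Q> A V Y"
  shows "\<exists>c d R. series_bounds k n m a A c d R"
proof -
  have VT: "V \<subseteq> tensor_space (model_N k n m a \<Q>)"
    and inv_V: "\<And>i j. i \<in> {1..k} \<Longrightarrow> j \<in> {1..n i} \<Longrightarrow> model_S_adj_id k n m a \<Q> i j ` V \<subseteq> V"
    and inv: "invertible_op UNIV V Y"
    and adj: "\<And>i j. i \<in> {1..k} \<Longrightarrow> j \<in> {1..n i} \<Longrightarrow> C i j = inv Y \<circ> model_S_adj_id k n m a \<Q> i j \<circ> Y"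
    using ms unfolding model_similarity_def C_def by blast+
  have bY: "bounded_op Y" and bij: "bij_betw Y UNIV V" and bI: "bounded_op_on V (inv Y)"
    using inv by (auto simp: invertible_op_def)
  have YV': "Y x \<in> V" for x using bij by (auto simp: bij_betw_def)
  have YV: "Y x \<in> tensor_space (model_N k n m a \<Q>)" for x using YV' VT by blast
  have Y_C: "Y (C i j x) = L i j (Y x)" if ij: "i \<in> {1..k}" "j \<in> {1..n i}" for i j x
  proof -
    \<comment> \<open>Invariance of \<open>V\<close> puts this vector in the range of Y, where
      \<open>inv Y\<close> is a genuine inverse.\<close>
    have "model_S_adj_id k n m a \<Q> i j (Y x) \<in> V" using inv_V[OF ij] YV' by blast
    then have "Y (C i j x) = model_S_adj_id k n m a \<Q> i j (Y x)"
      unfolding adj[OF ij] using bij by (simp add: bij_betw_inv_into_right)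
    then show ?thesis using model_S_adj_id_eq[OF Q ij YV] by simp
  qed
  have Y_mfold: "Y (mfold k C \<alpha> x) = mfold k L \<alpha> (Y x)" if "\<alpha> \<in> MW" for \<alpha> x
    by (rule mfold_intertwine[where f = Y and C = C and D = L, OF _ that]) (rule Y_C)
  obtain K where K: "K > 0" "\<And>x. norm (Y x) \<le> K * norm x"
    using bounded_op_on_bound[OF bY] by (metis UNIV_I)
  obtain K' where K': "K' > 0" "\<And>y. y \<in> V \<Longrightarrow> norm (inv Y y) \<le> K' * norm y"
    using bounded_op_on_bound[OF bI] by blast
  let ?B = "\<lambda>x y. cinner (Rep_l2 (Y x) vac) (Rep_l2 (Y y) vac)"
  have vb: "norm (Rep_l2 (Y x) vac) \<le> K * norm x" for x
    by (rule order_trans[OF norm_Rep_l2_le K(2)])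
  obtain R where bR: "bounded_op R" and R: "\<And>x y. cinner (R x) y = ?B x y"
  proof (rule sesquilinear_form_operator[of ?B "K * K"])
    show "cmod (?B x y) \<le> K * K * norm x * norm y" for x y
    proof -
      have "cmod (?B x y) \<le> norm (Rep_l2 (Y x) vac) * norm (Rep_l2 (Y y) vac)" by (rule cmod_cinner_le)
      also have "\<dots> \<le> (K * norm x) * (K * norm y)" using K(1) by (intro mult_mono vb) auto
      finally show ?thesis by (simp add: mult_ac)
    qed
  qed (auto simp: bounded_op_add[OF bY] bounded_op_scaleC[OF bY] plus_l2.rep_eq scaleC_l2.rep_eq
      cinner_add_left cinner_add_right cinner_scaleC_left cinner_scaleC_right)
  have posR: "positive_op R"
    by (rule positive_opI[where q = "\<lambda>x. (norm (Rep_l2 (Y x) vac))\<^sup>2"]) (auto simp: bR R cinner_self)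
  have qR: "qform R x = (norm (Rep_l2 (Y x) vac))\<^sup>2" for x
    by (simp add: qform_def R cinner_self flip: of_real_power)
  have sum: "(\<Sum>\<^sub>\<infinity>s\<in>(\<Pi>\<^sub>E i\<in>{1..k}. UNIV). enf (series_term m R s) x) = ennreal ((norm (Y x))\<^sup>2)" for x
  proof -
    have "(\<Sum>\<^sub>\<infinity>\<alpha>\<in>MW. ennreal (bm \<alpha> * qform R (mfold k C \<alpha> x))) = (\<Sum>\<^sub>\<infinity>\<alpha>\<in>MW. ennreal ((norm (Rep_l2 (Y x) \<alpha>))\<^sup>2))"
    proof (rule infsum_cong)
      fix \<alpha> assume \<alpha>: "\<alpha> \<in> MW"
      have "bm \<alpha> * qform R (mfold k C \<alpha> x) = (norm (Rep_l2 (Y x) \<alpha>))\<^sup>2"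
        using bm_pos[OF \<alpha>] unfolding qR Y_mfold[OF \<alpha>] Rep_mfold_L_vac[OF \<alpha>]
        by (simp add: power_mult_distrib power_divide)
      then show "ennreal (bm \<alpha> * qform R (mfold k C \<alpha> x)) = ennreal ((norm (Rep_l2 (Y x) \<alpha>))\<^sup>2)" by simp
    qed
    also have "\<dots> = (\<Sum>\<^sub>\<infinity>\<alpha>. ennreal ((norm (Rep_l2 (Y x) \<alpha>))\<^sup>2))"
      by (rule infsum_cong_neutral) (auto simp: tensor_space_model_N_support[OF YV])
    also have "\<dots> = ennreal ((norm (Y x))\<^sup>2)"
      unfolding norm_l2_square by (rule ennreal_infsum_eq[OF has_sum_infsum[OF l2_summable]]) simp
    finally show ?thesis unfolding word_sum[OF posR] .
  qed
  \<comment> \<open>The summand (1 / K')^2 is added so that the upper constant is at least the lower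
    one.\<close>
  have up: "(norm (Y x))\<^sup>2 \<le> (K\<^sup>2 + (1 / K')\<^sup>2) * (norm x)\<^sup>2" for x
  proof -
    have "(norm (Y x))\<^sup>2 \<le> (K * norm x)\<^sup>2" by (intro power_mono K) simp
    then show ?thesis by (simp add: power_mult_distrib distrib_right add_increasing2)
  qed
  have down: "(1 / K')\<^sup>2 * (norm x)\<^sup>2 \<le> (norm (Y x))\<^sup>2" for x
  proof -
    have "norm x \<le> K' * norm (Y x)"
      using K'(2)[OF YV', of x] bij by (simp add: bij_betw_def)
    then have "(1 / K' * norm x)\<^sup>2 \<le> (norm (Y x))\<^sup>2"
      using K'(1) by (intro power_mono) (auto simp: field_simps)
    then show ?thesis by (simp add: power_divide)
  qed
  have "series_bounds k n m a A ((1 / K')\<^sup>2) (K\<^sup>2 + (1 / K')\<^sup>2) R"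
    unfolding series_bounds_iff sum using posR K'(1) up down by (auto intro!: ennreal_leI simp del: power_divide)
  then show ?thesis by blast
qed

end

theorem theorem3p2:
  fixes k :: nat and n m :: "nat \<Rightarrow> nat"
    and a :: "nat \<Rightarrow> nat list \<Rightarrow> real"
    and \<Q> :: "ncpoly set"
    and A :: "nat \<Rightarrow> nat \<Rightarrow> 'h \<Rightarrow> 'h::{chilbert_space, second_countable_topology}"
  assumes "k \<ge> 1"
    and "\<And>i. i \<in> {1..k} \<Longrightarrow> n i \<ge> 1"
    and "\<And>i. i \<in> {1..k} \<Longrightarrow> m i \<ge> 1"
    and "\<And>i. i \<in> {1..k} \<Longrightarrow> positive_regular (n i) (a i)"
    and "\<Q> \<subseteq> ncpolys k n"
    and "model_N k n m a \<Q> \<noteq> {0}"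
    and "A \<in> commuting_tuples k n"
    and "\<And>i. i \<in> {1..k} \<Longrightarrow>
      \<exists>T. wot_has_sum (\<lambda>\<alpha> x. a i \<alpha> *\<^sub>R word_op (A i) \<alpha> (adj (word_op (A i) \<alpha>) x))
            (lists {1..n i}) T"
    and "\<And>q. q \<in> \<Q> \<Longrightarrow> poly_op k A q = (\<lambda>_. 0)"
  shows "((\<exists>G Y. model_similarity k n m a \<Q> A G Y) \<longleftrightarrow>
          (\<exists>Q. Q \<in> cone_ge k n m a A \<and> invertible_op UNIV UNIV Q \<and>
             (\<forall>i\<in>{1..k}. wot_tendsto_zero (\<lambda>s. (Phi (n i) (a i) (A i) ^^ s) Q)))) \<and>
         ((\<exists>Q. Q \<in> cone_ge k n m a A \<and> invertible_op UNIV UNIV Q \<and>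
             (\<forall>i\<in>{1..k}. wot_tendsto_zero (\<lambda>s. (Phi (n i) (a i) (A i) ^^ s) Q))) \<longleftrightarrow>
          (\<exists>c d R. series_bounds k n m a A c d R)) \<and>
         (\<forall>c d R. series_bounds k n m a A c d R \<longrightarrow>
            (\<exists>G Y. model_similarity k n m a \<Q> A G Y \<and>
               opnorm_on UNIV Y * opnorm_on G (inv_into UNIV Y) \<le> sqrt (d / c)))"
proof -
  interpret model_op_tuple k n m a A
    using assms(4,7,8) by unfold_locales (auto simp: positive_regular_def simp del: One_nat_def)
  have m: "\<forall>i\<in>{1..k}. m i \<ge> 1" using assms(3) by blast
  have iii_ii: "\<exists>c d R. series_bounds k n m a A c d R \<Longrightarrow> \<exists>Q. Q \<in> cone_ge k n m a A \<and> invertible_op UNIV UNIV Q \<and>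
             (\<forall>i\<in>{1..k}. wot_tendsto_zero (\<lambda>s. (Phi (n i) (a i) (A i) ^^ s) Q))"
    using cone_of_series_bounds[OF m] by blast
  moreover have "\<exists>Q. Q \<in> cone_ge k n m a A \<and> invertible_op UNIV UNIV Q \<and>
             (\<forall>i\<in>{1..k}. wot_tendsto_zero (\<lambda>s. (Phi (n i) (a i) (A i) ^^ s) Q)) \<Longrightarrow>
      \<exists>c d R. series_bounds k n m a A c d R"
    using series_bounds_of_cone[OF m] by blast
  moreover note series_bounds_of_similarity[OF assms(5)] similarity_of_series_bounds[OF assms(5,9)]
  ultimately show ?thesis by meson
qed

end
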